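(* Let $\mu(dx)=\frac1Ze^{-\mathcal H(x)}dx$ be a probability measure on $\mathbb{R}^N$ as in the context. Let $F=(F_1,\dots,F_d):\mathbb{R}^N\to\mathbb{R}^d$ be of class $C^2$ and in $L^2(\mu)$, and denote by $\mu\circ F^{-1}$ the law of $F$ under $\mu$. Then, for any choice of $\kappa_k>0$, $k=1,\dots,d$, $$\mathrm W_2\big(\mu\circ F^{-1},\gamma_d\big)\le A+B,$$ where, with $K=\mathrm{diag}(\kappa_1,\dots,\kappa_d)$, $$A=\Big(\int_{\mathbb{R}^N}\big|F+K^{-1}\mathrm LF\big|^2d\mu\Big)^{1/2},\qquad B=\Big(\int_{\mathbb{R}^N}\big|\mathrm{Id}-K^{-1}\Gamma(F)\big|^2d\mu\Big)^{1/2}.$$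
   Context: $\mathcal H:\mathbb{R}^N\to\mathbb{R}$ is a sufficiently regular function (e.g. smooth) with $Z=\int e^{-\mathcal H}dx<\infty$. For functions $f,g$ on $\mathbb{R}^N$ put $\mathrm Lf=\Delta f-\nabla\mathcal H\cdot\nabla f$ and $\Gamma(f,g)=\nabla f\cdot\nabla g$. Regularity of $\mathcal H$ is used in the form of the integration by parts formula $$\int_{\mathbb{R}^N}f(-\mathrm Lg)\,d\mu=\int_{\mathbb{R}^N}\Gamma(f,g)\,d\mu,$$ which is assumed to hold for all $f\in C^1(\mathbb{R}^N)$, $g\in C^2(\mathbb{R}^N)$ such that $f,|\nabla f|,|\nabla g|,\mathrm Lg\in L^2(\mu)$ (it does when $\mathcal H$ is smooth). For $F=(F_1,\dots,F_d)$: $\mathrm LF=(\mathrm LF_1,\dots,\mathrm LF_d)$ and $\Gamma(F)=(\Gamma(F_k,F_\ell))_{1\le k,\ell\le d}$. The norm $|\cdot|$ is the Euclidean norm on $\mathbb{R}^d$ and the Hilbert–Schmidt norm on $d\times d$ matrices; $A,B$ may be $+\infty$. $\mathrm W_2$ is the Wasserstein-2 distance on $\mathbb{R}^d$ and $\gamma_d$ the standard Gaussian measure on $\mathbb{R}^d$. *)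

theory Defs
  imports "HOL-Probability.Probability"
begin

(* Junk value of the definite description where f is not differentiable. *)
definition gradient :: "('a::real_inner \<Rightarrow> real) \<Rightarrow> 'a \<Rightarrow> 'a" where
  "gradient f x = (THE D. GDERIV f x :> D)"

lemma gradient_eqI:
  assumes "GDERIV f x :> D"
  shows "gradient f x = D"
  unfolding gradient_def
proof (rule the_equality[where P = "\<lambda>E. GDERIV f x :> E", OF assms])
  fix E assume "GDERIV f x :> E"
  then have "(\<lambda>h. inner h E) = (\<lambda>h. inner h D)"
    using assms unfolding gderiv_def by (rule has_derivative_unique)
  then have "inner (E - D) E = inner (E - D) D" by meson
  then have "inner (E - D) (E - D) = 0" by (simp add: inner_diff_right)
  then show "E = D" by simp
qed

definition C1 :: "('a::real_inner \<Rightarrow> real) \<Rightarrow> bool" where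
  "C1 f \<longleftrightarrow> (\<exists>D. (\<forall>x. GDERIV f x :> D x) \<and> continuous_on UNIV D)"

definition C2 :: "(real^'n \<Rightarrow> real) \<Rightarrow> bool" where
  "C2 f \<longleftrightarrow> C1 f \<and> (\<forall>i. C1 (\<lambda>x. gradient f x $ i))"

definition laplacian :: "(real^'n \<Rightarrow> real) \<Rightarrow> real^'n \<Rightarrow> real" where
  "laplacian f x = (\<Sum>i\<in>UNIV. gradient (\<lambda>y. gradient f y $ i) x $ i)"

definition generator :: "(real^'n \<Rightarrow> real) \<Rightarrow> (real^'n \<Rightarrow> real) \<Rightarrow> real^'n \<Rightarrow> real" where
  "generator H f x = laplacian f x - gradient H x \<bullet> gradient f x"

definition carre_du_champ :: "(real^'n \<Rightarrow> real) \<Rightarrow> (real^'n \<Rightarrow> real) \<Rightarrow> real^'n \<Rightarrow> real" where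
  "carre_du_champ f g x = gradient f x \<bullet> gradient g x"

definition generator_vec ::
    "(real^'n \<Rightarrow> real) \<Rightarrow> (real^'n \<Rightarrow> real^'d) \<Rightarrow> real^'n \<Rightarrow> real^'d" where
  "generator_vec H F x = (\<chi> k. generator H (\<lambda>y. F y $ k) x)"

definition carre_du_champ_matrix :: "(real^'n \<Rightarrow> real^'d) \<Rightarrow> real^'n \<Rightarrow> real^'d^'d" where
  "carre_du_champ_matrix F x = (\<chi> k l. carre_du_champ (\<lambda>y. F y $ k) (\<lambda>y. F y $ l) x)"

definition gibbs :: "(real^'n \<Rightarrow> real) \<Rightarrow> (real^'n) measure" where
  "gibbs H = density lborel (\<lambda>x. ennreal (exp (- H x) / (\<integral>y. exp (- H y) \<partial>lborel)))"

definition std_gaussian :: "(real^'d) measure" where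
  "std_gaussian = density lborel (\<lambda>x. ennreal (\<Prod>k\<in>UNIV. std_normal_density (x $ k)))"

definition square_integrable :: "'a measure \<Rightarrow> ('a \<Rightarrow> 'b::real_normed_vector) \<Rightarrow> bool" where
  "square_integrable M f \<longleftrightarrow> f \<in> borel_measurable M \<and> integrable M (\<lambda>x. (norm (f x))\<^sup>2)"

definition ennreal_sqrt :: "ennreal \<Rightarrow> ennreal" where
  "ennreal_sqrt a = (if a = \<top> then \<top> else ennreal (sqrt (enn2real a)))"

definition couplings :: "'a measure \<Rightarrow> 'b measure \<Rightarrow> ('a \<times> 'b) measure set" where
  "couplings M N = {P. sets P = sets (M \<Otimes>\<^sub>M N) \<and> distr P M fst = M \<and> distr P N snd = N}"

(* Takes the value top if no coupling has finite cost. *)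
definition wasserstein2 :: "'a::metric_space measure \<Rightarrow> 'a measure \<Rightarrow> ennreal" where
  "wasserstein2 M N =
     (INF P\<in>couplings M N. ennreal_sqrt (\<integral>\<^sup>+z. ennreal ((dist (fst z) (snd z))\<^sup>2) \<partial>P))"

definition diag_matrix :: "('d \<Rightarrow> real) \<Rightarrow> real^'d^'d" where
  "diag_matrix \<kappa> = (\<chi> k l. if k = l then \<kappa> k else 0)"

end

theory Submission
  imports Defs
begin

text \<open>
Write \<open>X = F\<close> under the Gibbs measure, let \<open>g\<close> be an independent standard Gaussian vector, and
observe \<open>X\<close> through the Gaussian channel \<open>Y\<^sub>s = s X + sqrt s g\<close> with \<open>s > 0\<close>. Let
\<open>m\<^sub>s(y) = E[X | Y\<^sub>s = y]\<close> and \<open>mmse(s) = E |X - m\<^sub>s(Y\<^sub>s)|\<^sup>2\<close>. The proof has two halves: a coupling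
whose cost is a sum of values of \<open>mmse\<close>, and a lower bound for \<open>mmse\<close> from integration by parts.

The coupling. Choose levels \<open>s\<^sub>0 < ... < s\<^sub>n\<close> with steps \<open>r\<^sub>k = s\<^sub>k\<^sub>+\<^sub>1 - s\<^sub>k\<close>. Given \<open>y\<^sub>k\<close>, draw a
fresh sample \<open>x\<close> from the law of \<open>X\<close> given \<open>Y\<^sub>s = y\<^sub>k\<close> at level \<open>s = s\<^sub>k\<close>, draw a fresh Gaussian
\<open>g\<^sub>k\<close>, and put \<open>y\<^sub>k\<^sub>+\<^sub>1 = y\<^sub>k + r\<^sub>k x + sqrt r\<^sub>k g\<^sub>k\<close>. By Bayes' rule \<open>y\<^sub>k\<close> has the law of the
observation at level \<open>s\<^sub>k\<close>, and a final posterior sample \<open>x\<close> has the law of \<open>X\<close>. On the other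
hand each \<open>g\<^sub>k\<close> is independent of the past, so \<open>N = sum of sqrt e\<^sub>k g\<^sub>k\<close> is exactly standard Gaussian
when the weights \<open>e\<^sub>k\<close> add up to 1; an independent first summand and a final top-up, which have no
overlap with the signal, make this exact. Since the posterior mean is a martingale along the chain, the
term \<open>g\<^sub>k\<close> contributes \<open>sqrt (r\<^sub>k e\<^sub>k) mmse(s\<^sub>k\<^sub>+\<^sub>1)\<close> to \<open>E (x \<bullet> N)\<close>, and therefore
\<open>W\<^sub>2\<^sup>2 \<le> E |X|\<^sup>2 + d - 2 (sum of sqrt (r\<^sub>k e\<^sub>k) mmse(s\<^sub>k\<^sub>+\<^sub>1))\<close>. This is a discrete version of the
coupling of \<open>X\<close> with a Brownian motion by the Foellmer process; redrawing \<open>x\<close> at every step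
replaces the stochastic differential equation, and the law of \<open>X\<close> can be arbitrary with a finite
second moment (\<open>overlap_coupling_extend\<close>, \<open>wasserstein2_le_overlap\<close>).

The Stein identity. Put \<open>R = F + K\<^sup>-\<^sup>1 LF\<close>, \<open>T = K\<^sup>-\<^sup>1 \<Gamma>(F)\<close>, \<open>A\<^sup>2 = E |R|\<^sup>2\<close> and
\<open>B\<^sup>2 = E |T - Id|\<^sup>2\<close>. Integration by parts and the chain rule give
\<open>E F\<^sub>k \<psi>(F) = E R\<^sub>k \<psi>(F) + E (T\<^sub>k \<bullet> \<nabla>\<psi>(F))\<close> for every bounded \<open>\<psi>\<close> of class \<open>C\<^sup>1\<close> with bounded gradient.
Take for \<open>\<psi>\<close> the Gaussian smoothing of a function \<open>\<phi>\<close> that is merely bounded and measurable: the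
derivative falls on the Gaussian density, and the identity becomes a statement about
\<open>u(y) = m\<^sub>s(y) - y / (1 + s)\<close>, the deviation from the posterior mean of a Gaussian \<open>X\<close>:
\<open>(1 + s) E (u(Y\<^sub>s) \<bullet> \<phi>(Y\<^sub>s)) = E ((R + sqrt s (T - Id) g) \<bullet> \<phi>(Y\<^sub>s))\<close>. Taking \<open>\<phi>\<close> to be \<open>u\<close> cut off at
large values, and using that the two summands on the right are orthogonal,
\<open>(1 + s)\<^sup>2 E |u(Y\<^sub>s)|\<^sup>2 \<le> A\<^sup>2 + s B\<^sup>2\<close> (\<open>mean_excess_bound\<close>). Expanding squares,
\<open>mmse(s) = (E |X|\<^sup>2 + s d) / (1 + s)\<^sup>2 - E |u(Y\<^sub>s)|\<^sup>2\<close>.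

Along levels with \<open>1 + s\<^sub>k\<close> geometric, the sum above is a Riemann sum for the integral of
\<open>mmse(s) / (1 + s)\<close> over the half-line; with the lower bound for \<open>mmse\<close> it yields
\<open>W\<^sub>2\<^sup>2 \<le> A\<^sup>2 + B\<^sup>2\<close> in the limit, and \<open>sqrt (A\<^sup>2 + B\<^sup>2) \<le> A + B\<close>. If \<open>A\<close> or \<open>B\<close> is infinite there is
nothing to prove; if both are finite, they give the square integrability of \<open>LF\<close> and of \<open>\<nabla>F\<close> that
integration by parts requires.
\<close>

section \<open>Square-integrable functions and laws\<close>

lemma integrable_norm_mult_norm:
  fixes f :: "'a \<Rightarrow> 'b::euclidean_space" and g :: "'a \<Rightarrow> 'c::euclidean_space"
  assumes [measurable]: "f \<in> borel_measurable M" "g \<in> borel_measurable M"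
    and i: "integrable M (\<lambda>x. (norm (f x))\<^sup>2)" "integrable M (\<lambda>x. (norm (g x))\<^sup>2)"
  shows "integrable M (\<lambda>x. norm (f x) * norm (g x))"
proof (rule Bochner_Integration.integrable_bound[OF Bochner_Integration.integrable_add[OF i]])
  show "AE x in M. norm (norm (f x) * norm (g x)) \<le> norm ((norm (f x))\<^sup>2 + (norm (g x))\<^sup>2)"
  proof (intro AE_I2)
    fix x
    have "0 \<le> (norm (f x) - norm (g x))\<^sup>2" by simp
    then have "2 * (norm (f x) * norm (g x)) \<le> (norm (f x))\<^sup>2 + (norm (g x))\<^sup>2"
      by (simp add: power2_diff)
    then have "norm (f x) * norm (g x) \<le> (norm (f x))\<^sup>2 + (norm (g x))\<^sup>2"
      using mult_nonneg_nonneg[OF norm_ge_zero[of "f x"] norm_ge_zero[of "g x"]] by linarith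
    then show "norm (norm (f x) * norm (g x)) \<le> norm ((norm (f x))\<^sup>2 + (norm (g x))\<^sup>2)"
      by (simp add: abs_mult)
  qed
qed measurable

lemma integral_norm_mult_norm_le:
  fixes f :: "'a \<Rightarrow> 'b::euclidean_space" and g :: "'a \<Rightarrow> 'c::euclidean_space"
  assumes m [measurable]: "f \<in> borel_measurable M" "g \<in> borel_measurable M"
    and i: "integrable M (\<lambda>x. (norm (f x))\<^sup>2)" "integrable M (\<lambda>x. (norm (g x))\<^sup>2)"
  shows "(\<integral>x. norm (f x) * norm (g x) \<partial>M)
           \<le> sqrt (\<integral>x. (norm (f x))\<^sup>2 \<partial>M) * sqrt (\<integral>x. (norm (g x))\<^sup>2 \<partial>M)"
proof -
  let ?I = "\<integral>x. norm (f x) * norm (g x) \<partial>M"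
  let ?F = "\<integral>x. (norm (f x))\<^sup>2 \<partial>M" let ?G = "\<integral>x. (norm (g x))\<^sup>2 \<partial>M"
  have pos: "0 \<le> ?I" "0 \<le> ?F" "0 \<le> ?G" by simp_all
  have "(ennreal ?I)\<^sup>2 = (\<integral>\<^sup>+x. ennreal (norm (f x)) * ennreal (norm (g x)) \<partial>M)\<^sup>2"
    by (subst nn_integral_eq_integral[symmetric, OF integrable_norm_mult_norm[OF m i]])
       (simp_all add: ennreal_mult)
  also have "\<dots> \<le> (\<integral>\<^sup>+x. (ennreal (norm (f x)))\<^sup>2 \<partial>M) * (\<integral>\<^sup>+x. (ennreal (norm (g x)))\<^sup>2 \<partial>M)"
    by (rule Cauchy_Schwarz_nn_integral) measurable
  also have "\<dots> = ennreal ?F * ennreal ?G"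
    by (simp add: ennreal_power nn_integral_eq_integral i)
  finally have "ennreal (?I\<^sup>2) \<le> ennreal (?F * ?G)"
    using pos by (simp add: ennreal_power ennreal_mult)
  then have "?I\<^sup>2 \<le> ?F * ?G" using pos by (subst (asm) ennreal_le_iff) simp_all
  then have "?I \<le> sqrt (?F * ?G)" by (rule real_le_rsqrt)
  then show ?thesis by (simp add: real_sqrt_mult)
qed

lemma integrable_inner_L2:
  fixes f g :: "'a \<Rightarrow> 'b::euclidean_space"
  assumes m [measurable]: "f \<in> borel_measurable M" "g \<in> borel_measurable M"
    and i: "integrable M (\<lambda>x. (norm (f x))\<^sup>2)" "integrable M (\<lambda>x. (norm (g x))\<^sup>2)"
  shows "integrable M (\<lambda>x. f x \<bullet> g x)"
  by (rule Bochner_Integration.integrable_bound[OF integrable_norm_mult_norm[OF m i]])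
     (auto simp: Cauchy_Schwarz_ineq2)

lemma integral_inner_L2_le:
  fixes f g :: "'a \<Rightarrow> 'b::euclidean_space"
  assumes m [measurable]: "f \<in> borel_measurable M" "g \<in> borel_measurable M"
    and i: "integrable M (\<lambda>x. (norm (f x))\<^sup>2)" "integrable M (\<lambda>x. (norm (g x))\<^sup>2)"
  shows "(\<integral>x. f x \<bullet> g x \<partial>M) \<le> sqrt (\<integral>x. (norm (f x))\<^sup>2 \<partial>M) * sqrt (\<integral>x. (norm (g x))\<^sup>2 \<partial>M)"
proof -
  have "(\<integral>x. f x \<bullet> g x \<partial>M) \<le> (\<integral>x. norm (f x) * norm (g x) \<partial>M)"
    by (intro integral_mono integrable_inner_L2 integrable_norm_mult_norm m i norm_cauchy_schwarz)
  also note integral_norm_mult_norm_le[OF m i]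
  finally show ?thesis .
qed

lemma integrable_norm_add_L2:
  fixes f g :: "'a \<Rightarrow> 'b::euclidean_space"
  assumes m [measurable]: "f \<in> borel_measurable M" "g \<in> borel_measurable M"
    and i: "integrable M (\<lambda>x. (norm (f x))\<^sup>2)" "integrable M (\<lambda>x. (norm (g x))\<^sup>2)"
  shows "integrable M (\<lambda>x. (norm (f x + g x))\<^sup>2)"
proof -
  have "(norm (f x + g x))\<^sup>2 = (norm (f x))\<^sup>2 + 2 * (f x \<bullet> g x) + (norm (g x))\<^sup>2" for x
    unfolding power2_norm_eq_inner by (simp add: algebra_simps inner_commute)
  then show ?thesis using integrable_inner_L2[OF m i] i by simp
qed

lemma integrable_norm_scaleR_L2:
  fixes f :: "'a \<Rightarrow> 'b::euclidean_space"
  assumes "integrable M (\<lambda>x. (norm (f x))\<^sup>2)"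
  shows "integrable M (\<lambda>x. (norm (c *\<^sub>R f x))\<^sup>2)"
  using assms by (simp add: power_mult_distrib)

lemma (in finite_measure) integrable_of_square:
  fixes f :: "'a \<Rightarrow> 'b::euclidean_space"
  assumes m [measurable]: "f \<in> borel_measurable M" and i: "integrable M (\<lambda>x. (norm (f x))\<^sup>2)"
  shows "integrable M f"
proof (rule Bochner_Integration.integrable_bound)
  show "integrable M (\<lambda>x. 1 + (norm (f x))\<^sup>2)" using i by simp
  have "norm (f x) \<le> 1 + (norm (f x))\<^sup>2" for x
  proof -
    have "2 * norm (f x) \<le> (norm (f x))\<^sup>2 + 1"
      using zero_le_power2[of "norm (f x) - 1"] by (simp add: power2_diff)
    then show ?thesis using norm_ge_zero[of "f x"] by linarith
  qed
  then show "AE x in M. norm (f x) \<le> norm (1 + (norm (f x))\<^sup>2)" by simp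
qed measurable

lemma bounded_mult_integrable:
  fixes f :: "'c \<Rightarrow> real"
  assumes f: "integrable N f" and [measurable]: "h \<in> borel_measurable N" and K: "\<And>x. \<bar>h x\<bar> \<le> K"
  shows "integrable N (\<lambda>x. f x * h x)"
proof (rule Bochner_Integration.integrable_bound)
  show "integrable N (\<lambda>x. K * f x)" using f by simp
  show "(\<lambda>x. f x * h x) \<in> borel_measurable N" using borel_measurable_integrable[OF f] by measurable
  have "0 \<le> K" using K[of undefined] by linarith
  then have "norm (f x * h x) \<le> norm (K * f x)" for x
    using mult_left_mono[OF K[of x], of "\<bar>f x\<bar>"] by (simp add: abs_mult mult.commute)
  then show "AE x in N. norm (f x * h x) \<le> norm (K * f x)" by simp
qed

lemma ennreal_sqrt_ennreal: "0 \<le> c \<Longrightarrow> ennreal_sqrt (ennreal c) = ennreal (sqrt c)"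
  by (simp add: ennreal_sqrt_def)

lemma distr_pair_snd:
  assumes "prob_space M" "sigma_finite_measure N"
  shows "distr (M \<Otimes>\<^sub>M N) N snd = N"
proof (rule measure_eqI)
  interpret M: prob_space M by fact
  interpret N: sigma_finite_measure N by fact
  fix A assume A: "A \<in> sets (distr (M \<Otimes>\<^sub>M N) N snd)"
  have "snd -` A \<inter> space (M \<Otimes>\<^sub>M N) = space M \<times> A"
    using A sets.sets_into_space[of A N] by (auto simp: space_pair_measure)
  then show "emeasure (distr (M \<Otimes>\<^sub>M N) N snd) A = emeasure N A"
    using A by (simp add: emeasure_distr N.emeasure_pair_measure_Times M.emeasure_space_1)
qed simp

text \<open>Laws are compared below through integrals of nonnegative functions, so that Fubini's theorem and
changes of variables apply without integrability conditions.\<close>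
lemma distr_eqI_nn_integral:
  assumes [measurable]: "f \<in> measurable M N" "g \<in> measurable M' N"
    and eq: "\<And>h. h \<in> borel_measurable N \<Longrightarrow> (\<integral>\<^sup>+x. h (f x) \<partial>M) = (\<integral>\<^sup>+x. h (g x) \<partial>M')"
  shows "distr M N f = distr M' N g"
proof (rule measure_eqI)
  fix A assume "A \<in> sets (distr M N f)"
  then have [measurable]: "A \<in> sets N" by simp
  have "emeasure (distr M N f) A = (\<integral>\<^sup>+x. indicator A (f x) \<partial>M)"
    by (simp flip: nn_integral_indicator add: nn_integral_distr)
  also have "\<dots> = (\<integral>\<^sup>+x. indicator A (g x) \<partial>M')" by (rule eq) measurable
  also have "\<dots> = emeasure (distr M' N g) A"
    by (simp flip: nn_integral_indicator add: nn_integral_distr)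
  finally show "emeasure (distr M N f) A = emeasure (distr M' N g) A" .
qed simp

lemma
  fixes h :: "'c \<Rightarrow> 'b::{banach, second_countable_topology}"
  assumes eq: "distr M N f = distr M' N g"
    and m [measurable]: "f \<in> measurable M N" "g \<in> measurable M' N" "h \<in> borel_measurable N"
  shows integral_eq_of_distr_eq: "(\<integral>x. h (f x) \<partial>M) = (\<integral>x. h (g x) \<partial>M')"
    and integrable_eq_of_distr_eq: "integrable M (\<lambda>x. h (f x)) \<longleftrightarrow> integrable M' (\<lambda>x. h (g x))"
  using integral_distr[OF m(1,3)] integral_distr[OF m(2,3)]
    integrable_distr_eq[OF m(1,3)] integrable_distr_eq[OF m(2,3)] by (simp_all add: eq)

lemma
  fixes f :: "'b \<Rightarrow> 'c::{banach, second_countable_topology}"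
  assumes law: "distr P M h = M" and h: "h \<in> measurable P M" and f: "integrable M f"
  shows integrable_of_law: "integrable P (\<lambda>x. f (h x))"
    and integral_of_law: "(\<integral>x. f (h x) \<partial>P) = (\<integral>x. f x \<partial>M)"
proof -
  have "integrable (distr P M h) f" using f by (simp only: law)
  then show "integrable P (\<lambda>x. f (h x))" by (rule integrable_distr[OF h])
  show "(\<integral>x. f (h x) \<partial>P) = (\<integral>x. f x \<partial>M)"
    using integral_distr[OF h borel_measurable_integrable[OF f]] by (simp only: law)
qed

lemma norm_sq_vec: "(norm v)\<^sup>2 = (\<Sum>k\<in>UNIV. (norm (v $ k))\<^sup>2)" for v :: "('b::real_inner)^'n"
  by (simp add: norm_vec_def L2_set_def sum_nonneg)

lemma vec_nth_measurable [measurable (raw)]: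
  fixes f :: "'a \<Rightarrow> ('b::topological_space)^'n"
  assumes "f \<in> borel_measurable M"
  shows "(\<lambda>x. f x $ k) \<in> borel_measurable M"
proof -
  have "(\<lambda>v::'b^'n. v $ k) \<in> borel_measurable borel"
    by (intro borel_measurable_continuous_onI continuous_intros)
  from measurable_compose[OF assms this] show ?thesis .
qed

section \<open>The standard Gaussian measure\<close>

lemma std_gaussian_density_eq:
  "(\<Prod>k\<in>UNIV. std_normal_density ((x::real^'d) $ k))
     = (1 / sqrt (2 * pi)) ^ CARD('d) * exp (- (norm x)\<^sup>2 / 2)"
proof -
  have "(\<Sum>k\<in>UNIV. - (x $ k)\<^sup>2 / 2) = - (norm x)\<^sup>2 / 2"
    by (simp add: norm_vec_def L2_set_def sum_nonneg sum_negf sum_divide_distrib)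
  then have "(\<Prod>k\<in>UNIV. exp (- (x $ k)\<^sup>2 / 2)) = exp (- (norm x)\<^sup>2 / 2)"
    by (simp flip: exp_sum)
  then show ?thesis
    unfolding std_normal_density_def prod.distrib by simp
qed

lemma std_gaussian_density_measurable [measurable]:
  "(\<lambda>x::real^'d. \<Prod>k\<in>UNIV. std_normal_density (x $ k)) \<in> borel_measurable borel"
  unfolding std_gaussian_density_eq by measurable

lemma sets_std_gaussian [simp, measurable_cong]: "sets std_gaussian = sets borel"
  by (simp add: std_gaussian_def)

lemma space_std_gaussian [simp]: "space std_gaussian = UNIV"
  by (simp add: std_gaussian_def)

text \<open>Lebesgue measure on \<open>real^'d\<close> is the image of a product measure indexed by the standard basis,
so Fubini's theorem reduces Gaussian integrals of products to dimension one.\<close>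
lemma std_gaussian_integral_prod:
  fixes h :: "'d::finite \<Rightarrow> real \<Rightarrow> real"
  assumes h: "\<And>i. integrable lborel (\<lambda>t. std_normal_density t * h i t)"
    and [measurable]: "\<And>i. h i \<in> borel_measurable borel"
  shows "integrable std_gaussian (\<lambda>x::real^'d. \<Prod>i\<in>UNIV. h i (x $ i))" (is ?I)
    and "(\<integral>x. (\<Prod>i\<in>UNIV. h i (x $ i)) \<partial>(std_gaussian :: (real^'d) measure))
           = (\<Prod>i\<in>UNIV. \<integral>t. std_normal_density t * h i t \<partial>lborel)" (is ?E)
proof -
  interpret product_sigma_finite "\<lambda>_::real^'d. lborel :: real measure" ..
  define ix where "ix = (inv (\<lambda>i::'d. axis i (1::real)))"
  have inj: "inj (\<lambda>i::'d. axis i (1::real))" by (simp add: inj_on_def axis_eq_axis)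
  have ix [simp]: "ix (axis i 1) = i" for i unfolding ix_def using inj by (rule inv_f_f)
  have Bas: "(Basis :: (real^'d) set) = (\<lambda>i. axis i 1) ` UNIV"
    by (auto simp: Basis_vec_def)
  have reindex: "(\<Prod>b\<in>Basis. k b) = (\<Prod>i\<in>UNIV. k (axis i 1))" for k :: "real^'d \<Rightarrow> real"
    unfolding Bas by (rule prod.reindex_cong[OF inj]) auto
  let ?f = "\<lambda>b t. std_normal_density t * h (ix b) t"
  let ?M = "\<Pi>\<^sub>M b\<in>(Basis::(real^'d) set). (lborel :: real measure)"
  have c: "(\<Sum>b\<in>Basis. f b *\<^sub>R b) $ i = f (axis i 1)" for f i
  proof -
    have "(\<Sum>b\<in>Basis. f b *\<^sub>R b) $ i = (\<Sum>b\<in>Basis. f b *\<^sub>R b) \<bullet> axis i 1"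
      by (simp add: inner_axis)
    also have "\<dots> = f (axis i 1)" by (rule inner_sum_left_Basis) (simp add: Bas)
    finally show ?thesis .
  qed
  have int: "integrable ?M (\<lambda>x. \<Prod>b\<in>Basis. ?f b (x b))"
    by (rule product_integrable_prod) (auto intro: h)
  have val: "(\<integral>x. (\<Prod>b\<in>Basis. ?f b (x b)) \<partial>?M) = (\<Prod>b\<in>Basis. \<integral>t. ?f b t \<partial>lborel)"
    by (rule product_integral_prod) (auto intro: h)
  have m: "(\<lambda>f. \<Sum>b\<in>Basis. f b *\<^sub>R b) \<in> measurable ?M (borel :: (real^'d) measure)"
    by measurable
  let ?k = "\<lambda>x::real^'d. (\<Prod>i\<in>UNIV. std_normal_density (x $ i)) *\<^sub>R (\<Prod>i\<in>UNIV. h i (x $ i))"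
  have eq: "?k (\<Sum>b\<in>Basis. f b *\<^sub>R b) = (\<Prod>b\<in>Basis. ?f b (f b))" for f
    unfolding reindex c by (simp add: prod.distrib)
  have mk: "?k \<in> borel_measurable borel" by measurable
  have ik: "integrable (lborel :: (real^'d) measure) ?k"
    by (subst lborel_eq, subst integrable_distr_eq[OF m mk]) (simp only: eq int)
  have dn: "AE x in lborel. 0 \<le> (\<Prod>i\<in>UNIV. std_normal_density ((x::real^'d) $ i))"
    by (intro AE_I2 prod_nonneg) simp
  have dm: "(\<lambda>x::real^'d. \<Prod>i\<in>UNIV. std_normal_density (x $ i)) \<in> borel_measurable lborel"
    by measurable
  have hm: "(\<lambda>x::real^'d. \<Prod>i\<in>UNIV. h i (x $ i)) \<in> borel_measurable lborel"
    by measurable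
  show ?I unfolding std_gaussian_def
    by (rule integrable_density[OF hm dm dn, THEN iffD2, OF ik])
  have "(\<integral>x. ?k x \<partial>(lborel :: (real^'d) measure)) = (\<Prod>b\<in>Basis. \<integral>t. ?f b t \<partial>lborel)"
    by (subst lborel_eq, subst integral_distr[OF m mk]) (simp only: eq val)
  then show ?E unfolding std_gaussian_def reindex ix integral_density[OF hm dm dn] .
qed

lemma prob_space_std_gaussian: "prob_space (std_gaussian :: (real^'d) measure)"
proof -
  have "(\<integral>t. std_normal_density t \<partial>lborel) = 1"
    using integral_std_normal_moment_even[of 0] by simp
  moreover have i: "integrable lborel std_normal_density"
    using integrable_std_normal_moment[of 0] by simp
  ultimately have *: "integrable (std_gaussian :: (real^'d) measure) (\<lambda>_. 1::real)"
    "(\<integral>x. 1 \<partial>(std_gaussian :: (real^'d) measure)) = (1::real)"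
    using std_gaussian_integral_prod[of "\<lambda>(_::'d) _. 1"] by simp_all
  have "emeasure (std_gaussian :: (real^'d) measure) (space std_gaussian)
     = (\<integral>\<^sup>+x. ennreal 1 \<partial>(std_gaussian :: (real^'d) measure))" by simp
  also have "\<dots> = ennreal (\<integral>x. 1 \<partial>(std_gaussian :: (real^'d) measure))"
    by (rule nn_integral_eq_integral[OF *(1)]) simp
  finally show ?thesis using *(2) by (intro prob_spaceI) (simp del: lebesgue_integral_const)
qed

interpretation std_gaussian: prob_space "std_gaussian :: (real^'d) measure"
  by (rule prob_space_std_gaussian)

lemma std_gaussian_moments:
  fixes i j :: "'d::finite"
  shows "integrable std_gaussian (\<lambda>x::real^'d. x $ i)"
    and "(\<integral>x. x $ i \<partial>(std_gaussian :: (real^'d) measure)) = 0"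
    and "integrable std_gaussian (\<lambda>x::real^'d. x $ i * x $ j)"
    and "(\<integral>x. x $ i * x $ j \<partial>(std_gaussian :: (real^'d) measure)) = (if i = j then 1 else 0)"
proof -
  have m: "integrable lborel std_normal_density"
    "(\<integral>t. std_normal_density t \<partial>lborel) = 1"
    "integrable lborel (\<lambda>t. std_normal_density t * t)"
    "(\<integral>t. std_normal_density t * t \<partial>lborel) = 0"
    "integrable lborel (\<lambda>t. std_normal_density t * (t * t))"
    "(\<integral>t. std_normal_density t * (t * t) \<partial>lborel) = 1"
    using integrable_std_normal_moment[of 0] integral_std_normal_moment_even[of 0]
      integrable_std_normal_moment[of 1] integral_std_normal_moment_odd[of 0]
      integrable_std_normal_moment[of 2] integral_std_normal_moment_even[of 1]
    by (simp_all add: power2_eq_square)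
  have p1: "(\<Prod>k\<in>UNIV. (if k = i then t k else 1)) = t i" for t :: "'d \<Rightarrow> real"
    by (simp add: prod.delta)
  let ?h = "\<lambda>(k::'d) (t::real). if k = i then t else 1"
  note P = std_gaussian_integral_prod[of ?h]
  have *: "integrable lborel (\<lambda>t. std_normal_density t * ?h k t)" for k
    using m by (cases "k = i") simp_all
  have **: "?h k \<in> borel_measurable borel" for k by (cases "k = i") simp_all
  have "(\<Prod>k\<in>UNIV. \<integral>t. std_normal_density t * ?h k t \<partial>lborel) = 0"
  proof (rule prod_zero)
    show "\<exists>k\<in>UNIV. (\<integral>t. std_normal_density t * ?h k t \<partial>lborel) = 0"
      using m by (intro bexI[of _ i]) simp_all
  qed simp
  then show "integrable std_gaussian (\<lambda>x::real^'d. x $ i)"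
    and "(\<integral>x. x $ i \<partial>(std_gaussian :: (real^'d) measure)) = 0"
    using P(1)[OF * **] P(2)[OF * **] unfolding p1 by simp_all
  let ?h = "\<lambda>(k::'d) (t::real). (if k = i then t else 1) * (if k = j then t else 1)"
  note P = std_gaussian_integral_prod[of ?h]
  have *: "integrable lborel (\<lambda>t. std_normal_density t * ?h k t)" for k
    using m by (cases "k = i"; cases "k = j") simp_all
  have **: "?h k \<in> borel_measurable borel" for k by (cases "k = i"; cases "k = j") simp_all
  have val: "(\<Prod>k\<in>UNIV. \<integral>t. std_normal_density t * ?h k t \<partial>lborel) = (if i = j then 1 else 0)"
  proof (cases "i = j")
    case True
    have "(\<integral>t. std_normal_density t * ?h k t \<partial>lborel) = 1" for k
      using m True by (cases "k = i") simp_all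
    then show ?thesis using True by simp
  next
    case False
    then have "(\<integral>t. std_normal_density t * ?h i t \<partial>lborel) = 0" using m by simp
    then have "\<exists>k\<in>UNIV. (\<integral>t. std_normal_density t * ?h k t \<partial>lborel) = 0" by blast
    then have "(\<Prod>k\<in>UNIV. \<integral>t. std_normal_density t * ?h k t \<partial>lborel) = 0"
      by (intro prod_zero) simp_all
    then show ?thesis using False by simp
  qed
  have pp: "(\<Prod>k\<in>UNIV. ?h k (x $ k)) = x $ i * x $ j" for x :: "real^'d"
    unfolding prod.distrib p1 by simp
  then show "integrable std_gaussian (\<lambda>x::real^'d. x $ i * x $ j)"
    and "(\<integral>x. x $ i * x $ j \<partial>(std_gaussian :: (real^'d) measure)) = (if i = j then 1 else 0)"
    using P(1)[OF * **] P(2)[OF * **] unfolding pp val by simp_all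
qed

lemma std_gaussian_inner_moments:
  fixes v w :: "real^'d"
  shows "integrable std_gaussian (\<lambda>x::real^'d. v \<bullet> x)"
    and "(\<integral>x. v \<bullet> x \<partial>std_gaussian) = 0"
    and "integrable std_gaussian (\<lambda>x::real^'d. (v \<bullet> x) * (w \<bullet> x))"
    and "(\<integral>x. (v \<bullet> x) * (w \<bullet> x) \<partial>std_gaussian) = v \<bullet> w"
proof -
  show "integrable std_gaussian (\<lambda>x::real^'d. v \<bullet> x)"
    and "(\<integral>x. v \<bullet> x \<partial>std_gaussian) = 0"
    unfolding inner_vec_def by (simp_all add: std_gaussian_moments)
  have *: "(v \<bullet> x) * (w \<bullet> x) = (\<Sum>i\<in>UNIV. \<Sum>j\<in>UNIV. (v $ i * w $ j) * (x $ i * x $ j))"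
    for x :: "real^'d"
    unfolding inner_vec_def sum_product by (simp add: ac_simps)
  show "integrable std_gaussian (\<lambda>x::real^'d. (v \<bullet> x) * (w \<bullet> x))"
    unfolding * by (simp add: std_gaussian_moments)
  show "(\<integral>x. (v \<bullet> x) * (w \<bullet> x) \<partial>std_gaussian) = v \<bullet> w"
    unfolding * by (simp add: std_gaussian_moments inner_vec_def if_distrib[of "(*) _"] sum.delta cong: if_cong)
qed

lemma std_gaussian_density:
  "std_gaussian = density lborel
     (\<lambda>x::real^'d. ennreal ((1 / sqrt (2 * pi)) ^ CARD('d) * exp (- (norm x)\<^sup>2 / 2)))"
  unfolding std_gaussian_def std_gaussian_density_eq ..

lemma nn_integral_lborel_translate:
  fixes f :: "'a::euclidean_space \<Rightarrow> ennreal"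
  assumes [measurable]: "f \<in> borel_measurable borel"
  shows "(\<integral>\<^sup>+x. f (x + a) \<partial>lborel) = (\<integral>\<^sup>+x. f x \<partial>lborel)"
proof -
  have "(\<integral>\<^sup>+x. f x \<partial>lborel) = (\<integral>\<^sup>+x. f x \<partial>distr lborel borel ((+) a))"
    by (simp add: lborel_distr_plus)
  also have "\<dots> = (\<integral>\<^sup>+x. f (x + a) \<partial>lborel)"
    by (subst nn_integral_distr) (simp_all add: add.commute)
  finally show ?thesis ..
qed

text \<open>Translation invariance of Lebesgue measure; the density appears by completing the square in
\<open>- |g - a|\<^sup>2 / 2\<close>.\<close>
lemma cameron_martin:
  fixes a :: "real^'d"
  shows "distr std_gaussian borel (\<lambda>g. g + a)
     = density std_gaussian (\<lambda>g. ennreal (exp (a \<bullet> g - (norm a)\<^sup>2 / 2)))"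
proof (rule measure_eqI)
  fix A :: "(real^'d) set" assume "A \<in> sets (distr std_gaussian borel (\<lambda>g. g + a))"
  then have [measurable]: "A \<in> sets borel" by simp
  let ?c = "(1 / sqrt (2 * pi)) ^ CARD('d)"
  have c: "0 \<le> ?c" by simp
  have "emeasure (distr std_gaussian borel (\<lambda>g. g + a)) A
      = (\<integral>\<^sup>+g. indicator A (g + a) \<partial>std_gaussian)"
    by (simp flip: nn_integral_indicator add: nn_integral_distr)
  also have "\<dots> = (\<integral>\<^sup>+g. ennreal (?c * exp (- (norm (g + a - a))\<^sup>2 / 2)) * indicator A (g + a) \<partial>lborel)"
    by (simp add: std_gaussian_density nn_integral_density)
  also have "\<dots> = (\<integral>\<^sup>+g. ennreal (?c * exp (- (norm (g - a))\<^sup>2 / 2)) * indicator A g \<partial>lborel)"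
    by (subst nn_integral_lborel_translate) simp_all
  also have "\<dots> = (\<integral>\<^sup>+g. ennreal (?c * exp (- (norm g)\<^sup>2 / 2)) *
        (ennreal (exp (a \<bullet> g - (norm a)\<^sup>2 / 2)) * indicator A g) \<partial>lborel)"
  proof (rule nn_integral_cong)
    fix g :: "real^'d"
    have "- (norm (g - a))\<^sup>2 / 2 = - (norm g)\<^sup>2 / 2 + (a \<bullet> g - (norm a)\<^sup>2 / 2)"
      unfolding power2_norm_eq_inner by (simp add: inner_diff_left inner_diff_right inner_commute field_simps)
    then have "?c * exp (- (norm (g - a))\<^sup>2 / 2)
        = (?c * exp (- (norm g)\<^sup>2 / 2)) * exp (a \<bullet> g - (norm a)\<^sup>2 / 2)"
      unfolding mult.assoc by (simp only: exp_add)
    then show "ennreal (?c * exp (- (norm (g - a))\<^sup>2 / 2)) * indicator A g =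
       ennreal (?c * exp (- (norm g)\<^sup>2 / 2)) * (ennreal (exp (a \<bullet> g - (norm a)\<^sup>2 / 2)) * indicator A g)"
      using c by (simp only: ennreal_mult mult.assoc exp_ge_zero mult_nonneg_nonneg)
  qed
  also have "\<dots> = emeasure (density std_gaussian (\<lambda>g. ennreal (exp (a \<bullet> g - (norm a)\<^sup>2 / 2)))) A"
    by (simp add: emeasure_density std_gaussian_density nn_integral_density)
  finally show "emeasure (distr std_gaussian borel (\<lambda>g. g + a)) A = \<dots>" .
qed simp

lemma nn_integral_lborel_swap:
  fixes f :: "'a::euclidean_space \<times> 'a \<Rightarrow> ennreal"
  assumes "f \<in> borel_measurable borel"
  shows "(\<integral>\<^sup>+b. \<integral>\<^sup>+a. f (a, b) \<partial>lborel \<partial>lborel) = (\<integral>\<^sup>+a. \<integral>\<^sup>+b. f (a, b) \<partial>lborel \<partial>lborel)"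
proof -
  have "(\<lambda>(a, b). f (a, b)) \<in> borel_measurable (lborel \<Otimes>\<^sub>M lborel)"
    using assms by (simp add: lborel_prod)
  then show ?thesis by (rule lborel_pair.Fubini')
qed

lemma nn_integral_lborel_shear:
  fixes f :: "'a::euclidean_space \<times> 'a \<Rightarrow> ennreal"
  assumes f: "f \<in> borel_measurable borel"
  shows "(\<integral>\<^sup>+b. \<integral>\<^sup>+a. f (a + p *\<^sub>R b, b) \<partial>lborel \<partial>lborel) = (\<integral>\<^sup>+b. \<integral>\<^sup>+a. f (a, b) \<partial>lborel \<partial>lborel)"
proof (rule nn_integral_cong)
  fix b :: 'a
  have "(\<lambda>a. f (a, b)) \<in> borel_measurable borel"
    by (rule measurable_compose[OF _ f]) (simp add: borel_prod[symmetric])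
  from nn_integral_lborel_translate[OF this]
  show "(\<integral>\<^sup>+a. f (a + p *\<^sub>R b, b) \<partial>lborel) = (\<integral>\<^sup>+a. f (a, b) \<partial>lborel)" by simp
qed

text \<open>A plane rotation by the angle \<open>\<theta>\<close> is a product of three shears, with coefficients
\<open>tan (\<theta>/2)\<close>, \<open>- sin \<theta>\<close>, \<open>tan (\<theta>/2)\<close>. Each shear translates one variable by a function of the other,
so translation invariance in each variable suffices.\<close>
lemma nn_integral_lborel_rotate:
  fixes f :: "'a::euclidean_space \<times> 'a \<Rightarrow> ennreal"
  assumes f: "f \<in> borel_measurable borel"
    and cs: "\<alpha>\<^sup>2 + \<beta>\<^sup>2 = 1" "0 < \<alpha>"
  shows "(\<integral>\<^sup>+b. \<integral>\<^sup>+a. f (\<alpha> *\<^sub>R a + \<beta> *\<^sub>R b, \<alpha> *\<^sub>R b - \<beta> *\<^sub>R a) \<partial>lborel \<partial>lborel)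
     = (\<integral>\<^sup>+b. \<integral>\<^sup>+a. f (a, b) \<partial>lborel \<partial>lborel)"
proof -
  \<comment> \<open>The tangent of half the rotation angle.\<close>
  define p where "p = \<beta> / (1 + \<alpha>)"
  have "\<beta>\<^sup>2 = (1 - \<alpha>) * (1 + \<alpha>)" using cs(1) by (simp add: algebra_simps power2_eq_square)
  then have pb: "p * \<beta> = 1 - \<alpha>" unfolding p_def power2_eq_square using cs(2) by (simp add: field_simps)
  have "p + p * \<alpha> = p * (1 + \<alpha>)" by (simp add: algebra_simps)
  then have pa: "p + p * \<alpha> = \<beta>" unfolding p_def using cs(2) by simp
  define f1 where "f1 = (\<lambda>z. f (fst z + p *\<^sub>R snd z, snd z))"
  define f2 where "f2 = (\<lambda>z. f1 (fst z, snd z + (- \<beta>) *\<^sub>R fst z))"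
  have f1: "f1 \<in> borel_measurable borel"
    unfolding f1_def by (rule measurable_compose[OF _ f]) (simp add: borel_prod[symmetric])
  have f2: "f2 \<in> borel_measurable borel"
    unfolding f2_def by (rule measurable_compose[OF _ f1]) (simp add: borel_prod[symmetric])
  have f1': "(\<lambda>z. f1 (snd z, fst z)) \<in> borel_measurable borel"
    by (rule measurable_compose[OF _ f1]) (simp add: borel_prod[symmetric])
  have "f (\<alpha> *\<^sub>R a + \<beta> *\<^sub>R b, \<alpha> *\<^sub>R b - \<beta> *\<^sub>R a) = f2 (a + p *\<^sub>R b, b)" for a b
  proof -
    have "b + - \<beta> *\<^sub>R (a + p *\<^sub>R b) = (1 - p * \<beta>) *\<^sub>R b - \<beta> *\<^sub>R a" by (simp add: algebra_simps)
    then have 1: "b + - \<beta> *\<^sub>R (a + p *\<^sub>R b) = \<alpha> *\<^sub>R b - \<beta> *\<^sub>R a" unfolding pb by simp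
    have "a + p *\<^sub>R b + p *\<^sub>R (\<alpha> *\<^sub>R b - \<beta> *\<^sub>R a) = (1 - p * \<beta>) *\<^sub>R a + (p + p * \<alpha>) *\<^sub>R b"
      by (simp add: algebra_simps)
    then show ?thesis unfolding f2_def f1_def fst_conv snd_conv 1 unfolding pa pb by simp
  qed
  then have "(\<integral>\<^sup>+b. \<integral>\<^sup>+a. f (\<alpha> *\<^sub>R a + \<beta> *\<^sub>R b, \<alpha> *\<^sub>R b - \<beta> *\<^sub>R a) \<partial>lborel \<partial>lborel)
      = (\<integral>\<^sup>+b. \<integral>\<^sup>+a. f2 (a + p *\<^sub>R b, b) \<partial>lborel \<partial>lborel)" by simp
  also have "\<dots> = (\<integral>\<^sup>+b. \<integral>\<^sup>+a. f2 (a, b) \<partial>lborel \<partial>lborel)" by (rule nn_integral_lborel_shear[OF f2])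
  also have "\<dots> = (\<integral>\<^sup>+a. \<integral>\<^sup>+b. f2 (a, b) \<partial>lborel \<partial>lborel)" by (rule nn_integral_lborel_swap[OF f2])
  also have "\<dots> = (\<integral>\<^sup>+a. \<integral>\<^sup>+b. f1 (a, b) \<partial>lborel \<partial>lborel)"
    unfolding f2_def using nn_integral_lborel_shear[OF f1', of "- \<beta>"] by simp
  also have "\<dots> = (\<integral>\<^sup>+b. \<integral>\<^sup>+a. f1 (a, b) \<partial>lborel \<partial>lborel)"
    by (rule nn_integral_lborel_swap[OF f1, symmetric])
  also have "\<dots> = (\<integral>\<^sup>+b. \<integral>\<^sup>+a. f (a, b) \<partial>lborel \<partial>lborel)"
    unfolding f1_def fst_conv snd_conv by (rule nn_integral_lborel_shear[OF f])
  finally show ?thesis .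
qed

text \<open>The product density depends only on \<open>|a|\<^sup>2 + |b|\<^sup>2\<close>, which a rotation preserves. This one fact gives
both the addition rule for independent Gaussians and their orthogonal decomposition.\<close>
lemma std_gaussian_rotate:
  assumes cs: "\<alpha>\<^sup>2 + \<beta>\<^sup>2 = 1" "0 < \<alpha>"
  shows "distr (std_gaussian \<Otimes>\<^sub>M std_gaussian) (borel \<Otimes>\<^sub>M borel)
      (\<lambda>(b, a). (\<alpha> *\<^sub>R b - \<beta> *\<^sub>R a, \<alpha> *\<^sub>R a + \<beta> *\<^sub>R b))
    = (std_gaussian \<Otimes>\<^sub>M std_gaussian :: ((real^'d) \<times> (real^'d)) measure)" (is "?L = ?R")
proof (rule measure_eqI)
  show "sets ?L = sets ?R" by (simp cong: sets_pair_measure_cong)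
  fix A assume "A \<in> sets ?L"
  then have [measurable]: "A \<in> sets (borel \<Otimes>\<^sub>M borel)" by simp
  let ?c = "(1 / sqrt (2 * pi)) ^ CARD('d)"
  let ?p = "\<lambda>x::real^'d. ennreal (?c * exp (- (norm x)\<^sup>2 / 2))"
  define f where "f = (\<lambda>z. ?p (fst z) * ?p (snd z) * indicator A (snd z, fst z) :: ennreal)"
  have f: "f \<in> borel_measurable borel"
    unfolding f_def borel_prod[symmetric] by measurable
  have pp: "?p (\<alpha> *\<^sub>R a + \<beta> *\<^sub>R b) * ?p (\<alpha> *\<^sub>R b - \<beta> *\<^sub>R a) = ?p a * ?p b" for a b
  proof -
    have "(norm (\<alpha> *\<^sub>R a + \<beta> *\<^sub>R b))\<^sup>2 + (norm (\<alpha> *\<^sub>R b - \<beta> *\<^sub>R a))\<^sup>2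
       = (\<alpha>\<^sup>2 + \<beta>\<^sup>2) * ((norm a)\<^sup>2 + (norm b)\<^sup>2)"
      unfolding power2_norm_eq_inner by (simp add: algebra_simps inner_commute power2_eq_square)
    then have "exp (- (norm (\<alpha> *\<^sub>R a + \<beta> *\<^sub>R b))\<^sup>2 / 2) * exp (- (norm (\<alpha> *\<^sub>R b - \<beta> *\<^sub>R a))\<^sup>2 / 2)
      = exp (- (norm a)\<^sup>2 / 2) * exp (- (norm b)\<^sup>2 / 2)"
      using cs(1) by (simp flip: exp_add add: field_simps)
    then have "(?c * exp (- (norm (\<alpha> *\<^sub>R a + \<beta> *\<^sub>R b))\<^sup>2 / 2)) * (?c * exp (- (norm (\<alpha> *\<^sub>R b - \<beta> *\<^sub>R a))\<^sup>2 / 2))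
      = (?c * exp (- (norm a)\<^sup>2 / 2)) * (?c * exp (- (norm b)\<^sup>2 / 2))"
      by (simp add: algebra_simps)
    then show ?thesis by (simp flip: ennreal_mult)
  qed
  have pair: "(\<integral>\<^sup>+z. h z \<partial>?R) = (\<integral>\<^sup>+b. \<integral>\<^sup>+a. ?p a * ?p b * h (b, a) \<partial>lborel \<partial>lborel)"
    if [measurable]: "h \<in> borel_measurable (borel \<Otimes>\<^sub>M borel)" for h
  proof -
    have "(\<integral>\<^sup>+z. h z \<partial>?R) = (\<integral>\<^sup>+b. \<integral>\<^sup>+a. h (b, a) \<partial>std_gaussian \<partial>std_gaussian)"
      by (subst std_gaussian.nn_integral_fst[symmetric]) simp_all
    also have "\<dots> = (\<integral>\<^sup>+b. ?p b * (\<integral>\<^sup>+a. ?p a * h (b, a) \<partial>lborel) \<partial>lborel)"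
      unfolding std_gaussian_density by (simp add: nn_integral_density)
    also have "\<dots> = (\<integral>\<^sup>+b. \<integral>\<^sup>+a. ?p a * ?p b * h (b, a) \<partial>lborel \<partial>lborel)"
      by (simp flip: nn_integral_cmult add: ac_simps)
    finally show ?thesis .
  qed
  have "emeasure ?L A = (\<integral>\<^sup>+z. indicator A z \<partial>?L)" by simp
  also have "\<dots> = (\<integral>\<^sup>+z. indicator A (case z of (b, a) \<Rightarrow> (\<alpha> *\<^sub>R b - \<beta> *\<^sub>R a, \<alpha> *\<^sub>R a + \<beta> *\<^sub>R b)) \<partial>?R)"
    by (subst nn_integral_distr) simp_all
  also have "\<dots> = (\<integral>\<^sup>+b. \<integral>\<^sup>+a. f (\<alpha> *\<^sub>R a + \<beta> *\<^sub>R b, \<alpha> *\<^sub>R b - \<beta> *\<^sub>R a) \<partial>lborel \<partial>lborel)"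
    unfolding f_def fst_conv snd_conv pp by (subst pair) simp_all
  also have "\<dots> = (\<integral>\<^sup>+b. \<integral>\<^sup>+a. f (a, b) \<partial>lborel \<partial>lborel)"
    by (rule nn_integral_lborel_rotate[OF f cs])
  also have "\<dots> = (\<integral>\<^sup>+z. indicator A z \<partial>?R)"
    by (subst pair) (simp_all add: f_def)
  also have "\<dots> = emeasure ?R A" by simp
  finally show "emeasure ?L A = emeasure ?R A" .
qed

text \<open>The density of the law of \<open>g + a\<close> with respect to that of \<open>g\<close>.\<close>
abbreviation tilt_weight :: "real^'d \<Rightarrow> real^'d \<Rightarrow> real" where
  "tilt_weight a g \<equiv> exp (a \<bullet> g - (norm a)\<^sup>2 / 2)"

lemma cameron_martin_integral:
  fixes f :: "real^'d \<Rightarrow> 'b::{banach, second_countable_topology}"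
  assumes [measurable]: "f \<in> borel_measurable borel"
  shows "(\<integral>g. f (g + a) \<partial>std_gaussian) = (\<integral>g. tilt_weight a g *\<^sub>R f g \<partial>std_gaussian)"
    and "integrable std_gaussian (\<lambda>g. f (g + a)) \<longleftrightarrow> integrable std_gaussian (\<lambda>g. tilt_weight a g *\<^sub>R f g)"
proof -
  have "(\<integral>g. f (g + a) \<partial>std_gaussian) = (\<integral>g. f g \<partial>distr std_gaussian borel (\<lambda>g. g + a))"
    by (simp add: integral_distr)
  then show "(\<integral>g. f (g + a) \<partial>std_gaussian) = (\<integral>g. tilt_weight a g *\<^sub>R f g \<partial>std_gaussian)"
    unfolding cameron_martin by (simp add: integral_density)
  have "integrable std_gaussian (\<lambda>g. f (g + a)) \<longleftrightarrow> integrable (distr std_gaussian borel (\<lambda>g. g + a)) f"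
    by (simp add: integrable_distr_eq)
  then show "integrable std_gaussian (\<lambda>g. f (g + a)) \<longleftrightarrow> integrable std_gaussian (\<lambda>g. tilt_weight a g *\<^sub>R f g)"
    unfolding cameron_martin by (simp add: integrable_density)
qed

lemma cameron_martin_nn_integral:
  fixes f :: "real^'d \<Rightarrow> ennreal"
  assumes [measurable]: "f \<in> borel_measurable borel"
  shows "(\<integral>\<^sup>+g. f (g + a) \<partial>std_gaussian) = (\<integral>\<^sup>+g. ennreal (tilt_weight a g) * f g \<partial>std_gaussian)"
proof -
  have "(\<integral>\<^sup>+g. f (g + a) \<partial>std_gaussian) = (\<integral>\<^sup>+g. f g \<partial>distr std_gaussian borel (\<lambda>g. g + a))"
    by (simp add: nn_integral_distr)
  then show ?thesis unfolding cameron_martin by (simp add: nn_integral_density)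
qed

lemma tilt_weight_moments:
  fixes a v :: "real^'d"
  shows "integrable std_gaussian (tilt_weight a)"
    and "(\<integral>g. tilt_weight a g \<partial>std_gaussian) = 1"
    and "integrable std_gaussian (\<lambda>g. tilt_weight a g * (v \<bullet> g))"
    and "(\<integral>g. tilt_weight a g * (v \<bullet> g) \<partial>std_gaussian) = v \<bullet> a"
    and "integrable std_gaussian (\<lambda>g. (tilt_weight a g)\<^sup>2)"
    and "(\<integral>g. (tilt_weight a g)\<^sup>2 \<partial>std_gaussian) = exp ((norm a)\<^sup>2)"
proof -
  show 1: "integrable std_gaussian (tilt_weight a)" "(\<integral>g. tilt_weight a g \<partial>std_gaussian) = 1" for a :: "real^'d"
    using cameron_martin_integral[of "\<lambda>_. 1::real" a] by (simp_all add: std_gaussian.prob_space[simplified])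
  show "integrable std_gaussian (\<lambda>g. tilt_weight a g * (v \<bullet> g))"
    "(\<integral>g. tilt_weight a g * (v \<bullet> g) \<partial>std_gaussian) = v \<bullet> a"
    using cameron_martin_integral[of "\<lambda>g. v \<bullet> g" a] std_gaussian_inner_moments[of v]
    by (simp_all add: inner_add_right std_gaussian.prob_space[simplified])
  \<comment> \<open>The square of a Cameron-Martin density is, up to a constant, the density for twice the shift.\<close>
  have "(tilt_weight a g)\<^sup>2 = exp ((norm a)\<^sup>2) * tilt_weight (2 *\<^sub>R a) g" for g
    by (simp add: power2_eq_square flip: exp_add)
  then show "integrable std_gaussian (\<lambda>g. (tilt_weight a g)\<^sup>2)"
    "(\<integral>g. (tilt_weight a g)\<^sup>2 \<partial>std_gaussian) = exp ((norm a)\<^sup>2)"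
    using 1[of "2 *\<^sub>R a"] by simp_all
qed

text \<open>The errors in the expansion of the Cameron-Martin density in \<open>a\<close>, measured in \<open>L\<^sup>2\<close>: of
order \<open>|a|\<close> after the constant term and of order \<open>|a|\<^sup>2\<close> after the linear term. Smoothing a bounded
function inherits its derivative from this expansion.\<close>
lemma tilt_weight_expansion:
  fixes a :: "real^'d"
  shows "integrable std_gaussian (\<lambda>g. \<bar>tilt_weight a g - 1\<bar>\<^sup>2)"
    and "(\<integral>g. \<bar>tilt_weight a g - 1\<bar>\<^sup>2 \<partial>std_gaussian) = exp ((norm a)\<^sup>2) - 1"
    and "integrable std_gaussian (\<lambda>g. \<bar>tilt_weight a g - 1 - a \<bullet> g\<bar>\<^sup>2)"
    and "(\<integral>g. \<bar>tilt_weight a g - 1 - a \<bullet> g\<bar>\<^sup>2 \<partial>std_gaussian) = exp ((norm a)\<^sup>2) - 1 - (norm a)\<^sup>2"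
proof -
  note [simp] = tilt_weight_moments std_gaussian_inner_moments std_gaussian.prob_space[simplified]
  have 1: "\<bar>tilt_weight a g - 1\<bar>\<^sup>2 = (tilt_weight a g)\<^sup>2 - 2 * tilt_weight a g + 1" for g
    by (simp add: power2_diff)
  show "integrable std_gaussian (\<lambda>g. \<bar>tilt_weight a g - 1\<bar>\<^sup>2)"
    "(\<integral>g. \<bar>tilt_weight a g - 1\<bar>\<^sup>2 \<partial>std_gaussian) = exp ((norm a)\<^sup>2) - 1"
    unfolding 1 by simp_all
  have 2: "\<bar>tilt_weight a g - 1 - a \<bullet> g\<bar>\<^sup>2 = (tilt_weight a g)\<^sup>2 - 2 * tilt_weight a g + 1
     - 2 * (tilt_weight a g * (a \<bullet> g)) + 2 * (a \<bullet> g) + (a \<bullet> g) * (a \<bullet> g)" for g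
    by (simp add: power2_eq_square algebra_simps)
  show "integrable std_gaussian (\<lambda>g. \<bar>tilt_weight a g - 1 - a \<bullet> g\<bar>\<^sup>2)"
    "(\<integral>g. \<bar>tilt_weight a g - 1 - a \<bullet> g\<bar>\<^sup>2 \<partial>std_gaussian) = exp ((norm a)\<^sup>2) - 1 - (norm a)\<^sup>2"
    unfolding 2 by (simp_all add: dot_square_norm)
qed

interpretation std_gaussian_pair:
  pair_prob_space "std_gaussian :: (real^'d) measure" "std_gaussian :: (real^'d) measure" ..

lemma measurable_std_gaussian_pair [simp]:
  "f \<in> measurable (std_gaussian \<Otimes>\<^sub>M std_gaussian) N \<longleftrightarrow> f \<in> measurable (borel \<Otimes>\<^sub>M borel) N"
  by (intro iffI; subst measurable_cong_sets[OF sets_pair_measure_cong refl]; simp)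

lemma std_gaussian_sum_law:
  assumes "0 \<le> t" "0 < e"
  shows "distr (std_gaussian \<Otimes>\<^sub>M std_gaussian) borel (\<lambda>z. sqrt t *\<^sub>R fst z + sqrt e *\<^sub>R snd z)
    = distr std_gaussian borel (\<lambda>g::real^'d. sqrt (t + e) *\<^sub>R g)"
proof -
  define \<alpha> where "\<alpha> = sqrt (e / (t + e))"
  define \<beta> where "\<beta> = sqrt (t / (t + e))"
  let ?G = "std_gaussian \<Otimes>\<^sub>M std_gaussian :: ((real^'d) \<times> (real^'d)) measure"
  let ?rot = "\<lambda>(b, a). (\<alpha> *\<^sub>R b - \<beta> *\<^sub>R a, \<alpha> *\<^sub>R a + \<beta> *\<^sub>R b) :: (real^'d) \<times> (real^'d)"
  have ab: "\<alpha>\<^sup>2 + \<beta>\<^sup>2 = 1" "0 < \<alpha>"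
    using assms by (simp_all add: \<alpha>_def \<beta>_def flip: add_divide_distrib)
  have c: "sqrt t = sqrt (t + e) * \<beta>" "sqrt e = sqrt (t + e) * \<alpha>"
    using assms by (simp_all add: \<alpha>_def \<beta>_def real_sqrt_divide)
  have "distr ?G borel (\<lambda>z. sqrt t *\<^sub>R fst z + sqrt e *\<^sub>R snd z)
      = distr ?G borel ((\<lambda>z. sqrt (t + e) *\<^sub>R snd z) \<circ> ?rot)"
    by (intro distr_cong) (auto simp: c algebra_simps)
  also have "\<dots> = distr (distr ?G (borel \<Otimes>\<^sub>M borel) ?rot) borel (\<lambda>z. sqrt (t + e) *\<^sub>R snd z)"
    by (subst distr_distr) simp_all
  also have "\<dots> = distr ?G borel ((\<lambda>g. sqrt (t + e) *\<^sub>R g) \<circ> snd)"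
    unfolding std_gaussian_rotate[OF ab] by (simp add: comp_def)
  also have "\<dots> = distr (distr ?G std_gaussian snd) borel (\<lambda>g. sqrt (t + e) *\<^sub>R g)"
    by (subst distr_distr) simp_all
  also have "distr ?G std_gaussian snd = std_gaussian"
    by (intro distr_pair_snd prob_space_std_gaussian std_gaussian.sigma_finite_measure_axioms)
  finally show ?thesis .
qed

lemma std_gaussian_norm_moment:
  shows "integrable std_gaussian (\<lambda>g::real^'d. (norm g)\<^sup>2)"
    and "(\<integral>g. (norm g)\<^sup>2 \<partial>(std_gaussian :: (real^'d) measure)) = real CARD('d)"
proof -
  have "(norm g)\<^sup>2 = (\<Sum>i\<in>UNIV. g $ i * g $ i)" for g :: "real^'d"
    by (simp add: power2_norm_eq_inner inner_vec_def)
  then show "integrable std_gaussian (\<lambda>g::real^'d. (norm g)\<^sup>2)"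
    "(\<integral>g. (norm g)\<^sup>2 \<partial>(std_gaussian :: (real^'d) measure)) = real CARD('d)"
    by (simp_all add: std_gaussian_moments)
qed

section \<open>Gaussian smoothing of bounded functions\<close>

lemma exp_minus_one_le:
  fixes x :: real
  assumes "0 \<le> x" "x \<le> 1"
  shows "exp x - 1 - x \<le> x\<^sup>2" "exp x - 1 \<le> 2 * x"
proof -
  show *: "exp x - 1 - x \<le> x\<^sup>2" using exp_bound[OF assms] by simp
  have "x\<^sup>2 \<le> x" using assms by (simp add: power2_eq_square mult_left_le)
  then show "exp x - 1 \<le> 2 * x" using * by simp
qed

definition gaussian_smoothing :: "real \<Rightarrow> (real^'d \<Rightarrow> real) \<Rightarrow> real^'d \<Rightarrow> real" where
  "gaussian_smoothing s \<phi> z = (\<integral>g. \<phi> (s *\<^sub>R z + sqrt s *\<^sub>R g) \<partial>std_gaussian)"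

text \<open>Differentiating under the integral is meaningless for a discontinuous \<open>\<phi>\<close>; this is what
Gaussian integration by parts would make of the result.\<close>
definition gaussian_smoothing_gradient :: "real \<Rightarrow> (real^'d \<Rightarrow> real) \<Rightarrow> real^'d \<Rightarrow> real^'d" where
  "gaussian_smoothing_gradient s \<phi> z = (\<chi> l. sqrt s * (\<integral>g. \<phi> (s *\<^sub>R z + sqrt s *\<^sub>R g) * g $ l \<partial>std_gaussian))"

context
  fixes s K :: real and \<phi> :: "real^'d \<Rightarrow> real"
  assumes s: "0 < s" and K: "\<And>y. \<bar>\<phi> y\<bar> \<le> K" and m [measurable]: "\<phi> \<in> borel_measurable borel"
begin

abbreviation noisy :: "real^'d \<Rightarrow> real^'d \<Rightarrow> real^'d" where
  "noisy z g \<equiv> s *\<^sub>R z + sqrt s *\<^sub>R g"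

abbreviation smoothed :: "real^'d \<Rightarrow> real" where
  "smoothed \<equiv> gaussian_smoothing s \<phi>"

abbreviation smoothed_gradient :: "real^'d \<Rightarrow> real^'d" where
  "smoothed_gradient \<equiv> gaussian_smoothing_gradient s \<phi>"

lemma bounded_times_integrable:
  assumes "integrable std_gaussian (f :: real^'d \<Rightarrow> real)"
  shows "integrable std_gaussian (\<lambda>g. \<phi> (noisy z g) * f g)"
    and "\<bar>\<integral>g. \<phi> (noisy z g) * f g \<partial>std_gaussian\<bar> \<le> K * (\<integral>g. \<bar>f g\<bar> \<partial>std_gaussian)"
proof -
  have [measurable]: "f \<in> borel_measurable borel" using assms by auto
  have le: "\<bar>\<phi> (noisy z g) * f g\<bar> \<le> K * \<bar>f g\<bar>" for g
    unfolding abs_mult by (intro mult_right_mono K) simp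
  show i: "integrable std_gaussian (\<lambda>g. \<phi> (noisy z g) * f g)"
  proof (rule Bochner_Integration.integrable_bound[where f="\<lambda>g. K * \<bar>f g\<bar>"])
    show "AE g in std_gaussian. norm (\<phi> (noisy z g) * f g) \<le> norm (K * \<bar>f g\<bar>)"
    proof (intro AE_I2)
      fix g show "norm (\<phi> (noisy z g) * f g) \<le> norm (K * \<bar>f g\<bar>)"
        using le[of g] abs_ge_self[of "K * \<bar>f g\<bar>"] unfolding real_norm_def by linarith
    qed
  qed (simp_all add: assms)
  have "\<bar>\<integral>g. \<phi> (noisy z g) * f g \<partial>std_gaussian\<bar>
      \<le> (\<integral>g. \<bar>\<phi> (noisy z g) * f g\<bar> \<partial>std_gaussian)" by (rule integral_abs_bound)
  also have "\<dots> \<le> (\<integral>g. K * \<bar>f g\<bar> \<partial>std_gaussian)"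
    using i assms le by (intro integral_mono) auto
  finally show "\<bar>\<integral>g. \<phi> (noisy z g) * f g \<partial>std_gaussian\<bar> \<le> K * (\<integral>g. \<bar>f g\<bar> \<partial>std_gaussian)"
    by simp
qed

lemma smoothing_gradient_inner:
  "h \<bullet> smoothed_gradient z
    = sqrt s * (\<integral>g. \<phi> (noisy z g) * (h \<bullet> g) \<partial>std_gaussian)"
proof -
  have "(\<integral>g. \<phi> (noisy z g) * (h \<bullet> g) \<partial>std_gaussian)
     = (\<integral>g. (\<Sum>l\<in>UNIV. h $ l * (\<phi> (noisy z g) * g $ l)) \<partial>std_gaussian)"
    by (simp add: inner_vec_def sum_distrib_left mult.left_commute)
  also have "\<dots> = (\<Sum>l\<in>UNIV. h $ l * (\<integral>g. \<phi> (noisy z g) * g $ l \<partial>std_gaussian))"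
    using bounded_times_integrable(1)[OF std_gaussian_moments(1)] by simp
  finally show ?thesis
    by (simp add: inner_vec_def gaussian_smoothing_gradient_def sum_distrib_left mult.left_commute)
qed

text \<open>A shift of the point at which the smoothing is evaluated is a shift of the Gaussian variable
inside \<open>\<phi>\<close>, and Cameron-Martin turns it into a smooth weight. From here on \<open>\<phi>\<close> is just a bounded
factor.\<close>
lemma shift_smoothing:
  assumes [measurable]: "f \<in> borel_measurable borel"
  shows "(\<integral>g. \<phi> (noisy (z + h) g) * f (g + sqrt s *\<^sub>R h) \<partial>std_gaussian)
    = (\<integral>g. \<phi> (noisy z g) * (tilt_weight (sqrt s *\<^sub>R h) g * f g) \<partial>std_gaussian)"
proof -
  have "s *\<^sub>R (z + h) + sqrt s *\<^sub>R g = s *\<^sub>R z + sqrt s *\<^sub>R (g + sqrt s *\<^sub>R h)" for g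
    using s by (simp add: algebra_simps)
  then show ?thesis
    using cameron_martin_integral(1)[of "\<lambda>g. \<phi> (noisy z g) * f g" "sqrt s *\<^sub>R h"]
    by (simp add: ac_simps)
qed

lemma norm_sqrt_scale: "(norm (sqrt s *\<^sub>R h))\<^sup>2 = s * (norm h)\<^sup>2"
  using s by (simp add: power_mult_distrib)

lemma bound_nonneg: "0 \<le> K" using K[of 0] by linarith

text \<open>The first-order remainder is the integral of \<open>\<phi>\<close> against the second-order remainder of the
Cameron-Martin density.\<close>
lemma smoothing_remainder:
  assumes h: "s * (norm h)\<^sup>2 \<le> 1"
  shows "\<bar>smoothed (z + h) - smoothed z
            - h \<bullet> smoothed_gradient z\<bar> \<le> K * (s * (norm h)\<^sup>2)"
proof -
  let ?a = "sqrt s *\<^sub>R h" let ?y = "\<lambda>g. noisy z g"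
  let ?r = "\<lambda>g. tilt_weight ?a g - 1 - ?a \<bullet> g"
  have i1: "integrable std_gaussian (\<lambda>g. \<phi> (?y g) * tilt_weight ?a g)"
    by (intro bounded_times_integrable tilt_weight_moments)
  have i2: "integrable std_gaussian (\<lambda>g. \<phi> (?y g) * 1)"
    by (rule bounded_times_integrable) simp
  have i3: "integrable std_gaussian (\<lambda>g. \<phi> (?y g) * (?a \<bullet> g))"
    by (intro bounded_times_integrable std_gaussian_inner_moments)
  have ir: "integrable std_gaussian ?r"
    by (intro Bochner_Integration.integrable_diff tilt_weight_moments std_gaussian_inner_moments) simp
  have "smoothed (z + h) - smoothed z - h \<bullet> smoothed_gradient z
    = (\<integral>g. \<phi> (?y g) * tilt_weight ?a g \<partial>std_gaussian) - (\<integral>g. \<phi> (?y g) * 1 \<partial>std_gaussian)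
      - (\<integral>g. \<phi> (?y g) * (?a \<bullet> g) \<partial>std_gaussian)"
    unfolding smoothing_gradient_inner using shift_smoothing[of "\<lambda>_. 1" z h]
    by (simp add: gaussian_smoothing_def mult.left_commute[of _ "sqrt s"])
  also have "\<dots> = (\<integral>g. \<phi> (?y g) * ?r g \<partial>std_gaussian)"
    unfolding right_diff_distrib Bochner_Integration.integral_diff[OF Bochner_Integration.integrable_diff[OF i1 i2] i3]
      Bochner_Integration.integral_diff[OF i1 i2] ..
  finally have "\<bar>smoothed (z + h) - smoothed z
            - h \<bullet> smoothed_gradient z\<bar> \<le> K * (\<integral>g. \<bar>?r g\<bar> \<partial>std_gaussian)"
    using bounded_times_integrable(2)[OF ir] by simp
  also have "(\<integral>g. \<bar>?r g\<bar> \<partial>std_gaussian) \<le> s * (norm h)\<^sup>2"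
  proof -
    have "(\<integral>g. \<bar>?r g\<bar> \<partial>std_gaussian) \<le> sqrt (\<integral>g. \<bar>?r g\<bar>\<^sup>2 \<partial>std_gaussian)"
      using integral_norm_mult_norm_le[of ?r std_gaussian "\<lambda>_. 1::real"] tilt_weight_expansion(3)[of ?a]
      by (simp add: std_gaussian.prob_space[simplified])
    also have "\<dots> \<le> sqrt ((s * (norm h)\<^sup>2)\<^sup>2)"
      unfolding tilt_weight_expansion(4)
      unfolding norm_sqrt_scale using s by (intro real_sqrt_le_mono exp_minus_one_le(1)[OF _ h]) simp
    finally show ?thesis using s by simp
  qed
  finally show ?thesis using bound_nonneg by (simp add: mult_left_mono)
qed

text \<open>Tested against the difference \<open>v\<close> of the two gradients, the shifted and the original integrals
differ by a weight whose \<open>L\<^sup>1\<close> norm is of order \<open>|h| |v|\<close>.\<close>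
lemma smoothing_gradient_Lipschitz:
  assumes h: "s * (norm h)\<^sup>2 \<le> 1"
  shows "norm (smoothed_gradient (z + h) - smoothed_gradient z)
     \<le> 3 * K * s * norm h"
proof -
  define v where "v = smoothed_gradient (z + h) - smoothed_gradient z"
  let ?a = "sqrt s *\<^sub>R h" let ?y = "\<lambda>g. noisy z g"
  let ?r = "\<lambda>g. tilt_weight ?a g * (v \<bullet> g - v \<bullet> ?a) - v \<bullet> g"
  have ir1: "integrable std_gaussian (\<lambda>g. tilt_weight ?a g * (v \<bullet> g - v \<bullet> ?a))"
    unfolding right_diff_distrib
    by (intro Bochner_Integration.integrable_diff integrable_mult_left tilt_weight_moments)
  have ir: "integrable std_gaussian ?r"
    by (intro Bochner_Integration.integrable_diff ir1 std_gaussian_inner_moments)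
  have "v \<bullet> v = sqrt s * ((\<integral>g. \<phi> (noisy (z + h) g) * (v \<bullet> g) \<partial>std_gaussian)
      - (\<integral>g. \<phi> (?y g) * (v \<bullet> g) \<partial>std_gaussian))"
    using smoothing_gradient_inner[of v "z + h"] smoothing_gradient_inner[of v z]
    by (subst (2) v_def) (simp add: inner_diff_right right_diff_distrib)
  also have "(\<integral>g. \<phi> (noisy (z + h) g) * (v \<bullet> g) \<partial>std_gaussian)
      = (\<integral>g. \<phi> (?y g) * (tilt_weight ?a g * (v \<bullet> g - v \<bullet> ?a)) \<partial>std_gaussian)"
    using shift_smoothing[of "\<lambda>g. v \<bullet> g - v \<bullet> ?a" z h] by (simp add: inner_add_right)
  also have "\<dots> - (\<integral>g. \<phi> (?y g) * (v \<bullet> g) \<partial>std_gaussian) = (\<integral>g. \<phi> (?y g) * ?r g \<partial>std_gaussian)"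
    unfolding right_diff_distrib[of "\<phi> (?y g)" "tilt_weight ?a g * (v \<bullet> g - v \<bullet> ?a)" "v \<bullet> g" for g]
    by (rule Bochner_Integration.integral_diff[symmetric])
       (intro bounded_times_integrable ir1 std_gaussian_inner_moments)+
  finally have vv_eq: "v \<bullet> v = sqrt s * (\<integral>g. \<phi> (?y g) * ?r g \<partial>std_gaussian)" .
  have rem: "(\<integral>g. \<phi> (?y g) * ?r g \<partial>std_gaussian) \<le> K * (\<integral>g. \<bar>?r g\<bar> \<partial>std_gaussian)"
    using bounded_times_integrable(2)[OF ir, of z] by simp
  have rem': "(\<integral>g. \<bar>?r g\<bar> \<partial>std_gaussian) \<le> 3 * sqrt s * norm h * norm v"
  proof -
    have "(norm (v \<bullet> g))\<^sup>2 = (v \<bullet> g) * (v \<bullet> g)" for g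
      by (simp add: power2_eq_square)
    then have vv: "integrable std_gaussian (\<lambda>g. (norm (v \<bullet> g))\<^sup>2)"
      "(\<integral>g. (norm (v \<bullet> g))\<^sup>2 \<partial>std_gaussian) = (norm v)\<^sup>2"
      using std_gaussian_inner_moments(3,4)[of v v] by (simp_all only: dot_square_norm)
    have i1: "integrable std_gaussian (\<lambda>g. norm (tilt_weight ?a g - 1) * norm (v \<bullet> g))"
      using tilt_weight_expansion(1)[of ?a] vv(1)
      by (intro integrable_norm_mult_norm) (simp_all only: real_norm_def, measurable)
    have "(\<integral>g. \<bar>?r g\<bar> \<partial>std_gaussian)
        \<le> (\<integral>g. norm (tilt_weight ?a g - 1) * norm (v \<bullet> g) + tilt_weight ?a g * \<bar>v \<bullet> ?a\<bar> \<partial>std_gaussian)"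
    proof (intro integral_mono integrable_abs ir Bochner_Integration.integrable_add i1 integrable_mult_left tilt_weight_moments)
      fix g
      have "?r g = (tilt_weight ?a g - 1) * (v \<bullet> g) - tilt_weight ?a g * (v \<bullet> ?a)"
        by (simp add: algebra_simps)
      then show "\<bar>?r g\<bar> \<le> norm (tilt_weight ?a g - 1) * norm (v \<bullet> g) + tilt_weight ?a g * \<bar>v \<bullet> ?a\<bar>"
        using abs_triangle_ineq4[of "(tilt_weight ?a g - 1) * (v \<bullet> g)" "tilt_weight ?a g * (v \<bullet> ?a)"]
        by (simp add: abs_mult)
    qed
    also have eq1: "\<dots> = (\<integral>g. norm (tilt_weight ?a g - 1) * norm (v \<bullet> g) \<partial>std_gaussian) + \<bar>v \<bullet> ?a\<bar>"
      using tilt_weight_moments(1,2)[of ?a] i1 by (subst Bochner_Integration.integral_add) simp_all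
    finally have le1: "(\<integral>g. \<bar>?r g\<bar> \<partial>std_gaussian) \<le> \<dots>" .
    have le2: "(\<integral>g. norm (tilt_weight ?a g - 1) * norm (v \<bullet> g) \<partial>std_gaussian)
        \<le> sqrt (exp (s * (norm h)\<^sup>2) - 1) * norm v"
    proof -
      have "(\<integral>g. norm (tilt_weight ?a g - 1) * norm (v \<bullet> g) \<partial>std_gaussian)
        \<le> sqrt (\<integral>g. \<bar>tilt_weight ?a g - 1\<bar>\<^sup>2 \<partial>std_gaussian) * sqrt (\<integral>g. (norm (v \<bullet> g))\<^sup>2 \<partial>std_gaussian)"
        unfolding real_norm_def[of "tilt_weight ?a g - 1" for g, symmetric]
        by (rule integral_norm_mult_norm_le)
           (use tilt_weight_expansion(1)[of ?a] vv(1) in \<open>simp_all only: real_norm_def, measurable\<close>)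
      then show ?thesis unfolding tilt_weight_expansion(2) vv(2) unfolding norm_sqrt_scale by simp
    qed
    have "sqrt (exp (s * (norm h)\<^sup>2) - 1) \<le> sqrt ((2 * (sqrt s * norm h))\<^sup>2)"
    proof (rule real_sqrt_le_mono)
      have "exp (s * (norm h)\<^sup>2) - 1 \<le> 2 * (s * (norm h)\<^sup>2)"
        using s by (intro exp_minus_one_le(2)[OF _ h]) simp
      moreover have "(2 * (sqrt s * norm h))\<^sup>2 = 4 * (s * (norm h)\<^sup>2)"
        using s by (simp add: power_mult_distrib)
      moreover have "0 \<le> s * (norm h)\<^sup>2" using s by simp
      ultimately show "exp (s * (norm h)\<^sup>2) - 1 \<le> (2 * (sqrt s * norm h))\<^sup>2" by linarith
    qed
    also have "sqrt ((2 * (sqrt s * norm h))\<^sup>2) = 2 * (sqrt s * norm h)"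
      using s by (subst real_sqrt_abs) simp
    finally have le3: "sqrt (exp (s * (norm h)\<^sup>2) - 1) * norm v \<le> 2 * (sqrt s * norm h) * norm v"
      by (rule mult_right_mono) simp
    have le4: "\<bar>v \<bullet> ?a\<bar> \<le> norm v * (sqrt s * norm h)"
      using Cauchy_Schwarz_ineq2[of v ?a] s by simp
    have "2 * (sqrt s * norm h) * norm v + norm v * (sqrt s * norm h) = 3 * sqrt s * norm h * norm v"
      by (simp add: algebra_simps)
    then show ?thesis using le1 le2 le3 le4 by linarith
  qed
  have "(norm v)\<^sup>2 = sqrt s * (\<integral>g. \<phi> (?y g) * ?r g \<partial>std_gaussian)"
    using vv_eq unfolding dot_square_norm .
  also have "\<dots> \<le> sqrt s * (K * (3 * sqrt s * norm h * norm v))"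
    using s bound_nonneg by (intro mult_left_mono order_trans[OF rem] rem') simp_all
  also have "\<dots> = (3 * K * s * norm h) * norm v" using s by (simp add: field_simps)
  finally have "norm v * norm v \<le> (3 * K * s * norm h) * norm v" by (simp add: power2_eq_square)
  then show ?thesis unfolding v_def[symmetric] using bound_nonneg s
    by (cases "v = 0") (simp_all add: mult_le_cancel_right)
qed

lemma gderiv_smoothing: "GDERIV smoothed z :> smoothed_gradient z"
  unfolding gderiv_def
proof (rule has_derivativeI_sandwich[where e="1 / sqrt s" and H="\<lambda>y. K * s * norm (y - z)"])
  show "0 < 1 / sqrt s" using s by simp
  show "bounded_linear (\<lambda>h. h \<bullet> smoothed_gradient z)" by (rule bounded_linear_inner_left)
  show "((\<lambda>y. K * s * norm (y - z)) \<longlongrightarrow> 0) (at z)"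
    by (rule tendsto_eq_intros refl | simp)+
  fix y assume y: "y \<noteq> z" "dist y z < 1 / sqrt s"
  define h where "h = y - z"
  have h: "norm h > 0" "norm h < 1 / sqrt s" "y = z + h" using y by (auto simp: h_def dist_norm)
  have "sqrt s * norm h \<le> 1" using h(2) s by (simp add: field_simps)
  then have "(sqrt s * norm h)\<^sup>2 \<le> 1" using s by (simp add: power_le_one)
  then have "s * (norm h)\<^sup>2 \<le> 1" using s by (simp add: power_mult_distrib)
  from smoothing_remainder[OF this, of z]
  have "\<bar>smoothed y - smoothed z - h \<bullet> smoothed_gradient z\<bar>
     \<le> K * s * norm h * norm h" unfolding h(3) by (simp add: power2_eq_square mult.assoc)
  then show "norm (smoothed y - smoothed z
      - (y - z) \<bullet> smoothed_gradient z) / norm (y - z) \<le> K * s * norm (y - z)"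
    using h(1) unfolding h_def[symmetric] by (simp add: pos_divide_le_eq)
qed

lemma continuous_smoothing_gradient: "continuous_on UNIV (smoothed_gradient)"
proof -
  have "isCont (smoothed_gradient) z" for z
    unfolding isCont_iff tendsto_dist_iff[of _ "smoothed_gradient z"]
  proof (rule tendsto_sandwich[where f="\<lambda>_. 0"])
    show "((\<lambda>h. 3 * K * s * norm h) \<longlongrightarrow> 0) (at (0::real^'d))"
      by (rule tendsto_eq_intros refl | simp)+
    have "((\<lambda>h. s * (norm h)\<^sup>2) \<longlongrightarrow> 0) (at (0::real^'d))"
      by (rule tendsto_eq_intros refl | simp)+
    then have "\<forall>\<^sub>F h in at (0::real^'d). s * (norm h)\<^sup>2 < 1" by (rule order_tendstoD) simp
    then show "\<forall>\<^sub>F h in at 0. dist (smoothed_gradient (z + h)) (smoothed_gradient z)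
        \<le> 3 * K * s * norm h"
      by eventually_elim (simp add: dist_norm smoothing_gradient_Lipschitz)
  qed simp_all
  then show ?thesis by (simp add: continuous_on_eq_continuous_at)
qed

lemma smoothing_bounded: "\<bar>smoothed z\<bar> \<le> K"
  using bounded_times_integrable(2)[of "\<lambda>_. 1" z]
  by (simp add: gaussian_smoothing_def std_gaussian.prob_space[simplified])

lemma smoothing_gradient_bounded: "\<bar>smoothed_gradient z $ l\<bar>
     \<le> sqrt s * K * (\<integral>g. \<bar>g $ l\<bar> \<partial>(std_gaussian :: (real^'d) measure))"
  using bounded_times_integrable(2)[OF std_gaussian_moments(1), of z l] s
  by (simp add: gaussian_smoothing_gradient_def abs_mult mult.assoc)

end

section \<open>The Gaussian channel and its posterior\<close>

text \<open>The signal \<open>X\<close> may live on any probability space; in the application it is \<open>F\<close> under the Gibbs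
measure. On \<open>joint\<close> the second coordinate is the noise of the channel, and on \<open>joint_noise\<close> there is
one more independent Gaussian vector.\<close>
locale gaussian_channel = prob_space M for M :: "'a measure" +
  fixes X :: "'a \<Rightarrow> real^'d"
  assumes X_measurable [measurable]: "X \<in> borel_measurable M"
    and X_L2: "integrable M (\<lambda>\<omega>. (norm (X \<omega>))\<^sup>2)"
begin

sublocale joint: pair_prob_space M "std_gaussian :: (real^'d) measure" ..

abbreviation joint :: "('a \<times> (real^'d)) measure" where
  "joint \<equiv> M \<Otimes>\<^sub>M std_gaussian"

abbreviation second_moment :: real where
  "second_moment \<equiv> \<integral>\<omega>. (norm (X \<omega>))\<^sup>2 \<partial>M"

abbreviation joint_noise :: "(('a \<times> (real^'d)) \<times> (real^'d)) measure" where
  "joint_noise \<equiv> joint \<Otimes>\<^sub>M std_gaussian"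

definition obs :: "real \<Rightarrow> 'a \<times> (real^'d) \<Rightarrow> real^'d" where
  "obs s z = s *\<^sub>R X (fst z) + sqrt s *\<^sub>R snd z"

text \<open>The density of the observation given \<open>X \<omega>\<close> with respect to pure noise \<open>sqrt s g\<close>, so
\<open>evidence\<close> is the density of the observation with respect to pure noise.\<close>
definition tilt :: "real \<Rightarrow> real^'d \<Rightarrow> 'a \<Rightarrow> real" where
  "tilt s y \<omega> = exp (X \<omega> \<bullet> y - s * (norm (X \<omega>))\<^sup>2 / 2)"

definition evidence :: "real \<Rightarrow> real^'d \<Rightarrow> real" where
  "evidence s y = (\<integral>\<omega>. tilt s y \<omega> \<partial>M)"

definition post_mean :: "real \<Rightarrow> real^'d \<Rightarrow> real^'d" where
  "post_mean s y = (1 / evidence s y) *\<^sub>R (\<integral>\<omega>. tilt s y \<omega> *\<^sub>R X \<omega> \<partial>M)"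

definition mmse :: "real \<Rightarrow> real" where
  "mmse s = (\<integral>z. (norm (X (fst z) - post_mean s (obs s z)))\<^sup>2 \<partial>joint)"

lemma sets_joint [measurable_cong]: "sets joint = sets (M \<Otimes>\<^sub>M borel)"
  by (intro sets_pair_measure_cong) simp_all

lemma obs_measurable [measurable]: "obs s \<in> borel_measurable joint"
  unfolding obs_def by measurable

lemma tilt_measurable [measurable (raw)]:
  assumes [measurable]: "f \<in> borel_measurable N" "h \<in> measurable N M"
  shows "(\<lambda>x. tilt s (f x) (h x)) \<in> borel_measurable N"
  unfolding tilt_def by measurable

lemma evidence_measurable [measurable]: "evidence s \<in> borel_measurable borel"
  unfolding evidence_def by measurable

lemma post_mean_measurable [measurable]: "post_mean s \<in> borel_measurable borel"
  unfolding post_mean_def by measurable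

lemma tilt_pos [simp]: "0 < tilt s y \<omega>" "0 \<le> tilt s y \<omega>"
  by (simp_all add: tilt_def)

text \<open>Complete the square: the exponent is \<open>|y|\<^sup>2 / (2 s) - |y - s X|\<^sup>2 / (2 s)\<close>. The bound makes all
posterior averages finite for every \<open>y\<close>, which is why the level is kept away from 0.\<close>
lemma tilt_le:
  assumes "0 < s"
  shows "tilt s y \<omega> \<le> exp ((norm y)\<^sup>2 / (2 * s))"
proof -
  have "0 \<le> (norm (y - s *\<^sub>R X \<omega>))\<^sup>2 / (2 * s)" using assms by simp
  also have "(norm (y - s *\<^sub>R X \<omega>))\<^sup>2 = (norm y)\<^sup>2 - 2 * s * (X \<omega> \<bullet> y) + s\<^sup>2 * (norm (X \<omega>))\<^sup>2"
    unfolding power2_norm_eq_inner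
    by (simp add: inner_diff_left inner_diff_right inner_commute algebra_simps power2_eq_square)
  also have "\<dots> / (2 * s) = (norm y)\<^sup>2 / (2 * s) - (X \<omega> \<bullet> y - s * (norm (X \<omega>))\<^sup>2 / 2)"
    using assms by (simp add: field_simps power2_eq_square)
  finally show ?thesis by (simp add: tilt_def)
qed

lemma X_integrable: "integrable M X"
  by (rule integrable_of_square[OF X_measurable X_L2])

lemma tilt_scaleR_integrable:
  fixes f :: "'a \<Rightarrow> 'b::euclidean_space"
  assumes s: "0 < s" and f: "integrable M f"
  shows "integrable M (\<lambda>\<omega>. tilt s y \<omega> *\<^sub>R f \<omega>)"
proof (rule Bochner_Integration.integrable_bound)
  show "integrable M (\<lambda>\<omega>. exp ((norm y)\<^sup>2 / (2 * s)) *\<^sub>R f \<omega>)" using f by simp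
  show "(\<lambda>\<omega>. tilt s y \<omega> *\<^sub>R f \<omega>) \<in> borel_measurable M"
    using borel_measurable_integrable[OF f] by measurable
  show "AE \<omega> in M. norm (tilt s y \<omega> *\<^sub>R f \<omega>) \<le> norm (exp ((norm y)\<^sup>2 / (2 * s)) *\<^sub>R f \<omega>)"
    using tilt_le[OF s] by (intro AE_I2) (simp add: mult_right_mono)
qed

lemma tilt_integrable: "0 < s \<Longrightarrow> integrable M (tilt s y)"
  using tilt_scaleR_integrable[of s "\<lambda>_. 1::real" y] by simp

lemma evidence_pos: "0 < s \<Longrightarrow> 0 < evidence s y"
proof -
  assume s: "0 < s"
  have "evidence s y \<noteq> 0"
    unfolding evidence_def using tilt_integrable[OF s, of y]
    by (subst integral_nonneg_eq_0_iff_AE) (simp_all add: tilt_def AE_False)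
  moreover have "0 \<le> evidence s y" unfolding evidence_def by simp
  ultimately show ?thesis by simp
qed

lemma nn_integral_tilt: "0 < s \<Longrightarrow> (\<integral>\<^sup>+\<omega>. ennreal (tilt s y \<omega>) \<partial>M) = ennreal (evidence s y)"
  unfolding evidence_def by (rule nn_integral_eq_integral) (simp_all add: tilt_integrable)

lemma evidence_post_mean:
  "0 < s \<Longrightarrow> evidence s y *\<^sub>R post_mean s y = (\<integral>\<omega>. tilt s y \<omega> *\<^sub>R X \<omega> \<partial>M)"
  using evidence_pos[of s y] by (simp add: post_mean_def)

text \<open>Bayes' rule: Cameron-Martin, applied for each fixed \<open>\<omega>\<close> with shift \<open>sqrt s X \<omega>\<close>, makes the
observation independent of \<open>\<omega>\<close> at the price of the density \<open>tilt\<close>.\<close>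
lemma channel_law:
  assumes s: "0 < s"
  shows "distr joint (M \<Otimes>\<^sub>M borel) (\<lambda>z. (fst z, obs s z))
    = distr (density joint (\<lambda>z. ennreal (tilt s (sqrt s *\<^sub>R snd z) (fst z)))) (M \<Otimes>\<^sub>M borel)
        (\<lambda>z. (fst z, sqrt s *\<^sub>R snd z))" (is "?L = ?R")
proof (rule measure_eqI)
  fix A assume "A \<in> sets ?L"
  then have [measurable]: "A \<in> sets (M \<Otimes>\<^sub>M borel)" by simp
  have "emeasure ?L A = (\<integral>\<^sup>+z. indicator A (fst z, obs s z) \<partial>joint)"
    by (simp flip: nn_integral_indicator add: nn_integral_distr)
  also have "\<dots> = (\<integral>\<^sup>+\<omega>. \<integral>\<^sup>+g. indicator A (\<omega>, sqrt s *\<^sub>R (g + sqrt s *\<^sub>R X \<omega>)) \<partial>std_gaussian \<partial>M)"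
    using s by (subst std_gaussian.nn_integral_fst[symmetric]) (simp_all add: obs_def algebra_simps)
  also have "\<dots> = (\<integral>\<^sup>+\<omega>. \<integral>\<^sup>+g. ennreal (tilt_weight (sqrt s *\<^sub>R X \<omega>) g)
       * indicator A (\<omega>, sqrt s *\<^sub>R g) \<partial>std_gaussian \<partial>M)"
  proof (rule nn_integral_cong)
    fix \<omega> assume [measurable]: "\<omega> \<in> space M"
    have "(\<lambda>g. indicator A (\<omega>, sqrt s *\<^sub>R g) :: ennreal) \<in> borel_measurable borel" by measurable
    from cameron_martin_nn_integral[OF this]
    show "(\<integral>\<^sup>+g. indicator A (\<omega>, sqrt s *\<^sub>R (g + sqrt s *\<^sub>R X \<omega>)) \<partial>std_gaussian)
      = (\<integral>\<^sup>+g. ennreal (tilt_weight (sqrt s *\<^sub>R X \<omega>) g) * indicator A (\<omega>, sqrt s *\<^sub>R g) \<partial>std_gaussian)" .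
  qed
  also have "\<dots> = (\<integral>\<^sup>+\<omega>. \<integral>\<^sup>+g. ennreal (tilt s (sqrt s *\<^sub>R g) \<omega>) * indicator A (\<omega>, sqrt s *\<^sub>R g) \<partial>std_gaussian \<partial>M)"
    using s by (simp add: tilt_def power_mult_distrib)
  also have "\<dots> = (\<integral>\<^sup>+z. ennreal (tilt s (sqrt s *\<^sub>R snd z) (fst z)) * indicator A (fst z, sqrt s *\<^sub>R snd z) \<partial>joint)"
    by (subst std_gaussian.nn_integral_fst[symmetric]) simp_all
  also have "\<dots> = emeasure ?R A"
    by (simp flip: nn_integral_indicator add: nn_integral_distr nn_integral_density)
  finally show "emeasure ?L A = emeasure ?R A" .
qed simp

lemma channel_nn_integral:
  assumes s: "0 < s" and [measurable]: "f \<in> borel_measurable (M \<Otimes>\<^sub>M borel)"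
  shows "(\<integral>\<^sup>+z. f (fst z, obs s z) \<partial>joint)
    = (\<integral>\<^sup>+g. \<integral>\<^sup>+\<omega>. ennreal (tilt s (sqrt s *\<^sub>R g) \<omega>) * f (\<omega>, sqrt s *\<^sub>R g) \<partial>M \<partial>std_gaussian)"
proof -
  have "(\<integral>\<^sup>+z. f (fst z, obs s z) \<partial>joint) = (\<integral>\<^sup>+z. f z \<partial>distr joint (M \<Otimes>\<^sub>M borel) (\<lambda>z. (fst z, obs s z)))"
    by (subst nn_integral_distr) simp_all
  also have "\<dots> = (\<integral>\<^sup>+z. ennreal (tilt s (sqrt s *\<^sub>R snd z) (fst z)) * f (fst z, sqrt s *\<^sub>R snd z) \<partial>joint)"
    unfolding channel_law[OF s] by (subst nn_integral_distr) (simp_all add: nn_integral_density)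
  also have "\<dots> = (\<integral>\<^sup>+g. \<integral>\<^sup>+\<omega>. ennreal (tilt s (sqrt s *\<^sub>R g) \<omega>) * f (\<omega>, sqrt s *\<^sub>R g) \<partial>M \<partial>std_gaussian)"
    by (subst joint.nn_integral_snd[symmetric]) simp_all
  finally show ?thesis .
qed

lemma channel_integral:
  fixes f :: "'a \<times> (real^'d) \<Rightarrow> real"
  assumes s: "0 < s" and [measurable]: "f \<in> borel_measurable (M \<Otimes>\<^sub>M borel)"
    and i: "integrable joint (\<lambda>z. f (fst z, obs s z))"
  shows "(\<integral>z. f (fst z, obs s z) \<partial>joint)
    = (\<integral>g. \<integral>\<omega>. tilt s (sqrt s *\<^sub>R g) \<omega> * f (\<omega>, sqrt s *\<^sub>R g) \<partial>M \<partial>std_gaussian)"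
proof -
  let ?h = "\<lambda>z. tilt s (sqrt s *\<^sub>R snd z) (fst z) * f (fst z, sqrt s *\<^sub>R snd z)"
  have "integrable (distr joint (M \<Otimes>\<^sub>M borel) (\<lambda>z. (fst z, obs s z))) f"
    using i by (simp add: integrable_distr_eq)
  then have ih: "integrable joint ?h"
    unfolding channel_law[OF s] by (simp add: integrable_distr_eq integrable_density)
  have "(\<integral>z. f (fst z, obs s z) \<partial>joint) = (\<integral>z. f z \<partial>distr joint (M \<Otimes>\<^sub>M borel) (\<lambda>z. (fst z, obs s z)))"
    by (subst integral_distr) simp_all
  also have "\<dots> = (\<integral>z. ?h z \<partial>joint)"
    unfolding channel_law[OF s] by (subst integral_distr) (simp_all add: integral_density)
  also have "\<dots> = (\<integral>g. \<integral>\<omega>. tilt s (sqrt s *\<^sub>R g) \<omega> * f (\<omega>, sqrt s *\<^sub>R g) \<partial>M \<partial>std_gaussian)"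
    using joint.integral_snd[of "\<lambda>\<omega> g. ?h (\<omega>, g)"] ih by (simp add: case_prod_unfold)
  finally show ?thesis .
qed

lemma
  fixes f :: "'a \<Rightarrow> 'b::euclidean_space"
  assumes "integrable M f"
  shows integrable_fst_joint: "integrable joint (\<lambda>z. f (fst z))"
    and integral_fst_joint: "(\<integral>z. f (fst z) \<partial>joint) = (\<integral>\<omega>. f \<omega> \<partial>M)"
  using integrable_of_law[OF std_gaussian.distr_pair_fst measurable_fst assms]
    integral_of_law[OF std_gaussian.distr_pair_fst measurable_fst assms] by simp_all

lemma
  fixes f :: "'a \<times> (real^'d) \<Rightarrow> 'b::euclidean_space"
  assumes "integrable joint f"
  shows integrable_fst_noise: "integrable joint_noise (\<lambda>p. f (fst p))"
    and integral_fst_noise: "(\<integral>p. f (fst p) \<partial>joint_noise) = (\<integral>z. f z \<partial>joint)"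
  using integrable_of_law[OF std_gaussian.distr_pair_fst measurable_fst assms]
    integral_of_law[OF std_gaussian.distr_pair_fst measurable_fst assms] by simp_all

lemma distr_joint_snd: "distr joint std_gaussian snd = std_gaussian"
  by (intro distr_pair_snd prob_space_axioms std_gaussian.sigma_finite_measure_axioms)

lemma distr_joint_noise_snd: "distr joint_noise std_gaussian snd = std_gaussian"
  by (intro distr_pair_snd joint.prob_space_axioms std_gaussian.sigma_finite_measure_axioms)

lemma
  fixes f :: "real^'d \<Rightarrow> 'b::euclidean_space"
  assumes "integrable std_gaussian f"
  shows integrable_snd_joint: "integrable joint (\<lambda>z. f (snd z))"
    and integral_snd_joint: "(\<integral>z. f (snd z) \<partial>joint) = (\<integral>g. f g \<partial>std_gaussian)"
    and integrable_snd_noise: "integrable joint_noise (\<lambda>p. f (snd p))"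
  using integrable_of_law[OF distr_joint_snd measurable_snd assms] integral_of_law[OF distr_joint_snd measurable_snd assms]
    integrable_of_law[OF distr_joint_noise_snd measurable_snd assms] by simp_all

lemma noise_L2: "integrable joint (\<lambda>z. (norm (snd z))\<^sup>2)"
  by (intro integrable_snd_joint std_gaussian_norm_moment)

lemma tilted_inner:
  assumes "0 < s"
  shows "integrable M (\<lambda>\<omega>. tilt s y \<omega> * (v \<bullet> X \<omega>))"
    and "(\<integral>\<omega>. tilt s y \<omega> * (v \<bullet> X \<omega>) \<partial>M) = evidence s y * (v \<bullet> post_mean s y)"
proof -
  have i: "integrable M (\<lambda>\<omega>. tilt s y \<omega> *\<^sub>R X \<omega>)"
    by (rule tilt_scaleR_integrable[OF assms X_integrable])
  show "integrable M (\<lambda>\<omega>. tilt s y \<omega> * (v \<bullet> X \<omega>))"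
    using integrable_inner_right[OF i, of v] by simp
  have "(\<integral>\<omega>. tilt s y \<omega> * (v \<bullet> X \<omega>) \<partial>M) = v \<bullet> (\<integral>\<omega>. tilt s y \<omega> *\<^sub>R X \<omega> \<partial>M)"
    using integral_inner_right[OF i, of v] by simp
  then show "(\<integral>\<omega>. tilt s y \<omega> * (v \<bullet> X \<omega>) \<partial>M) = evidence s y * (v \<bullet> post_mean s y)"
    by (simp flip: evidence_post_mean[OF assms])
qed

text \<open>The posterior variance is nonnegative.\<close>
lemma evidence_post_mean_sq_le:
  assumes s: "0 < s"
  shows "evidence s y * (norm (post_mean s y))\<^sup>2 \<le> (\<integral>\<omega>. tilt s y \<omega> * (norm (X \<omega>))\<^sup>2 \<partial>M)"
proof -
  let ?m = "post_mean s y"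
  have i: "integrable M (\<lambda>\<omega>. tilt s y \<omega> * (norm (X \<omega>))\<^sup>2)"
    using tilt_scaleR_integrable[OF s X_L2] by simp
  \<comment> \<open>The unnormalised posterior variance.\<close>
  have "0 \<le> (\<integral>\<omega>. tilt s y \<omega> * (norm (X \<omega> - ?m))\<^sup>2 \<partial>M)" by (simp add: tilt_def)
  also have "\<dots> = (\<integral>\<omega>. tilt s y \<omega> * (norm (X \<omega>))\<^sup>2 - 2 * (tilt s y \<omega> * (?m \<bullet> X \<omega>))
      + tilt s y \<omega> * (norm ?m)\<^sup>2 \<partial>M)"
    unfolding power2_norm_eq_inner
    by (intro Bochner_Integration.integral_cong refl) (simp add: inner_diff_left inner_diff_right inner_commute algebra_simps)
  also have "\<dots> = (\<integral>\<omega>. tilt s y \<omega> * (norm (X \<omega>))\<^sup>2 \<partial>M) - 2 * (\<integral>\<omega>. tilt s y \<omega> * (?m \<bullet> X \<omega>) \<partial>M)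
      + (\<integral>\<omega>. tilt s y \<omega> \<partial>M) * (norm ?m)\<^sup>2"
    using i tilted_inner(1)[OF s] tilt_integrable[OF s] by simp
  also have "\<dots> = (\<integral>\<omega>. tilt s y \<omega> * (norm (X \<omega>))\<^sup>2 \<partial>M) - evidence s y * (norm ?m)\<^sup>2"
    unfolding tilted_inner(2)[OF s] by (simp add: dot_square_norm evidence_def)
  finally show ?thesis by simp
qed

lemma post_mean_L2:
  assumes s: "0 < s"
  shows "integrable joint (\<lambda>z. (norm (post_mean s (obs s z)))\<^sup>2)"
proof (rule integrableI_bounded)
  have "(\<integral>\<^sup>+z. ennreal ((norm (post_mean s (obs s z)))\<^sup>2) \<partial>joint)
     = (\<integral>\<^sup>+g. \<integral>\<^sup>+\<omega>. ennreal (tilt s (sqrt s *\<^sub>R g) \<omega>) * ennreal ((norm (post_mean s (sqrt s *\<^sub>R g)))\<^sup>2) \<partial>M \<partial>std_gaussian)"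
    using channel_nn_integral[OF s, of "\<lambda>z. ennreal ((norm (post_mean s (snd z)))\<^sup>2)"] by simp
  also have "\<dots> \<le> (\<integral>\<^sup>+g. \<integral>\<^sup>+\<omega>. ennreal (tilt s (sqrt s *\<^sub>R g) \<omega>) * ennreal ((norm (X \<omega>))\<^sup>2) \<partial>M \<partial>std_gaussian)"
  proof (rule nn_integral_mono)
    fix g :: "real^'d"
    have i: "integrable M (\<lambda>\<omega>. tilt s (sqrt s *\<^sub>R g) \<omega> * (norm (X \<omega>))\<^sup>2)"
      using tilt_scaleR_integrable[OF s X_L2] by simp
    have "(\<integral>\<^sup>+\<omega>. ennreal (tilt s (sqrt s *\<^sub>R g) \<omega>) * ennreal ((norm (post_mean s (sqrt s *\<^sub>R g)))\<^sup>2) \<partial>M)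
      = ennreal (evidence s (sqrt s *\<^sub>R g) * (norm (post_mean s (sqrt s *\<^sub>R g)))\<^sup>2)"
      using evidence_pos[OF s, of "sqrt s *\<^sub>R g"]
      by (simp add: nn_integral_multc nn_integral_tilt[OF s] ennreal_mult less_imp_le)
    also have "\<dots> \<le> ennreal (\<integral>\<omega>. tilt s (sqrt s *\<^sub>R g) \<omega> * (norm (X \<omega>))\<^sup>2 \<partial>M)"
      by (intro ennreal_leI evidence_post_mean_sq_le s)
    also have "\<dots> = (\<integral>\<^sup>+\<omega>. ennreal (tilt s (sqrt s *\<^sub>R g) \<omega>) * ennreal ((norm (X \<omega>))\<^sup>2) \<partial>M)"
      using i by (simp add: nn_integral_eq_integral flip: ennreal_mult)
    finally show "(\<integral>\<^sup>+\<omega>. ennreal (tilt s (sqrt s *\<^sub>R g) \<omega>) * ennreal ((norm (post_mean s (sqrt s *\<^sub>R g)))\<^sup>2) \<partial>M)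
       \<le> \<dots>" .
  qed
  also have "\<dots> = (\<integral>\<^sup>+z. ennreal ((norm (X (fst z)))\<^sup>2) \<partial>joint)"
    using channel_nn_integral[OF s, of "\<lambda>z. ennreal ((norm (X (fst z)))\<^sup>2)"] by simp
  also have "\<dots> < \<infinity>"
    using integrable_fst_joint[OF X_L2] by (simp add: integrable_iff_bounded)
  finally show "(\<integral>\<^sup>+z. ennreal (norm ((norm (post_mean s (obs s z)))\<^sup>2)) \<partial>joint) < \<infinity>" by simp
qed measurable

text \<open>The posterior mean is the \<open>L\<^sup>2\<close> projection of \<open>X\<close> onto functions of the observation.\<close>
lemma post_mean_inner:
  assumes s: "0 < s" and [measurable]: "h \<in> borel_measurable borel"
    and h: "integrable joint (\<lambda>z. (norm (h (obs s z)))\<^sup>2)"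
  shows "(\<integral>z. h (obs s z) \<bullet> X (fst z) \<partial>joint) = (\<integral>z. h (obs s z) \<bullet> post_mean s (obs s z) \<partial>joint)"
proof -
  have i1: "integrable joint (\<lambda>z. h (obs s z) \<bullet> X (fst z))"
    by (intro integrable_inner_L2 h integrable_fst_joint X_L2) measurable
  have i2: "integrable joint (\<lambda>z. h (obs s z) \<bullet> post_mean s (obs s z))"
    by (intro integrable_inner_L2 h post_mean_L2 s) measurable
  have "(\<integral>z. h (obs s z) \<bullet> X (fst z) \<partial>joint)
    = (\<integral>g. \<integral>\<omega>. tilt s (sqrt s *\<^sub>R g) \<omega> * (h (sqrt s *\<^sub>R g) \<bullet> X \<omega>) \<partial>M \<partial>std_gaussian)"
    using channel_integral[OF s, of "\<lambda>z. h (snd z) \<bullet> X (fst z)"] i1 by simp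
  also have "\<dots> = (\<integral>g. \<integral>\<omega>. tilt s (sqrt s *\<^sub>R g) \<omega> * (h (sqrt s *\<^sub>R g) \<bullet> post_mean s (sqrt s *\<^sub>R g)) \<partial>M \<partial>std_gaussian)"
    unfolding tilted_inner(2)[OF s] by (simp add: evidence_def)
  also have "\<dots> = (\<integral>z. h (obs s z) \<bullet> post_mean s (obs s z) \<partial>joint)"
    using channel_integral[OF s, of "\<lambda>z. h (snd z) \<bullet> post_mean s (snd z)"] i2 by simp
  finally show ?thesis .
qed

lemma obs_L2: "0 < s \<Longrightarrow> integrable joint (\<lambda>z. (norm (obs s z))\<^sup>2)"
  unfolding obs_def
  by (intro integrable_norm_add_L2 integrable_norm_scaleR_L2 integrable_fst_joint X_L2 noise_L2)
    measurable

lemma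
  shows integrable_X_inner_snd: "integrable joint (\<lambda>z. X (fst z) \<bullet> snd z)"
    and integral_X_inner_snd: "(\<integral>z. X (fst z) \<bullet> snd z \<partial>joint) = 0"
proof -
  show i: "integrable joint (\<lambda>z. X (fst z) \<bullet> snd z)"
    by (intro integrable_inner_L2 integrable_fst_joint X_L2 noise_L2) measurable
  have "(\<integral>z. X (fst z) \<bullet> snd z \<partial>joint) = (\<integral>\<omega>. \<integral>g. X \<omega> \<bullet> g \<partial>std_gaussian \<partial>M)"
    using joint.integral_fst[of "\<lambda>\<omega> g. X \<omega> \<bullet> g"] i by (simp add: case_prod_unfold)
  then show "(\<integral>z. X (fst z) \<bullet> snd z \<partial>joint) = 0" by (simp add: std_gaussian_inner_moments)
qed

lemma mmse_eq:
  assumes s: "0 < s"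
  shows "mmse s = second_moment - (\<integral>z. (norm (post_mean s (obs s z)))\<^sup>2 \<partial>joint)"
proof -
  let ?m = "\<lambda>z. post_mean s (obs s z)"
  have i: "integrable joint (\<lambda>z. ?m z \<bullet> X (fst z))"
    by (intro integrable_inner_L2 post_mean_L2 s integrable_fst_joint X_L2) measurable
  have "(norm (X (fst z) - ?m z))\<^sup>2 = (norm (X (fst z)))\<^sup>2 - 2 * (?m z \<bullet> X (fst z)) + (norm (?m z))\<^sup>2" for z
    unfolding power2_norm_eq_inner by (simp add: inner_diff_left inner_diff_right inner_commute)
  then have "mmse s = second_moment - 2 * (\<integral>z. ?m z \<bullet> X (fst z) \<partial>joint) + (\<integral>z. (norm (?m z))\<^sup>2 \<partial>joint)"
    unfolding mmse_def using i post_mean_L2[OF s] integrable_fst_joint[OF X_L2] integral_fst_joint[OF X_L2] by simp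
  then show ?thesis
    using post_mean_inner[OF s post_mean_measurable post_mean_L2[OF s]] by (simp add: dot_square_norm)
qed

lemma mmse_nonneg: "0 \<le> mmse s"
  by (simp add: mmse_def)

text \<open>The projection property with the observation itself as test function.\<close>
lemma post_mean_inner_obs:
  assumes s: "0 < s"
  shows "(\<integral>z. obs s z \<bullet> post_mean s (obs s z) \<partial>joint) = s * second_moment"
proof -
  have "(\<integral>z. obs s z \<bullet> post_mean s (obs s z) \<partial>joint) = (\<integral>z. obs s z \<bullet> X (fst z) \<partial>joint)"
    using post_mean_inner[OF s, of "\<lambda>y. y"] obs_L2[OF s] by simp
  also have "\<dots> = (\<integral>z. s * (norm (X (fst z)))\<^sup>2 + sqrt s * (X (fst z) \<bullet> snd z) \<partial>joint)"
    by (simp add: obs_def inner_add_left dot_square_norm inner_commute[of "snd _" "X _"])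
  also have "\<dots> = s * second_moment"
    using integrable_X_inner_snd integrable_fst_joint[OF X_L2] integral_fst_joint[OF X_L2] by (simp add: integral_X_inner_snd)
  finally show ?thesis .
qed

text \<open>Replacing the signal by a fresh sample from its posterior does not change the joint law of
signal and observation.\<close>
lemma resample:
  assumes s: "0 < s" and [measurable]: "f \<in> borel_measurable (M \<Otimes>\<^sub>M borel)"
  shows "(\<integral>\<^sup>+z. \<integral>\<^sup>+\<omega>. ennreal (tilt s (obs s z) \<omega> / evidence s (obs s z)) * f (\<omega>, obs s z) \<partial>M \<partial>joint)
    = (\<integral>\<^sup>+z. f (fst z, obs s z) \<partial>joint)"
proof -
  define h where "h y = (\<integral>\<^sup>+\<omega>. ennreal (tilt s y \<omega> / evidence s y) * f (\<omega>, y) \<partial>M)" for y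
  have [measurable]: "h \<in> borel_measurable borel" unfolding h_def by measurable
  have h: "ennreal (evidence s y) * h y = (\<integral>\<^sup>+\<omega>. ennreal (tilt s y \<omega>) * f (\<omega>, y) \<partial>M)" for y
    unfolding h_def using evidence_pos[OF s, of y]
    by (subst nn_integral_cmult[symmetric]) (simp_all add: mult.assoc[symmetric] flip: ennreal_mult')
  have "(\<integral>\<^sup>+z. h (obs s z) \<partial>joint)
     = (\<integral>\<^sup>+g. \<integral>\<^sup>+\<omega>. ennreal (tilt s (sqrt s *\<^sub>R g) \<omega>) * h (sqrt s *\<^sub>R g) \<partial>M \<partial>std_gaussian)"
    using channel_nn_integral[OF s, of "\<lambda>z. h (snd z)"] by simp
  also have "\<dots> = (\<integral>\<^sup>+g. \<integral>\<^sup>+\<omega>. ennreal (tilt s (sqrt s *\<^sub>R g) \<omega>) * f (\<omega>, sqrt s *\<^sub>R g) \<partial>M \<partial>std_gaussian)"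
    by (simp add: nn_integral_multc nn_integral_tilt[OF s] h)
  also have "\<dots> = (\<integral>\<^sup>+z. f (fst z, obs s z) \<partial>joint)"
    by (rule channel_nn_integral[OF s, symmetric]) measurable
  finally show ?thesis unfolding h_def .
qed

end

context gaussian_channel
begin

definition posterior :: "real \<Rightarrow> real^'d \<Rightarrow> 'a \<Rightarrow> real" where
  "posterior s y \<omega> = tilt s y \<omega> / evidence s y"

lemma posterior_measurable [measurable (raw)]:
  assumes [measurable]: "f \<in> borel_measurable N" "h \<in> measurable N M"
  shows "(\<lambda>x. posterior s (f x) (h x)) \<in> borel_measurable N"
  unfolding posterior_def by measurable

lemma posterior_nonneg: "0 < s \<Longrightarrow> 0 \<le> posterior s y \<omega>"
  using evidence_pos[of s y] by (simp add: posterior_def)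

lemma nn_integral_posterior: "0 < s \<Longrightarrow> (\<integral>\<^sup>+\<omega>. ennreal (posterior s y \<omega>) \<partial>M) = 1"
proof -
  assume s: "0 < s"
  have "(\<integral>\<^sup>+\<omega>. ennreal (posterior s y \<omega>) \<partial>M) = ennreal (\<integral>\<omega>. posterior s y \<omega> \<partial>M)"
    using tilt_integrable[OF s, of y] posterior_nonneg[OF s]
    by (intro nn_integral_eq_integral) (simp_all add: posterior_def)
  then show ?thesis using evidence_pos[OF s, of y]
    by (simp add: posterior_def) (simp add: evidence_def)
qed

text \<open>Under the posterior the signal is again the input of a Gaussian channel. Since the tilts multiply,
observing at level \<open>s\<close> and then independently at level \<open>r\<close> amounts to observing at level
\<open>s + r\<close>; facts about conditioning on a first observation need no separate proof.\<close>
lemma posterior_channel: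
  assumes s: "0 < s"
  shows "gaussian_channel (density M (\<lambda>\<omega>. ennreal (posterior s y \<omega>))) X"
proof -
  interpret T: prob_space "density M (\<lambda>\<omega>. ennreal (posterior s y \<omega>))"
    by (rule prob_spaceI) (simp add: emeasure_density nn_integral_posterior[OF s] cong: nn_integral_cong)
  show ?thesis
  proof
    have "integrable M (\<lambda>\<omega>. posterior s y \<omega> *\<^sub>R (norm (X \<omega>))\<^sup>2)"
      using tilt_scaleR_integrable[OF s X_L2, of y] by (simp add: posterior_def)
    then show "integrable (density M (\<lambda>\<omega>. ennreal (posterior s y \<omega>))) (\<lambda>\<omega>. (norm (X \<omega>))\<^sup>2)"
      using posterior_nonneg[OF s] by (subst integrable_density) simp_all
  qed simp
qed

lemma tilt_tilt: "tilt s y \<omega> * tilt r x \<omega> = tilt (s + r) (y + x) \<omega>"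
  by (simp add: tilt_def inner_add_right algebra_simps add_divide_distrib flip: exp_add)

lemma posterior_post_mean:
  assumes s: "0 < s" and r: "0 < r"
  shows "gaussian_channel.post_mean (density M (\<lambda>\<omega>. ennreal (posterior s y \<omega>))) X r x
           = post_mean (s + r) (y + x)"
proof -
  interpret T: gaussian_channel "density M (\<lambda>\<omega>. ennreal (posterior s y \<omega>))" X
    by (rule posterior_channel[OF s])
  have eq: "(\<integral>\<omega>. tilt r x \<omega> *\<^sub>R f \<omega> \<partial>density M (\<lambda>\<omega>. ennreal (posterior s y \<omega>)))
      = (1 / evidence s y) *\<^sub>R (\<integral>\<omega>. tilt (s + r) (y + x) \<omega> *\<^sub>R f \<omega> \<partial>M)"
    if [measurable]: "f \<in> borel_measurable M" for f :: "'a \<Rightarrow> 'b::euclidean_space"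
  proof -
    have "(\<integral>\<omega>. tilt r x \<omega> *\<^sub>R f \<omega> \<partial>density M (\<lambda>\<omega>. ennreal (posterior s y \<omega>)))
      = (\<integral>\<omega>. posterior s y \<omega> *\<^sub>R tilt r x \<omega> *\<^sub>R f \<omega> \<partial>M)"
      using posterior_nonneg[OF s] by (subst integral_density) simp_all
    also have "\<dots> = (\<integral>\<omega>. (1 / evidence s y) *\<^sub>R (tilt (s + r) (y + x) \<omega> *\<^sub>R f \<omega>) \<partial>M)"
      by (simp add: posterior_def flip: tilt_tilt)
    finally show ?thesis by (simp only: integral_scaleR_right)
  qed
  have "T.evidence r x = (1 / evidence s y) * evidence (s + r) (y + x)"
    using eq[of "\<lambda>_. 1::real"] by (simp add: T.evidence_def evidence_def)
  then show ?thesis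
    using eq[OF X_measurable] evidence_pos[OF s, of y]
    by (simp add: T.post_mean_def post_mean_def)
qed

text \<open>The tower property. It is the projection property of the posterior channel for a constant test
function, and it holds for every value \<open>y\<close> of the first observation.\<close>
lemma post_mean_martingale:
  assumes s: "0 < s" and r: "0 < r"
  shows "(\<integral>z. posterior s y (fst z) * (v \<bullet> post_mean (s + r) (y + obs r z)) \<partial>joint) = v \<bullet> post_mean s y"
proof -
  let ?T = "density M (\<lambda>\<omega>. ennreal (posterior s y \<omega>))"
  interpret T: gaussian_channel ?T X by (rule posterior_channel[OF s])
  have D: "T.joint = density joint (\<lambda>z. ennreal (posterior s y (fst z)))"
    using pair_measure_density[of "\<lambda>\<omega>. ennreal (posterior s y \<omega>)" M "\<lambda>_. 1" std_gaussian]
    by (simp add: density_1 std_gaussian.sigma_finite_measure_axioms T.sigma_finite_measure_axioms case_prod_unfold)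
  have "(\<integral>z. posterior s y (fst z) * (v \<bullet> post_mean (s + r) (y + obs r z)) \<partial>joint)
     = (\<integral>z. v \<bullet> T.post_mean r (obs r z) \<partial>T.joint)"
    unfolding D posterior_post_mean[OF s r] using posterior_nonneg[OF s]
    by (subst integral_density) simp_all
  also have "\<dots> = (\<integral>z. v \<bullet> X (fst z) \<partial>T.joint)"
    by (rule T.post_mean_inner[OF r, of "\<lambda>_. v", symmetric]) simp_all
  also have "\<dots> = (\<integral>\<omega>. v \<bullet> X \<omega> \<partial>?T)"
    using T.X_integrable by (intro T.integral_fst_joint) simp
  also have "\<dots> = (\<integral>\<omega>. posterior s y \<omega> * (v \<bullet> X \<omega>) \<partial>M)"
    using posterior_nonneg[OF s] by (subst integral_density) simp_all
  also have "\<dots> = v \<bullet> post_mean s y"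
    using tilted_inner(2)[OF s, of y v] evidence_pos[OF s, of y] by (simp add: posterior_def)
  finally show ?thesis .
qed

text \<open>Two successive observations with noises \<open>b\<close> and \<open>a\<close> form one observation with noise
\<open>\<alpha> a + \<beta> b\<close>, which is independent of \<open>\<alpha> b - \<beta> a\<close>. The second component expresses the new noise
\<open>a\<close> through these two.\<close>
lemma increment_law:
  assumes s: "0 < s" and r: "0 < r"
  shows "distr (joint \<Otimes>\<^sub>M std_gaussian) (borel \<Otimes>\<^sub>M borel)
      (\<lambda>p. (obs s (fst p) + obs r (fst (fst p), snd p), snd p))
    = distr (joint \<Otimes>\<^sub>M std_gaussian) (borel \<Otimes>\<^sub>M borel)
      (\<lambda>p. (obs (s + r) (fst p), sqrt (r / (s + r)) *\<^sub>R snd (fst p) - sqrt (s / (s + r)) *\<^sub>R snd p))"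
proof (rule distr_eqI_nn_integral)
  define \<alpha> where "\<alpha> = sqrt (r / (s + r))"
  define \<beta> where "\<beta> = sqrt (s / (s + r))"
  have ab: "\<alpha>\<^sup>2 + \<beta>\<^sup>2 = 1" "0 < \<alpha>"
    using assms by (simp_all add: \<alpha>_def \<beta>_def flip: add_divide_distrib)
  have c: "sqrt s = sqrt (s + r) * \<beta>" "sqrt r = sqrt (s + r) * \<alpha>"
    using assms by (simp_all add: \<alpha>_def \<beta>_def real_sqrt_divide)
  let ?G = "std_gaussian \<Otimes>\<^sub>M std_gaussian :: ((real^'d) \<times> (real^'d)) measure"
  let ?rot = "\<lambda>(b, a). (\<alpha> *\<^sub>R b - \<beta> *\<^sub>R a, \<alpha> *\<^sub>R a + \<beta> *\<^sub>R b) :: (real^'d) \<times> (real^'d)"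
  fix h :: "(real^'d) \<times> (real^'d) \<Rightarrow> ennreal"
  assume [measurable]: "h \<in> borel_measurable (borel \<Otimes>\<^sub>M borel)"
  \<comment> \<open>The test function expressed in the rotated pair \<open>q = (\<alpha> b - \<beta> a, \<alpha> a + \<beta> b)\<close>.\<close>
  define F where "F \<omega> q = h ((s + r) *\<^sub>R X \<omega> + sqrt (s + r) *\<^sub>R snd q, \<alpha> *\<^sub>R snd q - \<beta> *\<^sub>R fst q)" for \<omega> q
  have [measurable]: "F \<omega> \<in> borel_measurable (borel \<Otimes>\<^sub>M borel)" for \<omega>
    unfolding F_def by measurable
  have rotF: "h (s *\<^sub>R X \<omega> + sqrt s *\<^sub>R b + (r *\<^sub>R X \<omega> + sqrt r *\<^sub>R a), a) = F \<omega> (?rot (b, a))" for \<omega> a b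
  proof -
    have 1: "s *\<^sub>R X \<omega> + sqrt s *\<^sub>R b + (r *\<^sub>R X \<omega> + sqrt r *\<^sub>R a)
        = (s + r) *\<^sub>R X \<omega> + sqrt (s + r) *\<^sub>R (\<alpha> *\<^sub>R a + \<beta> *\<^sub>R b)"
      by (simp add: c algebra_simps)
    \<comment> \<open>The inverse rotation recovers the second noise.\<close>
    have "\<alpha> *\<^sub>R (\<alpha> *\<^sub>R a + \<beta> *\<^sub>R b) - \<beta> *\<^sub>R (\<alpha> *\<^sub>R b - \<beta> *\<^sub>R a) = (\<alpha>\<^sup>2 + \<beta>\<^sup>2) *\<^sub>R a"
      by (simp add: algebra_simps power2_eq_square)
    then show ?thesis unfolding F_def 1 by (simp add: ab)
  qed
  have "(\<integral>\<^sup>+p. h (obs s (fst p) + obs r (fst (fst p), snd p), snd p) \<partial>(joint \<Otimes>\<^sub>M std_gaussian))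
     = (\<integral>\<^sup>+\<omega>. \<integral>\<^sup>+b. \<integral>\<^sup>+a. h (obs s (\<omega>, b) + obs r (\<omega>, a), a) \<partial>std_gaussian \<partial>std_gaussian \<partial>M)"
    by (subst std_gaussian.nn_integral_fst[symmetric], measurable,
        subst std_gaussian.nn_integral_fst[symmetric], measurable)
  also have "\<dots> = (\<integral>\<^sup>+\<omega>. \<integral>\<^sup>+q. F \<omega> (?rot q) \<partial>?G \<partial>M)"
    unfolding obs_def fst_conv snd_conv rotF
    by (intro nn_integral_cong std_gaussian.nn_integral_fst) simp
  also have "\<dots> = (\<integral>\<^sup>+\<omega>. \<integral>\<^sup>+q. F \<omega> q \<partial>?G \<partial>M)"
  proof (rule nn_integral_cong)
    fix \<omega>
    have "(\<integral>\<^sup>+q. F \<omega> q \<partial>?G) = (\<integral>\<^sup>+q. F \<omega> q \<partial>distr ?G (borel \<Otimes>\<^sub>M borel) ?rot)"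
      unfolding std_gaussian_rotate[OF ab] ..
    also have "\<dots> = (\<integral>\<^sup>+q. F \<omega> (?rot q) \<partial>?G)" by (subst nn_integral_distr) simp_all
    finally show "(\<integral>\<^sup>+q. F \<omega> (?rot q) \<partial>?G) = (\<integral>\<^sup>+q. F \<omega> q \<partial>?G)" ..
  qed
  also have "\<dots> = (\<integral>\<^sup>+\<omega>. \<integral>\<^sup>+a. \<integral>\<^sup>+b. F \<omega> (b, a) \<partial>std_gaussian \<partial>std_gaussian \<partial>M)"
    by (subst std_gaussian_pair.nn_integral_snd[symmetric]) simp_all
  also have "\<dots> = (\<integral>\<^sup>+p. h (obs (s + r) (fst p), \<alpha> *\<^sub>R snd (fst p) - \<beta> *\<^sub>R snd p) \<partial>(joint \<Otimes>\<^sub>M std_gaussian))"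
    unfolding F_def
    by (subst std_gaussian.nn_integral_fst[symmetric], measurable,
        subst std_gaussian.nn_integral_fst[symmetric], measurable) (simp add: obs_def)
  finally show "(\<integral>\<^sup>+p. h (obs s (fst p) + obs r (fst (fst p), snd p), snd p) \<partial>(joint \<Otimes>\<^sub>M std_gaussian))
    = (\<integral>\<^sup>+p. h (obs (s + r) (fst p), sqrt (r / (s + r)) *\<^sub>R snd (fst p) - sqrt (s / (s + r)) *\<^sub>R snd p) \<partial>(joint \<Otimes>\<^sub>M std_gaussian))"
    unfolding \<alpha>_def \<beta>_def .
qed (unfold obs_def, measurable)

end

section \<open>A coupling built from resampled posteriors\<close>

context gaussian_channel
begin

text \<open>A joint law of an observation at level \<open>s\<close> and a centred Gaussian vector with covariance \<open>t Id\<close>.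
Its overlap \<open>G\<close> is \<open>E (X \<bullet> N)\<close> if \<open>X\<close> is then drawn from the posterior given the observation.\<close>
definition overlap_coupling :: "real \<Rightarrow> real \<Rightarrow> real \<Rightarrow> ((real^'d) \<times> (real^'d)) measure \<Rightarrow> bool" where
  "overlap_coupling s t G Q \<longleftrightarrow> prob_space Q \<and> sets Q = sets (borel \<Otimes>\<^sub>M borel) \<and>
     distr Q borel fst = distr joint borel (obs s) \<and>
     distr Q borel snd = distr std_gaussian borel (\<lambda>g. sqrt t *\<^sub>R g) \<and>
     (\<integral>q. post_mean s (fst q) \<bullet> snd q \<partial>Q) = G"

lemma post_mean_L2_borel:
  assumes "0 < s" and "distr Q borel f = distr joint borel (obs s)" and [measurable]: "f \<in> borel_measurable Q"
  shows "integrable Q (\<lambda>q. (norm (post_mean s (f q)))\<^sup>2)"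
  using integrable_eq_of_distr_eq[OF assms(2), of "\<lambda>y. (norm (post_mean s y))\<^sup>2"] post_mean_L2[OF assms(1)]
  by simp

end

lemma gaussian_scaled_L2:
  assumes "distr Q borel f = distr std_gaussian borel (\<lambda>g. sqrt t *\<^sub>R g)" and [measurable]: "f \<in> borel_measurable Q"
  shows "integrable Q (\<lambda>q. (norm (f q :: real^'d))\<^sup>2)"
  using integrable_eq_of_distr_eq[OF assms(1), of "\<lambda>y. (norm y)\<^sup>2"] 
    integrable_norm_scaleR_L2[OF std_gaussian_norm_moment(1), of "sqrt t"]
  by simp

locale overlap_step = gaussian_channel M X for M :: "'a measure" and X :: "'a \<Rightarrow> real^'d" +
  fixes s t G :: real and Q :: "((real^'d) \<times> (real^'d)) measure"
  assumes s: "0 < s" and t: "0 \<le> t" and Q: "overlap_coupling s t G Q"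
begin

sublocale Q: prob_space Q using Q by (simp add: overlap_coupling_def)

lemma sets_Q [measurable_cong]: "sets Q = sets (borel \<Otimes>\<^sub>M borel)"
  and Q_fst: "distr Q borel fst = distr joint borel (obs s)"
  and Q_snd: "distr Q borel snd = distr std_gaussian borel (\<lambda>g. sqrt t *\<^sub>R g)"
  and Q_overlap: "(\<integral>q. post_mean s (fst q) \<bullet> snd q \<partial>Q) = G"
  using Q by (simp_all add: overlap_coupling_def)

sublocale QJ: pair_prob_space Q joint ..

text \<open>The law of \<open>((y, n), (\<omega>, g))\<close>: the pair \<open>(y, n)\<close> has law \<open>Q\<close>, given this pair \<open>\<omega>\<close> is drawn from the
posterior at \<open>y\<close>, and \<open>g\<close> is fresh noise. The posterior has a density with respect to \<open>M\<close>, so no Markov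
kernel is needed. Both the next step of the chain and the final coupling are images of this law.\<close>
definition refinement :: "(((real^'d) \<times> (real^'d)) \<times> ('a \<times> (real^'d))) measure" where
  "refinement = density (Q \<Otimes>\<^sub>M joint) (\<lambda>p. ennreal (posterior s (fst (fst p)) (fst (snd p))))"

lemma sets_refinement [measurable_cong]: "sets refinement = sets (Q \<Otimes>\<^sub>M joint)"
  by (simp add: refinement_def)

lemma nn_integral_refinement:
  assumes [measurable]: "f \<in> borel_measurable (Q \<Otimes>\<^sub>M joint)"
  shows "(\<integral>\<^sup>+p. f p \<partial>refinement) = (\<integral>\<^sup>+q. \<integral>\<^sup>+\<omega>. ennreal (posterior s (fst q) \<omega>) * (\<integral>\<^sup>+g. f (q, (\<omega>, g)) \<partial>std_gaussian) \<partial>M \<partial>Q)"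
proof -
  have "(\<integral>\<^sup>+p. f p \<partial>refinement) = (\<integral>\<^sup>+p. ennreal (posterior s (fst (fst p)) (fst (snd p))) * f p \<partial>(Q \<Otimes>\<^sub>M joint))"
    unfolding refinement_def by (subst nn_integral_density) simp_all
  also have "\<dots> = (\<integral>\<^sup>+q. \<integral>\<^sup>+z. ennreal (posterior s (fst q) (fst z)) * f (q, z) \<partial>joint \<partial>Q)"
    by (subst joint.nn_integral_fst[symmetric]) simp_all
  also have "\<dots> = (\<integral>\<^sup>+q. \<integral>\<^sup>+\<omega>. \<integral>\<^sup>+g. ennreal (posterior s (fst q) \<omega>) * f (q, (\<omega>, g)) \<partial>std_gaussian \<partial>M \<partial>Q)"
    by (intro nn_integral_cong, subst std_gaussian.nn_integral_fst[symmetric]) simp_all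
  also have "\<dots> = (\<integral>\<^sup>+q. \<integral>\<^sup>+\<omega>. ennreal (posterior s (fst q) \<omega>) * (\<integral>\<^sup>+g. f (q, (\<omega>, g)) \<partial>std_gaussian) \<partial>M \<partial>Q)"
    by (intro nn_integral_cong nn_integral_cmult) simp
  finally show ?thesis .
qed

text \<open>Forgetting \<open>n\<close>, the resampled \<open>\<omega>\<close> and \<open>y\<close> are indistinguishable from a true signal and its
observation.\<close>
lemma refinement_law:
  "distr refinement (borel \<Otimes>\<^sub>M (M \<Otimes>\<^sub>M borel)) (\<lambda>p. (fst (fst p), snd p))
    = distr joint_noise (borel \<Otimes>\<^sub>M (M \<Otimes>\<^sub>M borel)) (\<lambda>p. (obs s (fst p), (fst (fst p), snd p)))"
proof (rule distr_eqI_nn_integral)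
  fix h :: "(real^'d) \<times> ('a \<times> (real^'d)) \<Rightarrow> ennreal"
  assume [measurable]: "h \<in> borel_measurable (borel \<Otimes>\<^sub>M (M \<Otimes>\<^sub>M borel))"
  define f where "f y \<omega> = (\<integral>\<^sup>+g. h (y, (\<omega>, g)) \<partial>std_gaussian)" for y \<omega>
  have [measurable]: "(\<lambda>x. f (fst x) (snd x)) \<in> borel_measurable (borel \<Otimes>\<^sub>M M)"
    unfolding f_def by measurable
  have [measurable]: "(\<lambda>x. f (snd x) (fst x)) \<in> borel_measurable (M \<Otimes>\<^sub>M borel)"
    unfolding f_def by measurable
  define k where "k y = (\<integral>\<^sup>+\<omega>. ennreal (posterior s y \<omega>) * f y \<omega> \<partial>M)" for y
  have [measurable]: "k \<in> borel_measurable borel" unfolding k_def f_def by measurable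
  have "(\<integral>\<^sup>+p. h (fst (fst p), snd p) \<partial>refinement) = (\<integral>\<^sup>+q. k (fst q) \<partial>Q)"
    by (subst nn_integral_refinement) (simp_all add: k_def f_def)
  also have "\<dots> = (\<integral>\<^sup>+y. k y \<partial>distr Q borel fst)"
    by (subst nn_integral_distr) simp_all
  also have "\<dots> = (\<integral>\<^sup>+z. k (obs s z) \<partial>joint)"
    unfolding Q_fst by (subst nn_integral_distr) simp_all
  also have "\<dots> = (\<integral>\<^sup>+z. f (obs s z) (fst z) \<partial>joint)"
    using resample[OF s, of "\<lambda>x. f (snd x) (fst x)"] by (simp add: k_def posterior_def)
  also have "\<dots> = (\<integral>\<^sup>+p. h (obs s (fst p), (fst (fst p), snd p)) \<partial>joint_noise)"
    unfolding f_def by (subst std_gaussian.nn_integral_fst[symmetric]) simp_all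
  finally show "(\<integral>\<^sup>+p. h (fst (fst p), snd p) \<partial>refinement)
     = (\<integral>\<^sup>+p. h (obs s (fst p), (fst (fst p), snd p)) \<partial>joint_noise)" .
qed simp_all

lemma prob_space_refinement: "prob_space refinement"
proof
  have "emeasure refinement (space refinement) = (\<integral>\<^sup>+p. 1 \<partial>refinement)" by simp
  also have "\<dots> = 1"
    by (subst nn_integral_refinement)
       (simp_all add: nn_integral_posterior[OF s] Q.emeasure_space_1 std_gaussian.emeasure_space_1[simplified])
  finally show "emeasure refinement (space refinement) = 1" .
qed

sublocale refinement: prob_space refinement by (rule prob_space_refinement)

lemma refinement_noise_law:
  assumes e: "0 < e"
  shows "distr refinement borel (\<lambda>p. snd (fst p) + sqrt e *\<^sub>R snd (snd p)) = distr std_gaussian borel (\<lambda>g. sqrt (t + e) *\<^sub>R g)"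
proof -
  have "distr refinement borel (\<lambda>p. snd (fst p) + sqrt e *\<^sub>R snd (snd p))
    = distr (std_gaussian \<Otimes>\<^sub>M std_gaussian) borel (\<lambda>z. sqrt t *\<^sub>R fst z + sqrt e *\<^sub>R snd z)"
  proof (rule distr_eqI_nn_integral)
    fix h :: "real^'d \<Rightarrow> ennreal" assume [measurable]: "h \<in> borel_measurable borel"
    define f where "f y = (\<integral>\<^sup>+g. h (y + sqrt e *\<^sub>R g) \<partial>std_gaussian)" for y
    have [measurable]: "f \<in> borel_measurable borel" unfolding f_def by measurable
    have "(\<integral>\<^sup>+p. h (snd (fst p) + sqrt e *\<^sub>R snd (snd p)) \<partial>refinement) = (\<integral>\<^sup>+q. f (snd q) \<partial>Q)"
      by (subst nn_integral_refinement) (simp_all add: f_def nn_integral_multc nn_integral_posterior[OF s])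
    also have "\<dots> = (\<integral>\<^sup>+y. f y \<partial>distr Q borel snd)"
      by (subst nn_integral_distr) simp_all
    also have "\<dots> = (\<integral>\<^sup>+g. f (sqrt t *\<^sub>R g) \<partial>std_gaussian)"
      unfolding Q_snd by (subst nn_integral_distr) simp_all
    also have "\<dots> = (\<integral>\<^sup>+z. h (sqrt t *\<^sub>R fst z + sqrt e *\<^sub>R snd z) \<partial>(std_gaussian \<Otimes>\<^sub>M std_gaussian))"
      unfolding f_def by (subst std_gaussian.nn_integral_fst[symmetric]) simp_all
    finally show "(\<integral>\<^sup>+p. h (snd (fst p) + sqrt e *\<^sub>R snd (snd p)) \<partial>refinement)
      = (\<integral>\<^sup>+z. h (sqrt t *\<^sub>R fst z + sqrt e *\<^sub>R snd z) \<partial>(std_gaussian \<Otimes>\<^sub>M std_gaussian))" .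
  qed simp_all
  then show ?thesis using std_gaussian_sum_law[OF t e] by simp
qed

lemma refinement_X_law: "distr refinement borel (\<lambda>p. X (fst (snd p))) = distr M borel X"
proof -
  let ?N = "borel \<Otimes>\<^sub>M (M \<Otimes>\<^sub>M borel)"
  have "distr refinement borel (\<lambda>p. X (fst (snd p))) = distr (distr refinement ?N (\<lambda>p. (fst (fst p), snd p))) borel (\<lambda>x. X (fst (snd x)))"
    by (subst distr_distr) (simp_all add: comp_def)
  also have "\<dots> = distr joint_noise borel (\<lambda>p. X (fst (fst p)))"
    unfolding refinement_law by (subst distr_distr) (simp_all add: comp_def)
  also have "\<dots> = distr (distr (distr joint_noise joint fst) M fst) borel X"
    by (simp add: distr_distr comp_def)
  also have "\<dots> = distr M borel X"
    by (simp add: std_gaussian.distr_pair_fst)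
  finally show ?thesis .
qed

lemma refinement_observation_law:
  assumes r: "0 < r"
  shows "distr refinement (borel \<Otimes>\<^sub>M borel) (\<lambda>p. (fst (fst p) + obs r (snd p), snd (snd p)))
    = distr joint_noise (borel \<Otimes>\<^sub>M borel)
      (\<lambda>p. (obs (s + r) (fst p), sqrt (r / (s + r)) *\<^sub>R snd (fst p) - sqrt (s / (s + r)) *\<^sub>R snd p))"
proof -
  let ?N = "borel \<Otimes>\<^sub>M (M \<Otimes>\<^sub>M borel)"
  have [measurable]: "obs r \<in> borel_measurable (M \<Otimes>\<^sub>M borel)" unfolding obs_def by measurable
  have "distr refinement (borel \<Otimes>\<^sub>M borel) (\<lambda>p. (fst (fst p) + obs r (snd p), snd (snd p)))
    = distr (distr refinement ?N (\<lambda>p. (fst (fst p), snd p))) (borel \<Otimes>\<^sub>M borel) (\<lambda>x. (fst x + obs r (snd x), snd (snd x)))"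
    by (subst distr_distr) (simp_all add: comp_def)
  also have "\<dots> = distr joint_noise (borel \<Otimes>\<^sub>M borel)
      (\<lambda>p. (obs s (fst p) + obs r (fst (fst p), snd p), snd p))"
    unfolding refinement_law by (subst distr_distr) (simp_all add: comp_def)
  finally show ?thesis unfolding increment_law[OF s r] .
qed

lemma refinement_new_observation_law:
  assumes r: "0 < r"
  shows "distr refinement borel (\<lambda>p. fst (fst p) + obs r (snd p)) = distr joint borel (obs (s + r))"
proof -
  have [measurable]: "obs r \<in> borel_measurable (M \<Otimes>\<^sub>M borel)" unfolding obs_def by measurable
  have "distr refinement borel (\<lambda>p. fst (fst p) + obs r (snd p))
    = distr (distr refinement (borel \<Otimes>\<^sub>M borel) (\<lambda>p. (fst (fst p) + obs r (snd p), snd (snd p)))) borel fst"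
    by (subst distr_distr) (simp_all add: comp_def)
  also have "\<dots> = distr (distr joint_noise joint fst) borel (obs (s + r))"
    unfolding refinement_observation_law[OF r] by (subst distr_distr, simp, simp, subst distr_distr) (simp_all add: comp_def)
  finally show ?thesis by (simp add: std_gaussian.distr_pair_fst)
qed

lemma refinement_noise_L2: "integrable refinement (\<lambda>p. (norm (snd (snd p)))\<^sup>2)"
proof -
  have "integrable joint_noise (\<lambda>p. (norm (snd p))\<^sup>2)"
    by (intro integrable_snd_noise std_gaussian_norm_moment)
  then show ?thesis
    using integrable_eq_of_distr_eq[OF refinement_law, of "\<lambda>x. (norm (snd (snd x)))\<^sup>2"] by simp
qed

lemma refinement_old_L2: "integrable refinement (\<lambda>p. (norm (snd (fst p)))\<^sup>2)"
proof (rule integrableI_bounded)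
  have "(\<integral>\<^sup>+p. ennreal ((norm (snd (fst p)))\<^sup>2) \<partial>refinement) = (\<integral>\<^sup>+q. ennreal ((norm (snd q))\<^sup>2) \<partial>Q)"
    by (subst nn_integral_refinement)
       (simp_all add: nn_integral_multc nn_integral_posterior[OF s] std_gaussian.emeasure_space_1[simplified])
  also have "\<dots> < \<infinity>"
    using gaussian_scaled_L2[OF Q_snd] by (simp add: integrable_iff_bounded)
  finally show "(\<integral>\<^sup>+p. ennreal (norm ((norm (snd (fst p)))\<^sup>2)) \<partial>refinement) < \<infinity>" by simp
qed measurable

lemma refinement_X_L2: "integrable refinement (\<lambda>p. (norm (X (fst (snd p))))\<^sup>2)"
  using integrable_eq_of_distr_eq[OF refinement_X_law, of "\<lambda>y. (norm y)\<^sup>2"] X_L2 by simp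

lemma integral_refinement:
  fixes f :: "_ \<Rightarrow> real"
  assumes f: "integrable refinement f"
  shows "(\<integral>p. f p \<partial>refinement) = (\<integral>q. \<integral>z. posterior s (fst q) (fst z) * f (q, z) \<partial>joint \<partial>Q)"
proof -
  have [measurable]: "f \<in> borel_measurable (Q \<Otimes>\<^sub>M joint)"
    using borel_measurable_integrable[OF f] by (simp add: refinement_def)
  have i: "integrable (Q \<Otimes>\<^sub>M joint) (\<lambda>p. posterior s (fst (fst p)) (fst (snd p)) * f p)"
    using f posterior_nonneg[OF s] unfolding refinement_def by (subst (asm) integrable_density) simp_all
  have "(\<integral>p. f p \<partial>refinement) = (\<integral>p. posterior s (fst (fst p)) (fst (snd p)) * f p \<partial>(Q \<Otimes>\<^sub>M joint))"
    unfolding refinement_def using posterior_nonneg[OF s] by (subst integral_density) simp_all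
  also have "\<dots> = (\<integral>q. \<integral>z. posterior s (fst q) (fst z) * f (q, z) \<partial>joint \<partial>Q)"
    using QJ.integral_fst[of "\<lambda>q z. posterior s (fst q) (fst z) * f (q, z)"] i by (simp add: case_prod_unfold)
  finally show ?thesis .
qed

text \<open>By the martingale property the finer observation does not change the average overlap with the
noise that has already been used.\<close>
lemma refinement_overlap_old:
  assumes r: "0 < r"
  shows "integrable refinement (\<lambda>p. post_mean (s + r) (fst (fst p) + obs r (snd p)) \<bullet> snd (fst p))"
    and "(\<integral>p. post_mean (s + r) (fst (fst p) + obs r (snd p)) \<bullet> snd (fst p) \<partial>refinement) = G"
proof -
  have sr: "0 < s + r" using s r by simp
  have [measurable]: "obs r \<in> borel_measurable (M \<Otimes>\<^sub>M borel)" unfolding obs_def by measurable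
  have "integrable refinement (\<lambda>p. (norm (post_mean (s + r) (fst (fst p) + obs r (snd p))))\<^sup>2)"
    by (rule post_mean_L2_borel[OF sr refinement_new_observation_law[OF r]]) measurable
  then show i: "integrable refinement (\<lambda>p. post_mean (s + r) (fst (fst p) + obs r (snd p)) \<bullet> snd (fst p))"
    by (intro integrable_inner_L2 refinement_old_L2) measurable
  have "(\<integral>p. post_mean (s + r) (fst (fst p) + obs r (snd p)) \<bullet> snd (fst p) \<partial>refinement)
      = (\<integral>q. snd q \<bullet> post_mean s (fst q) \<partial>Q)"
    unfolding integral_refinement[OF i] unfolding inner_commute[of "post_mean _ _" "snd _"]
    using post_mean_martingale[OF s r] by simp
  then show "(\<integral>p. post_mean (s + r) (fst (fst p) + obs r (snd p)) \<bullet> snd (fst p) \<partial>refinement) = G"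
    by (simp only: inner_commute[of "snd _" "post_mean _ _"] Q_overlap)
qed

text \<open>The fresh noise involves only the joint law of signal, observation and noise, so it can be computed
for the true signal. After rotation it is \<open>\<alpha>\<close> times the noise of the observation at level \<open>s + r\<close> plus an
independent term, and \<open>sqrt (s + r)\<close> times the former is the observation minus \<open>(s + r) X\<close>.\<close>
lemma refinement_overlap_new:
  assumes r: "0 < r"
  shows "integrable refinement (\<lambda>p. post_mean (s + r) (fst (fst p) + obs r (snd p)) \<bullet> snd (snd p))"
    and "(\<integral>p. post_mean (s + r) (fst (fst p) + obs r (snd p)) \<bullet> snd (snd p) \<partial>refinement) = sqrt r * mmse (s + r)"
proof -
  have sr: "0 < s + r" using s r by simp
  have [measurable]: "obs r \<in> borel_measurable (M \<Otimes>\<^sub>M borel)" unfolding obs_def by measurable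
  define \<alpha> where "\<alpha> = sqrt (r / (s + r))"
  define \<beta> where "\<beta> = sqrt (s / (s + r))"
  let ?m = "\<lambda>z. post_mean (s + r) (obs (s + r) z)"
  interpret P: pair_prob_space joint "std_gaussian :: (real^'d) measure" ..
  have law: "distr refinement (borel \<Otimes>\<^sub>M borel) (\<lambda>p. (fst (fst p) + obs r (snd p), snd (snd p)))
    = distr joint_noise (borel \<Otimes>\<^sub>M borel) (\<lambda>p. (obs (s + r) (fst p), \<alpha> *\<^sub>R snd (fst p) - \<beta> *\<^sub>R snd p))"
    unfolding refinement_observation_law[OF r] \<alpha>_def \<beta>_def ..
  have i0: "integrable joint (\<lambda>z. ?m z \<bullet> snd z)"
    by (intro integrable_inner_L2 post_mean_L2 sr noise_L2) measurable
  have i1: "integrable joint_noise (\<lambda>p. ?m (fst p) \<bullet> snd (fst p))"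
    by (rule integrable_fst_noise[OF i0])
  have i2: "integrable joint_noise (\<lambda>p. ?m (fst p) \<bullet> snd p)"
  proof (intro integrable_inner_L2)
    show "integrable joint_noise (\<lambda>p. (norm (?m (fst p)))\<^sup>2)"
      by (rule integrable_fst_noise[OF post_mean_L2[OF sr]])
    show "integrable joint_noise (\<lambda>p. (norm (snd p))\<^sup>2)"
      by (intro integrable_snd_noise std_gaussian_norm_moment)
  qed measurable
  have z: "(\<integral>p. ?m (fst p) \<bullet> snd p \<partial>joint_noise) = 0"
    using P.integral_fst[of "\<lambda>z g. ?m z \<bullet> g"] i2 by (simp add: case_prod_unfold std_gaussian_inner_moments)
  have split: "?m (fst p) \<bullet> (\<alpha> *\<^sub>R snd (fst p) - \<beta> *\<^sub>R snd p) = \<alpha> * (?m (fst p) \<bullet> snd (fst p)) - \<beta> * (?m (fst p) \<bullet> snd p)" for p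
    by (simp add: inner_diff_right)
  have i3: "integrable joint_noise (\<lambda>p. ?m (fst p) \<bullet> (\<alpha> *\<^sub>R snd (fst p) - \<beta> *\<^sub>R snd p))"
    unfolding split using i1 i2 by simp
  show "integrable refinement (\<lambda>p. post_mean (s + r) (fst (fst p) + obs r (snd p)) \<bullet> snd (snd p))"
    using integrable_eq_of_distr_eq[OF law, of "\<lambda>x. post_mean (s + r) (fst x) \<bullet> snd x"] i3 by simp
  \<comment> \<open>The noise of the observation is what remains of it after subtracting the signal.\<close>
  have "sqrt (s + r) * (\<integral>z. ?m z \<bullet> snd z \<partial>joint) = (\<integral>z. ?m z \<bullet> (sqrt (s + r) *\<^sub>R snd z) \<partial>joint)"
    by simp
  also have "\<dots> = (\<integral>z. ?m z \<bullet> obs (s + r) z - (s + r) * (?m z \<bullet> X (fst z)) \<partial>joint)"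
    by (simp add: obs_def inner_add_right)
  also have "\<dots> = (\<integral>z. ?m z \<bullet> obs (s + r) z \<partial>joint) - (s + r) * (\<integral>z. ?m z \<bullet> X (fst z) \<partial>joint)"
    by (subst Bochner_Integration.integral_diff)
       (auto intro!: integrable_inner_L2 post_mean_L2 sr obs_L2 integrable_fst_joint X_L2)
  also have "\<dots> = (s + r) * mmse (s + r)"
    using post_mean_inner_obs[OF sr] post_mean_inner[OF sr post_mean_measurable post_mean_L2[OF sr]]
    by (simp add: mmse_eq[OF sr] inner_commute[of "post_mean _ _" "obs _ _"] dot_square_norm right_diff_distrib)
  finally have "sqrt (s + r) * (\<integral>z. ?m z \<bullet> snd z \<partial>joint) = sqrt (s + r) * (sqrt (s + r) * mmse (s + r))"
    using sr by (simp flip: mult.assoc)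
  then have core: "(\<integral>z. ?m z \<bullet> snd z \<partial>joint) = sqrt (s + r) * mmse (s + r)" using sr by simp
  have "(\<integral>p. post_mean (s + r) (fst (fst p) + obs r (snd p)) \<bullet> snd (snd p) \<partial>refinement)
      = (\<integral>p. ?m (fst p) \<bullet> (\<alpha> *\<^sub>R snd (fst p) - \<beta> *\<^sub>R snd p) \<partial>joint_noise)"
    using integral_eq_of_distr_eq[OF law, of "\<lambda>x. post_mean (s + r) (fst x) \<bullet> snd x"] by simp
  also have "\<dots> = \<alpha> * (\<integral>z. ?m z \<bullet> snd z \<partial>joint)"
    unfolding split using i1 i2 integral_fst_noise[OF i0] by (simp add: z)
  also have "\<dots> = sqrt r * mmse (s + r)"
    unfolding core \<alpha>_def using sr by (simp add: real_sqrt_divide)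
  finally show "(\<integral>p. post_mean (s + r) (fst (fst p) + obs r (snd p)) \<bullet> snd (snd p) \<partial>refinement) = sqrt r * mmse (s + r)" .
qed

text \<open>One step of the chain. The noise that drives the observation with variance \<open>r\<close> enters the Gaussian
vector with variance \<open>e\<close>, and the two step sizes are free.\<close>
lemma overlap_coupling_extend:
  assumes r: "0 < r" and e: "0 < e"
  shows "\<exists>Q'. overlap_coupling (s + r) (t + e) (G + sqrt (r * e) * mmse (s + r)) Q'"
proof (intro exI)
  have [measurable]: "obs r \<in> borel_measurable (M \<Otimes>\<^sub>M borel)" unfolding obs_def by measurable
  let ?y = "\<lambda>p. fst (fst p) + obs r (snd p)" and ?n = "\<lambda>p. snd (fst p) + sqrt e *\<^sub>R snd (snd p)"
  let ?Q = "distr refinement (borel \<Otimes>\<^sub>M borel) (\<lambda>p. (?y p, ?n p))"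
  have 1: "distr ?Q borel fst = distr joint borel (obs (s + r))"
    by (subst distr_distr) (simp_all add: comp_def refinement_new_observation_law[OF r])
  have 2: "distr ?Q borel snd = distr std_gaussian borel (\<lambda>g. sqrt (t + e) *\<^sub>R g)"
    by (subst distr_distr) (simp_all add: comp_def refinement_noise_law[OF e])
  have "(\<integral>q. post_mean (s + r) (fst q) \<bullet> snd q \<partial>?Q)
     = (\<integral>p. post_mean (s + r) (?y p) \<bullet> snd (fst p) + sqrt e * (post_mean (s + r) (?y p) \<bullet> snd (snd p)) \<partial>refinement)"
    by (subst integral_distr) (simp_all add: inner_add_right)
  also have "\<dots> = G + sqrt e * (sqrt r * mmse (s + r))"
    using refinement_overlap_old[OF r] refinement_overlap_new[OF r] by simp
  finally show "overlap_coupling (s + r) (t + e) (G + sqrt (r * e) * mmse (s + r)) ?Q"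
    unfolding overlap_coupling_def using 1 2
    by (simp add: refinement.prob_space_distr real_sqrt_mult mult.left_commute mult.assoc)
qed

text \<open>Draw the signal from the posterior and top up the Gaussian vector to unit covariance with fresh
noise, which is independent of the signal. The cost is \<open>E |X|\<^sup>2 + E |N|\<^sup>2 - 2 E (X \<bullet> N)\<close>.\<close>
lemma wasserstein2_le_overlap:
  assumes t1: "t < 1"
  shows "wasserstein2 (distr M borel X) std_gaussian
    \<le> ennreal (sqrt (second_moment + real CARD('d) - 2 * G))"
proof -
  define e where "e = 1 - t"
  have e: "0 < e" using t1 by (simp add: e_def)
  let ?x = "\<lambda>p. X (fst (snd p))" and ?n = "\<lambda>p. snd (fst p) + sqrt e *\<^sub>R snd (snd p)"
  let ?P = "distr refinement (borel \<Otimes>\<^sub>M borel) (\<lambda>p. (?x p, ?n p))"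
  let ?c = "second_moment + real CARD('d) - 2 * G"
  have nlaw: "distr refinement borel ?n = distr std_gaussian borel (\<lambda>g. g)"
    using refinement_noise_law[OF e] by (simp add: e_def)
  have nlaw': "distr refinement borel ?n = (std_gaussian :: (real^'d) measure)"
    unfolding nlaw by (rule distr_id2) simp
  have P: "?P \<in> couplings (distr M borel X) std_gaussian"
  proof -
    have "distr ?P (distr M borel X) fst = distr refinement borel ?x"
      by (subst distr_distr) (simp_all add: comp_def cong: distr_cong)
    moreover have "distr ?P std_gaussian snd = distr refinement borel ?n"
      by (subst distr_distr) (simp_all add: comp_def cong: distr_cong)
    moreover have "sets ?P = sets (distr M borel X \<Otimes>\<^sub>M std_gaussian)"
      by (simp cong: sets_pair_measure_cong)
    ultimately show ?thesis unfolding couplings_def by (simp add: refinement_X_law nlaw')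
  qed
  have n2: "integrable refinement (\<lambda>p. (norm (?n p))\<^sup>2)" "(\<integral>p. (norm (?n p))\<^sup>2 \<partial>refinement) = real CARD('d)"
  proof -
    have "integrable refinement (\<lambda>p. (norm (?n p))\<^sup>2) \<longleftrightarrow> integrable std_gaussian (\<lambda>g::real^'d. (norm g)\<^sup>2)"
      by (rule integrable_eq_of_distr_eq[OF nlaw, of "\<lambda>y. (norm y)\<^sup>2"]) measurable
    then show "integrable refinement (\<lambda>p. (norm (?n p))\<^sup>2)" by (simp only: std_gaussian_norm_moment)
    have "(\<integral>p. (norm (?n p))\<^sup>2 \<partial>refinement) = (\<integral>g. (norm g)\<^sup>2 \<partial>(std_gaussian :: (real^'d) measure))"
      by (rule integral_eq_of_distr_eq[OF nlaw, of "\<lambda>y. (norm y)\<^sup>2"]) measurable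
    then show "(\<integral>p. (norm (?n p))\<^sup>2 \<partial>refinement) = real CARD('d)" by (simp only: std_gaussian_norm_moment)
  qed
  have x2: "(\<integral>p. (norm (?x p))\<^sup>2 \<partial>refinement) = second_moment"
    using integral_eq_of_distr_eq[OF refinement_X_law, of "\<lambda>y. (norm y)\<^sup>2"] by simp
  have io: "integrable refinement (\<lambda>p. ?x p \<bullet> snd (fst p))" and "integrable refinement (\<lambda>p. ?x p \<bullet> snd (snd p))"
    by (intro integrable_inner_L2 refinement_X_L2 refinement_old_L2 refinement_noise_L2; measurable)+
  have "(\<integral>p. ?x p \<bullet> snd (fst p) \<partial>refinement) = G"
  proof -
    have "(\<integral>z. posterior s (fst q) (fst z) * (X (fst z) \<bullet> snd q) \<partial>joint) = post_mean s (fst q) \<bullet> snd q" for q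
    proof -
      have "integrable M (\<lambda>\<omega>. posterior s (fst q) \<omega> * (X \<omega> \<bullet> snd q))"
        using tilted_inner(1)[OF s, of "fst q" "snd q"] by (simp add: posterior_def inner_commute)
      from integral_fst_joint[OF this]
      show ?thesis using tilted_inner(2)[OF s, of "fst q" "snd q"] evidence_pos[OF s, of "fst q"]
        by (simp add: posterior_def inner_commute)
    qed
    then show ?thesis using Q_overlap by (simp add: integral_refinement[OF io])
  qed
  moreover have "(\<integral>p. ?x p \<bullet> snd (snd p) \<partial>refinement) = 0"
  proof -
      interpret R: pair_prob_space joint "std_gaussian :: (real^'d) measure" ..
    have eq: "(\<integral>p. ?x p \<bullet> snd (snd p) \<partial>refinement) = (\<integral>p. X (fst (fst p)) \<bullet> snd p \<partial>joint_noise)"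
      and "integrable joint_noise (\<lambda>p. X (fst (fst p)) \<bullet> snd p)"
      using integral_eq_of_distr_eq[OF refinement_law, of "\<lambda>x. X (fst (snd x)) \<bullet> snd (snd x)"]
        integrable_eq_of_distr_eq[OF refinement_law, of "\<lambda>x. X (fst (snd x)) \<bullet> snd (snd x)"]
        \<open>integrable refinement (\<lambda>p. ?x p \<bullet> snd (snd p))\<close> by simp_all
    then show ?thesis
      using R.integral_fst[of "\<lambda>z g. X (fst z) \<bullet> g"] by (simp add: case_prod_unfold std_gaussian_inner_moments)
  qed
  moreover have xn: "?x p \<bullet> ?n p = ?x p \<bullet> snd (fst p) + sqrt e * (?x p \<bullet> snd (snd p))" for p
    by (simp add: inner_add_right)
  ultimately have over: "integrable refinement (\<lambda>p. ?x p \<bullet> ?n p)" "(\<integral>p. ?x p \<bullet> ?n p \<partial>refinement) = G"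
    using io \<open>integrable refinement (\<lambda>p. ?x p \<bullet> snd (snd p))\<close> unfolding xn by simp_all
  have expand: "(dist (?x p) (?n p))\<^sup>2 = (norm (?x p))\<^sup>2 + (norm (?n p))\<^sup>2 - 2 * (?x p \<bullet> ?n p)" for p
    unfolding dist_norm power2_norm_eq_inner by (simp add: inner_diff_left inner_diff_right inner_commute)
  have ic: "integrable refinement (\<lambda>p. (dist (?x p) (?n p))\<^sup>2)" "(\<integral>p. (dist (?x p) (?n p))\<^sup>2 \<partial>refinement) = ?c"
    unfolding expand using over refinement_X_L2 n2 x2 by simp_all
  have "(\<integral>\<^sup>+z. ennreal ((dist (fst z) (snd z))\<^sup>2) \<partial>?P) = (\<integral>\<^sup>+p. ennreal ((dist (?x p) (?n p))\<^sup>2) \<partial>refinement)"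
    by (subst nn_integral_distr) simp_all
  also have "\<dots> = ennreal ?c"
    unfolding ic(2)[symmetric] by (rule nn_integral_eq_integral[OF ic(1)]) simp
  finally have cost: "(\<integral>\<^sup>+z. ennreal ((dist (fst z) (snd z))\<^sup>2) \<partial>?P) = ennreal ?c" .
  have "0 \<le> ?c" unfolding ic(2)[symmetric] by simp
  then have "ennreal_sqrt (ennreal ?c) = ennreal (sqrt ?c)" by (rule ennreal_sqrt_ennreal)
  then show ?thesis
    unfolding wasserstein2_def by (intro INF_lower2[OF P]) (simp only: cost order_refl)
qed

end

context gaussian_channel
begin

lemma overlap_coupling_independent:
  assumes s: "0 < s"
  shows "\<exists>Q. overlap_coupling s t 0 Q"
proof (intro exI)
  interpret R: pair_prob_space joint "std_gaussian :: (real^'d) measure" ..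
  let ?Q = "distr joint_noise (borel \<Otimes>\<^sub>M borel) (\<lambda>p. (obs s (fst p), sqrt t *\<^sub>R snd p))"
  have "distr ?Q borel fst = distr (distr joint_noise joint fst) borel (obs s)"
    by (simp add: distr_distr comp_def)
  moreover have "distr ?Q borel snd = distr (distr joint_noise std_gaussian snd) borel (\<lambda>g. sqrt t *\<^sub>R g)"
    by (simp add: distr_distr comp_def)
  moreover have "(\<integral>q. post_mean s (fst q) \<bullet> snd q \<partial>?Q) = 0"
  proof -
    have "integrable std_gaussian (\<lambda>g::real^'d. (norm (sqrt t *\<^sub>R g))\<^sup>2)"
      by (rule integrable_norm_scaleR_L2[OF std_gaussian_norm_moment(1)])
    then have 2: "integrable joint_noise (\<lambda>p. (norm (sqrt t *\<^sub>R snd p))\<^sup>2)" by (rule integrable_snd_noise)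
    have 1: "integrable joint_noise (\<lambda>p. (norm (post_mean s (obs s (fst p))))\<^sup>2)"
      by (rule integrable_fst_noise[OF post_mean_L2[OF s]])
    have i: "integrable joint_noise (\<lambda>p. post_mean s (obs s (fst p)) \<bullet> (sqrt t *\<^sub>R snd p))"
      by (intro integrable_inner_L2 1 2) measurable
    have "(\<integral>q. post_mean s (fst q) \<bullet> snd q \<partial>?Q) = (\<integral>p. post_mean s (obs s (fst p)) \<bullet> (sqrt t *\<^sub>R snd p) \<partial>joint_noise)"
      by (subst integral_distr) simp_all
    also have "\<dots> = (\<integral>z. \<integral>g. post_mean s (obs s z) \<bullet> (sqrt t *\<^sub>R g) \<partial>std_gaussian \<partial>joint)"
    proof -
      have "integrable joint_noise (case_prod (\<lambda>z g. post_mean s (obs s z) \<bullet> (sqrt t *\<^sub>R g)))"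
        using i by (simp only: case_prod_unfold)
      from R.integral_fst[OF this, symmetric] show ?thesis by (simp only: case_prod_unfold)
    qed
    also have "\<dots> = 0" by (simp add: std_gaussian_inner_moments)
    finally show ?thesis .
  qed
  ultimately show "overlap_coupling s t 0 ?Q"
    unfolding overlap_coupling_def
    by (simp add: R.prob_space_distr std_gaussian.distr_pair_fst
        distr_joint_noise_snd)
qed

text \<open>Levels \<open>s = 1/p - 1\<close> and variances \<open>t = 1 - p\<close> with \<open>p = q\<^sup>k\<close>: since \<open>t = s / (1 + s)\<close>, the
variance of the Gaussian vector follows the natural clock of the Brownian bridge, and the product
\<open>r e\<close> of the step sizes is the same at every step.\<close>
lemma overlap_coupling_chain:
  assumes q: "0 < q" "q < 1"
  shows "\<exists>Q. overlap_coupling (1 / q ^ Suc n - 1) (1 - q ^ Suc n)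
     (\<Sum>j<n. (1 - q) / sqrt q * mmse (1 / q ^ (j + 2) - 1)) Q"
proof (induction n)
  case 0
  show ?case using overlap_coupling_independent[of "1 / q - 1" "1 - q"] q by simp
next
  case (Suc n)
  then obtain Q where Q: "overlap_coupling (1 / q ^ Suc n - 1) (1 - q ^ Suc n)
     (\<Sum>j<n. (1 - q) / sqrt q * mmse (1 / q ^ (j + 2) - 1)) Q" ..
  have qn: "q ^ Suc n < 1" "0 < q ^ Suc n" using power_Suc_less_one[OF q, of n] q by (simp_all del: power_Suc)
  interpret overlap_step M X "1 / q ^ Suc n - 1" "1 - q ^ Suc n"
     "\<Sum>j<n. (1 - q) / sqrt q * mmse (1 / q ^ (j + 2) - 1)" Q
    by (unfold_locales; (rule Q)?) (insert qn, simp_all add: field_simps del: power_Suc)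
  \<comment> \<open>The increments of \<open>1/p - 1\<close> and \<open>1 - p\<close> when \<open>p\<close> decreases from \<open>q ^ (n + 1)\<close> to \<open>q ^ (n + 2)\<close>.\<close>
  let ?r = "(1 - q) / q ^ (n + 2)" and ?e = "q ^ Suc n * (1 - q)"
  have "0 < ?r" "0 < ?e" using q by simp_all
  from overlap_coupling_extend[OF this] obtain Q' where
    Q': "overlap_coupling (1 / q ^ Suc n - 1 + ?r) (1 - q ^ Suc n + ?e)
     ((\<Sum>j<n. (1 - q) / sqrt q * mmse (1 / q ^ (j + 2) - 1)) + sqrt (?r * ?e) * mmse (1 / q ^ Suc n - 1 + ?r)) Q'" ..
  have 1: "1 / q ^ Suc n - 1 + ?r = 1 / q ^ (n + 2) - 1" using q by (simp add: field_simps)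
  have 2: "1 - q ^ Suc n + ?e = 1 - q ^ Suc (Suc n)" by (simp add: algebra_simps)
  have "?r * ?e = (1 - q)\<^sup>2 / q" using q by (simp add: field_simps power2_eq_square)
  then have 3: "sqrt (?r * ?e) = (1 - q) / sqrt q" using q by (simp add: real_sqrt_divide)
  show ?case using Q' unfolding 1 2 3 by auto
qed

lemma wasserstein2_le_mmse_sum:
  assumes q: "0 < q" "q < 1"
  shows "wasserstein2 (distr M borel X) std_gaussian
    \<le> ennreal (sqrt (second_moment + real CARD('d)
         - 2 * (\<Sum>j<n. (1 - q) / sqrt q * mmse (1 / q ^ (j + 2) - 1))))"
proof -
  obtain Q where Q: "overlap_coupling (1 / q ^ Suc n - 1) (1 - q ^ Suc n)
     (\<Sum>j<n. (1 - q) / sqrt q * mmse (1 / q ^ (j + 2) - 1)) Q"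
    using overlap_coupling_chain[OF q] ..
  have qn: "q ^ Suc n < 1" "0 < q ^ Suc n" using power_Suc_less_one[OF q, of n] q by (simp_all del: power_Suc)
  interpret overlap_step M X "1 / q ^ Suc n - 1" "1 - q ^ Suc n"
     "\<Sum>j<n. (1 - q) / sqrt q * mmse (1 / q ^ (j + 2) - 1)" Q
    by (unfold_locales; (rule Q)?) (insert qn, simp_all add: field_simps del: power_Suc)
  show ?thesis using qn by (intro wasserstein2_le_overlap) simp
qed

text \<open>Under the assumed bound \<open>mmse (1/p - 1) \<ge> \<alpha> p\<^sup>2 + \<beta> p\<close>, so the sums over the chain are dominated from
below by geometric series. First the number of steps tends to infinity, then the ratio \<open>q\<close> tends to 1,
and the value \<open>\<alpha>/2 + \<beta>\<close> of the limit is the integral of \<open>\<alpha> p + \<beta>\<close> over the unit interval.\<close>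
lemma wasserstein2_le_of_mmse_bound:
  assumes lower: "\<And>s. 0 < s \<Longrightarrow>
      mmse s \<ge> (second_moment + s * real CARD('d) - (a + s * b)) / (1 + s)\<^sup>2"
  shows "wasserstein2 (distr M borel X) std_gaussian \<le> ennreal (sqrt (a + b))"
proof -
  let ?W = "wasserstein2 (distr M borel X) std_gaussian"
  define e where "e = second_moment"
  define d where "d = real CARD('d)"
  define \<alpha> where "\<alpha> = e - d - a + b"
  define \<beta> where "\<beta> = d - b"
  have bound: "?W \<le> ennreal (sqrt (e + d - 2 * (\<alpha> * q ^ 4 / (1 + q) + \<beta> * q\<^sup>2)))"
    if q: "0 < q" "q < 1" for q
  proof (rule tendsto_lowerbound)
    let ?S = "\<lambda>n. \<Sum>j<n. (1 - q) * (\<alpha> * q ^ 4) * (q\<^sup>2) ^ j + (1 - q) * (\<beta> * q\<^sup>2) * q ^ j"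
    have q2: "q\<^sup>2 < 1" using q by (simp add: power_less_one_iff)
    have "(\<lambda>j. (1 - q) * (\<alpha> * q ^ 4) * (q\<^sup>2) ^ j + (1 - q) * (\<beta> * q\<^sup>2) * q ^ j)
        sums ((1 - q) * (\<alpha> * q ^ 4) * (1 / (1 - q\<^sup>2)) + (1 - q) * (\<beta> * q\<^sup>2) * (1 / (1 - q)))"
      using q q2 by (intro sums_add sums_mult geometric_sums) simp_all
    moreover have "(1 - q) * (\<alpha> * q ^ 4) * (1 / (1 - q\<^sup>2)) + (1 - q) * (\<beta> * q\<^sup>2) * (1 / (1 - q))
        = \<alpha> * q ^ 4 / (1 + q) + \<beta> * q\<^sup>2"
    proof -
      have "1 - q\<^sup>2 = (1 - q) * (1 + q)" by (simp add: power2_eq_square algebra_simps)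
      then show ?thesis using q by simp
    qed
    ultimately have "?S \<longlonglongrightarrow> \<alpha> * q ^ 4 / (1 + q) + \<beta> * q\<^sup>2" by (simp add: sums_def)
    then show "(\<lambda>n. ennreal (sqrt (e + d - 2 * ?S n))) \<longlonglongrightarrow> ennreal (sqrt (e + d - 2 * (\<alpha> * q ^ 4 / (1 + q) + \<beta> * q\<^sup>2)))"
      by (intro tendsto_ennrealI tendsto_real_sqrt tendsto_diff tendsto_mult tendsto_const)
    show "\<forall>\<^sub>F n in sequentially. ?W \<le> ennreal (sqrt (e + d - 2 * ?S n))"
    proof (intro always_eventually allI)
      fix n
      have "?S n \<le> (\<Sum>j<n. (1 - q) / sqrt q * mmse (1 / q ^ (j + 2) - 1))"
      proof (rule sum_mono)
        fix j
        let ?p = "q ^ (j + 2)"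
        have p: "0 < ?p" "?p < 1" using power_Suc_less_one[OF q, of "Suc j"] q by simp_all
        have "\<alpha> * ?p\<^sup>2 + \<beta> * ?p = (e + (1 / ?p - 1) * d - (a + (1 / ?p - 1) * b)) / (1 + (1 / ?p - 1))\<^sup>2"
          using p(1) unfolding \<alpha>_def \<beta>_def
          by (simp add: power_divide del: power_Suc power_add) (simp add: field_simps power2_eq_square del: power_Suc power_add)
        also have "\<dots> \<le> mmse (1 / ?p - 1)"
          using lower[of "1 / ?p - 1"] p unfolding e_def d_def by simp
        finally have le: "\<alpha> * ?p\<^sup>2 + \<beta> * ?p \<le> mmse (1 / ?p - 1)" .
        have "(1 - q) * (\<alpha> * q ^ 4) * (q\<^sup>2) ^ j + (1 - q) * (\<beta> * q\<^sup>2) * q ^ j = (1 - q) * (\<alpha> * ?p\<^sup>2 + \<beta> * ?p)"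
        proof -
          have "?p\<^sup>2 = q ^ 4 * (q\<^sup>2) ^ j"
            by (simp only: power_mult[symmetric] power_add[symmetric]) (rule arg_cong[where f="power q"], simp)
          moreover have "?p = q\<^sup>2 * q ^ j" by (simp only: power_add[symmetric]) (simp add: add.commute)
          ultimately show ?thesis by (simp only: distrib_left mult.assoc)
        qed
        also have "\<dots> \<le> (1 - q) * mmse (1 / ?p - 1)" using q le by (intro mult_left_mono) simp_all
        also have "\<dots> \<le> (1 - q) / sqrt q * mmse (1 / ?p - 1)"
        proof (rule mult_right_mono[OF _ mmse_nonneg])
          \<comment> \<open>The factor \<open>1 / sqrt q\<close> tends to 1 and is dropped, which is possible because \<open>mmse\<close> is nonnegative.\<close>
          have "sqrt q \<le> 1" "0 < sqrt q" using q by simp_all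
          then show "1 - q \<le> (1 - q) / sqrt q" using q by (simp add: pos_le_divide_eq mult_left_le)
        qed
        finally show "(1 - q) * (\<alpha> * q ^ 4) * (q\<^sup>2) ^ j + (1 - q) * (\<beta> * q\<^sup>2) * q ^ j
           \<le> (1 - q) / sqrt q * mmse (1 / ?p - 1)" .
      qed
      then show "?W \<le> ennreal (sqrt (e + d - 2 * ?S n))"
        using wasserstein2_le_mmse_sum[OF q, of n] unfolding e_def d_def
        by (elim order_trans) (intro ennreal_leI real_sqrt_le_mono, simp)
    qed
  qed simp
  show ?thesis
  proof (rule tendsto_lowerbound)
    have "((\<lambda>q. e + d - 2 * (\<alpha> * q ^ 4 / (1 + q) + \<beta> * q\<^sup>2)) \<longlongrightarrow> e + d - 2 * (\<alpha> * 1 ^ 4 / (1 + 1) + \<beta> * 1\<^sup>2)) (at_left 1)"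
      by (intro tendsto_intros) simp
    moreover have "e + d - 2 * (\<alpha> * 1 ^ 4 / (1 + 1) + \<beta> * 1\<^sup>2) = a + b"
      by (simp add: \<alpha>_def \<beta>_def field_simps)
    ultimately show "((\<lambda>q. ennreal (sqrt (e + d - 2 * (\<alpha> * q ^ 4 / (1 + q) + \<beta> * q\<^sup>2)))) \<longlongrightarrow> ennreal (sqrt (a + b))) (at_left 1)"
      by (intro tendsto_ennrealI tendsto_real_sqrt) simp
    have "\<forall>\<^sub>F q in at_left 1. 0 < q \<and> q < (1::real)"
      by (auto simp: eventually_at_left[of 0] intro: exI[of _ 0])
    then show "\<forall>\<^sub>F q in at_left 1. ?W \<le> ennreal (sqrt (e + d - 2 * (\<alpha> * q ^ 4 / (1 + q) + \<beta> * q\<^sup>2)))"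
      by eventually_elim (use bound in blast)
  qed simp
qed

end

section \<open>The posterior mean under an approximate Stein identity\<close>

context gaussian_channel
begin

text \<open>A standard Gaussian signal has posterior mean \<open>y / (1 + s)\<close>.\<close>
definition mean_excess :: "real \<Rightarrow> real^'d \<Rightarrow> real^'d" where
  "mean_excess s y = post_mean s y - (1 / (1 + s)) *\<^sub>R y"

lemma mean_excess_measurable [measurable]: "mean_excess s \<in> borel_measurable borel"
  unfolding mean_excess_def by measurable

lemma mean_excess_L2:
  assumes s: "0 < s"
  shows "integrable joint (\<lambda>z. (norm (mean_excess s (obs s z)))\<^sup>2)"
proof -
  have "integrable joint (\<lambda>z. (norm (post_mean s (obs s z) + (- (1 / (1 + s))) *\<^sub>R obs s z))\<^sup>2)"
    by (intro integrable_norm_add_L2 integrable_norm_scaleR_L2 post_mean_L2 obs_L2 s) measurable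
  then show ?thesis by (simp add: mean_excess_def)
qed

lemma obs_second_moment:
  assumes s: "0 < s"
  shows "(\<integral>z. (norm (obs s z))\<^sup>2 \<partial>joint) = s\<^sup>2 * second_moment + s * real CARD('d)"
proof -
  have "(norm (obs s z))\<^sup>2 = s\<^sup>2 * (norm (X (fst z)))\<^sup>2 + 2 * s * sqrt s * (X (fst z) \<bullet> snd z) + s * (norm (snd z))\<^sup>2" for z
    using s unfolding obs_def power2_norm_eq_inner
    by (simp add: inner_add_left inner_add_right inner_commute[of "snd z" "X (fst z)"] power2_eq_square algebra_simps)
  then show ?thesis
    using integrable_X_inner_snd integrable_fst_joint[OF X_L2] integral_fst_joint[OF X_L2]
      noise_L2 integral_snd_joint[OF std_gaussian_norm_moment(1)]
    by (simp add: integral_X_inner_snd std_gaussian_norm_moment)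
qed

lemma mmse_mean_excess:
  assumes s: "0 < s"
  shows "mmse s = (second_moment + s * real CARD('d)) / (1 + s)\<^sup>2
      - (\<integral>z. (norm (mean_excess s (obs s z)))\<^sup>2 \<partial>joint)"
proof -
  define e where "e = second_moment"
  define d where "d = real CARD('d)"
  define c where "c = 1 / (1 + s)"
  let ?m = "\<lambda>z. post_mean s (obs s z)"
  have i: "integrable joint (\<lambda>z. obs s z \<bullet> ?m z)"
    by (intro integrable_inner_L2 post_mean_L2 obs_L2 s) measurable
  have "(norm (mean_excess s (obs s z)))\<^sup>2 = (norm (?m z))\<^sup>2 - 2 * c * (obs s z \<bullet> ?m z) + c\<^sup>2 * (norm (obs s z))\<^sup>2" for z
    unfolding mean_excess_def power2_norm_eq_inner c_def[symmetric]
    by (simp add: inner_diff_left inner_diff_right inner_commute[of "post_mean s (obs s z)" "obs s z"] power2_eq_square algebra_simps)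
  then have "(\<integral>z. (norm (mean_excess s (obs s z)))\<^sup>2 \<partial>joint)
     = (\<integral>z. (norm (?m z))\<^sup>2 \<partial>joint) - 2 * c * (s * e) + c\<^sup>2 * (s\<^sup>2 * e + s * d)"
    using i post_mean_L2[OF s] obs_L2[OF s]
    by (simp add: post_mean_inner_obs[OF s] obs_second_moment[OF s] e_def d_def)
  then have "mmse s + (\<integral>z. (norm (mean_excess s (obs s z)))\<^sup>2 \<partial>joint) = e - 2 * c * (s * e) + c\<^sup>2 * (s\<^sup>2 * e + s * d)"
    using mmse_eq[OF s] by (simp add: e_def)
  also have "\<dots> = (e + s * d) / (1 + s)\<^sup>2"
  proof -
    \<comment> \<open>The left-hand side is \<open>e (1 - c s)\<^sup>2 + c\<^sup>2 s d\<close>, and \<open>1 - c s = c\<close>.\<close>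
    have cs: "c * s = 1 - c" using s unfolding c_def by (simp add: field_simps)
    have "e - 2 * c * (s * e) + c\<^sup>2 * (s\<^sup>2 * e + s * d) = e * (1 - c * s)\<^sup>2 + c\<^sup>2 * (s * d)"
      by (simp add: power2_eq_square algebra_simps)
    then show ?thesis unfolding cs by (simp add: c_def power_divide add_divide_distrib)
  qed
  finally show ?thesis unfolding e_def d_def by simp
qed

end

text \<open>The case \<open>R = 0\<close>, \<open>T = Id\<close> is Stein's identity, which characterises the standard Gaussian law;
\<open>R = 0\<close> alone says that \<open>T\<close> is a Stein kernel.\<close>
locale approximate_stein_identity = gaussian_channel M X for M :: "'a measure" and X :: "'a \<Rightarrow> real^'d" +
  fixes R :: "'a \<Rightarrow> real^'d" and T :: "'a \<Rightarrow> real^'d^'d"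
  assumes R_measurable [measurable]: "R \<in> borel_measurable M"
    and T_measurable [measurable]: "T \<in> borel_measurable M"
    and R_L2: "integrable M (\<lambda>\<omega>. (norm (R \<omega>))\<^sup>2)"
    and T_L2: "integrable M (\<lambda>\<omega>. (norm (T \<omega> - mat 1))\<^sup>2)"
    and stein: "\<And>\<psi> D K k. \<lbrakk>\<And>z. GDERIV \<psi> z :> D z; continuous_on UNIV D; \<And>z. \<bar>\<psi> z\<bar> \<le> K; \<And>z. norm (D z) \<le> K\<rbrakk> \<Longrightarrow>
      (\<integral>\<omega>. X \<omega> $ k * \<psi> (X \<omega>) \<partial>M) = (\<integral>\<omega>. R \<omega> $ k * \<psi> (X \<omega>) \<partial>M) + (\<integral>\<omega>. T \<omega> $ k \<bullet> D (X \<omega>) \<partial>M)"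
begin

lemma T_square_integrable: "integrable M (\<lambda>\<omega>. (norm (T \<omega>))\<^sup>2)"
proof -
  have "integrable M (\<lambda>\<omega>. (norm (T \<omega> - mat 1 + mat 1))\<^sup>2)"
    by (rule integrable_norm_add_L2[OF _ _ T_L2]) simp_all
  then show ?thesis by simp
qed

lemma T_row_L2: "integrable M (\<lambda>\<omega>. (norm (T \<omega> $ k))\<^sup>2)"
  by (rule Bochner_Integration.integrable_bound[OF T_square_integrable])
     (auto intro!: power_mono Finite_Cartesian_Product.norm_nth_le)

text \<open>The Stein identity for \<open>\<psi> = gaussian_smoothing s \<phi>\<close>. The gradient of \<open>\<psi>\<close> is an average of
\<open>\<phi>\<close> times the noise, so no derivative of \<open>\<phi>\<close> remains and \<open>\<phi>\<close> can be any bounded measurable function of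
the observation.\<close>
lemma stein_smoothed:
  fixes \<phi> :: "real^'d \<Rightarrow> real"
  assumes s: "0 < s" and m [measurable]: "\<phi> \<in> borel_measurable borel" and K: "\<And>y. \<bar>\<phi> y\<bar> \<le> K"
  shows "(\<integral>z. X (fst z) $ k * \<phi> (obs s z) \<partial>joint)
    = (\<integral>z. R (fst z) $ k * \<phi> (obs s z) \<partial>joint) + sqrt s * (\<integral>z. (T (fst z) $ k \<bullet> snd z) * \<phi> (obs s z) \<partial>joint)"
proof -
  let ?\<psi> = "gaussian_smoothing s \<phi>" and ?D = "gaussian_smoothing_gradient s \<phi>"
  let ?L = "\<Sum>l\<in>UNIV. sqrt s * K * (\<integral>g. \<bar>g $ l\<bar> \<partial>(std_gaussian :: (real^'d) measure))"
  note K0 = bound_nonneg[OF s K m]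
  have L0: "0 \<le> ?L" using K0 s by (intro sum_nonneg mult_nonneg_nonneg) simp_all
  have id: "(\<integral>\<omega>. X \<omega> $ k * ?\<psi> (X \<omega>) \<partial>M) = (\<integral>\<omega>. R \<omega> $ k * ?\<psi> (X \<omega>) \<partial>M) + (\<integral>\<omega>. T \<omega> $ k \<bullet> ?D (X \<omega>) \<partial>M)"
  proof (rule stein[where K = "K + ?L"])
    show "GDERIV ?\<psi> z :> ?D z" for z by (rule gderiv_smoothing[OF s K m])
    show "continuous_on UNIV ?D" by (rule continuous_smoothing_gradient[OF s K m])
    show "\<bar>?\<psi> z\<bar> \<le> K + ?L" for z using smoothing_bounded[OF s K m, of z] L0 by linarith
    have D_le: "norm (?D z) \<le> ?L" for z
      by (rule order_trans[OF norm_le_l1_cart sum_mono]) (rule smoothing_gradient_bounded[OF s K m])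
    show "norm (?D z) \<le> K + ?L" for z using D_le[of z] K0 by linarith
  qed
  have lift: "(\<integral>\<omega>. f \<omega> * ?\<psi> (X \<omega>) \<partial>M) = (\<integral>z. f (fst z) * \<phi> (obs s z) \<partial>joint)"
    if f: "integrable M f" for f :: "'a \<Rightarrow> real"
  proof -
    have i: "integrable joint (case_prod (\<lambda>\<omega> g. f \<omega> * \<phi> (obs s (\<omega>, g))))"
      using bounded_mult_integrable[OF integrable_fst_joint[OF f], of "\<lambda>z. \<phi> (obs s z)" K] K
      by (simp add: case_prod_unfold)
    show ?thesis
      using joint.integral_fst[OF i] by (simp add: case_prod_unfold gaussian_smoothing_def obs_def)
  qed
  have comp: "integrable M (\<lambda>\<omega>. f \<omega> $ k)" if "f \<in> borel_measurable M" "integrable M (\<lambda>\<omega>. (norm (f \<omega>))\<^sup>2)"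
    for f :: "'a \<Rightarrow> real^'d"
    using integrable_inner_left[OF integrable_of_square[OF that], of "axis k 1"] by (simp add: inner_axis)
  have iT: "integrable joint (\<lambda>z. (T (fst z) $ k \<bullet> snd z) * \<phi> (obs s z))"
    by (intro bounded_mult_integrable[where K=K] integrable_inner_L2 integrable_fst_joint[OF T_row_L2]
        noise_L2 K) measurable
  have "(\<integral>\<omega>. T \<omega> $ k \<bullet> ?D (X \<omega>) \<partial>M) = (\<integral>\<omega>. sqrt s * (\<integral>g. (T \<omega> $ k \<bullet> g) * \<phi> (obs s (\<omega>, g)) \<partial>std_gaussian) \<partial>M)"
    unfolding smoothing_gradient_inner[OF s K m] by (simp add: obs_def mult.commute)
  also have "\<dots> = sqrt s * (\<integral>z. (T (fst z) $ k \<bullet> snd z) * \<phi> (obs s z) \<partial>joint)"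
  proof -
    have "integrable joint (case_prod (\<lambda>\<omega> g. (T \<omega> $ k \<bullet> g) * \<phi> (obs s (\<omega>, g))))"
      using iT by (simp add: case_prod_unfold)
    from joint.integral_fst[OF this] show ?thesis by (simp add: case_prod_unfold)
  qed
  finally show ?thesis
    using id lift[OF comp[OF X_measurable X_L2]] lift[OF comp[OF R_measurable R_L2]] by simp
qed

definition defect :: "real \<Rightarrow> 'a \<times> (real^'d) \<Rightarrow> real^'d" where
  "defect s z = R (fst z) + sqrt s *\<^sub>R ((T (fst z) - mat 1) *v snd z)"

lemma defect_nth: "defect s z $ k = R (fst z) $ k + sqrt s * ((T (fst z) $ k - axis k 1) \<bullet> snd z)"
proof -
  have "(mat 1 :: real^'d^'d) $ k = axis k 1" by (simp add: mat_def axis_def vec_eq_iff)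
  then show ?thesis by (simp add: defect_def matrix_vector_mul_component)
qed

lemma defect_measurable [measurable]: "defect s \<in> borel_measurable joint"
proof -
  have "(\<lambda>z. R (fst z) $ k + sqrt s * ((T (fst z) $ k - axis k 1) \<bullet> snd z)) \<in> borel_measurable joint" for k
    by measurable
  then have "(\<lambda>z. defect s z \<bullet> b) \<in> borel_measurable joint" if "b \<in> Basis" for b
    using that by (auto simp: Basis_vec_def inner_axis defect_nth)
  then show ?thesis by (subst borel_measurable_euclidean_space) blast
qed

lemma
  assumes s: "0 < s"
  shows defect_L2: "integrable joint (\<lambda>z. (norm (defect s z))\<^sup>2)"
    and defect_second_moment: "(\<integral>z. (norm (defect s z))\<^sup>2 \<partial>joint)
      = (\<integral>\<omega>. (norm (R \<omega>))\<^sup>2 \<partial>M) + s * (\<integral>\<omega>. (norm (T \<omega> - mat 1))\<^sup>2 \<partial>M)"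
proof -
  let ?S = "\<lambda>\<omega> k. T \<omega> $ k - axis k 1"
  have mS: "(mat 1 :: real^'d^'d) $ k = axis k 1" for k by (simp add: mat_def axis_def vec_eq_iff)
  have row: "(norm (T \<omega> - mat 1))\<^sup>2 = (\<Sum>k\<in>UNIV. (norm (?S \<omega> k))\<^sup>2)" for \<omega>
    unfolding norm_sq_vec[of "T \<omega> - mat 1"] by (simp add: mS)
  have S2: "integrable M (\<lambda>\<omega>. (norm (?S \<omega> k))\<^sup>2)" for k
  proof (rule Bochner_Integration.integrable_bound[OF T_L2])
    show "AE \<omega> in M. norm ((norm (?S \<omega> k))\<^sup>2) \<le> norm ((norm (T \<omega> - mat 1))\<^sup>2)"
      unfolding row by (intro AE_I2) (simp add: sum_nonneg, rule member_le_sum, simp_all)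
  qed measurable
  have Sg: "integrable joint (\<lambda>z. (?S (fst z) k \<bullet> snd z)\<^sup>2)" 
    "(\<integral>z. (?S (fst z) k \<bullet> snd z)\<^sup>2 \<partial>joint) = (\<integral>\<omega>. (norm (?S \<omega> k))\<^sup>2 \<partial>M)" for k
  proof -
    have sq: "(v \<bullet> g)\<^sup>2 = (v \<bullet> g) * (v \<bullet> g)" for v g :: "real^'d" by (simp add: power2_eq_square)
    have "(\<integral>\<^sup>+z. ennreal ((?S (fst z) k \<bullet> snd z)\<^sup>2) \<partial>joint)
      = (\<integral>\<^sup>+\<omega>. \<integral>\<^sup>+g. ennreal ((?S \<omega> k \<bullet> g)\<^sup>2) \<partial>std_gaussian \<partial>M)"
      by (subst std_gaussian.nn_integral_fst[symmetric]) simp_all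
    also have "\<dots> = (\<integral>\<^sup>+\<omega>. ennreal ((norm (?S \<omega> k))\<^sup>2) \<partial>M)"
      unfolding sq
      by (intro nn_integral_cong, subst nn_integral_eq_integral)
         (simp_all only: std_gaussian_inner_moments dot_square_norm, auto)
    also have "\<dots> = ennreal (\<integral>\<omega>. (norm (?S \<omega> k))\<^sup>2 \<partial>M)"
      by (rule nn_integral_eq_integral[OF S2]) simp
    finally have nn: "(\<integral>\<^sup>+z. ennreal ((?S (fst z) k \<bullet> snd z)\<^sup>2) \<partial>joint) = ennreal (\<integral>\<omega>. (norm (?S \<omega> k))\<^sup>2 \<partial>M)" .
    show "integrable joint (\<lambda>z. (?S (fst z) k \<bullet> snd z)\<^sup>2)"
      by (rule integrableI_bounded) (measurable, simp add: nn)
    show "(\<integral>z. (?S (fst z) k \<bullet> snd z)\<^sup>2 \<partial>joint) = (\<integral>\<omega>. (norm (?S \<omega> k))\<^sup>2 \<partial>M)"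
      by (subst integral_eq_nn_integral) (measurable, simp_all add: nn)
  qed
  have Rk: "integrable M (\<lambda>\<omega>. (R \<omega> $ k)\<^sup>2)" for k
  proof (rule Bochner_Integration.integrable_bound[OF R_L2])
    have "norm ((R \<omega> $ k)\<^sup>2) \<le> norm ((norm (R \<omega>))\<^sup>2)" for \<omega>
      using power_mono[OF component_le_norm_cart[of "R \<omega>" k], of 2] by simp
    then show "AE \<omega> in M. norm ((R \<omega> $ k)\<^sup>2) \<le> norm ((norm (R \<omega>))\<^sup>2)" by simp
  qed measurable
  \<comment> \<open>The noise is centred and independent of \<open>\<omega>\<close>, so the two parts of the defect are orthogonal.\<close>
  have cross: "integrable joint (\<lambda>z. R (fst z) $ k * (?S (fst z) k \<bullet> snd z))"
    "(\<integral>z. R (fst z) $ k * (?S (fst z) k \<bullet> snd z) \<partial>joint) = 0" for k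
  proof -
    have "integrable joint (\<lambda>z. R (fst z) $ k \<bullet> (?S (fst z) k \<bullet> snd z))"
      using integrable_fst_joint[OF Rk[of k]] Sg(1)[of k] by (intro integrable_inner_L2; measurable; simp)
    then show i: "integrable joint (\<lambda>z. R (fst z) $ k * (?S (fst z) k \<bullet> snd z))" by simp
    then have "integrable joint (case_prod (\<lambda>\<omega> g. R \<omega> $ k * (?S \<omega> k \<bullet> g)))" by (simp only: case_prod_unfold)
    from joint.integral_fst[OF this]
    show "(\<integral>z. R (fst z) $ k * (?S (fst z) k \<bullet> snd z) \<partial>joint) = 0"
      by (simp add: case_prod_unfold std_gaussian_inner_moments)
  qed
  have expand: "(norm (defect s z))\<^sup>2 = (\<Sum>k\<in>UNIV. (R (fst z) $ k)\<^sup>2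
      + 2 * sqrt s * (R (fst z) $ k * (?S (fst z) k \<bullet> snd z)) + s * (?S (fst z) k \<bullet> snd z)\<^sup>2)" for z
  proof -
    have "(defect s z $ k)\<^sup>2 = (R (fst z) $ k)\<^sup>2
      + 2 * sqrt s * (R (fst z) $ k * (?S (fst z) k \<bullet> snd z)) + s * (?S (fst z) k \<bullet> snd z)\<^sup>2" for k
      unfolding defect_nth power2_sum power_mult_distrib using s by (simp add: mult_ac)
    moreover have "(norm (defect s z))\<^sup>2 = (\<Sum>k\<in>UNIV. (defect s z $ k)\<^sup>2)"
      by (simp add: norm_sq_vec)
    ultimately show ?thesis by simp
  qed
  note ints = integrable_fst_joint[OF Rk] cross(1) Sg(1)
  show "integrable joint (\<lambda>z. (norm (defect s z))\<^sup>2)"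
    unfolding expand using ints by simp
  have "(\<integral>z. (norm (defect s z))\<^sup>2 \<partial>joint)
    = (\<Sum>k\<in>UNIV. (\<integral>\<omega>. (R \<omega> $ k)\<^sup>2 \<partial>M) + s * (\<integral>\<omega>. (norm (?S \<omega> k))\<^sup>2 \<partial>M))"
    unfolding expand using ints by (simp add: cross(2) Sg(2) integral_fst_joint[OF Rk])
  also have "\<dots> = (\<integral>\<omega>. (\<Sum>k\<in>UNIV. (R \<omega> $ k)\<^sup>2) \<partial>M) + s * (\<integral>\<omega>. (\<Sum>k\<in>UNIV. (norm (?S \<omega> k))\<^sup>2) \<partial>M)"
    using Rk S2 by (simp add: sum.distrib sum_distrib_left)
  also have "\<dots> = (\<integral>\<omega>. (norm (R \<omega>))\<^sup>2 \<partial>M) + s * (\<integral>\<omega>. (norm (T \<omega> - mat 1))\<^sup>2 \<partial>M)"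
    unfolding row by (simp add: norm_sq_vec[of "R _"])
  finally show "(\<integral>z. (norm (defect s z))\<^sup>2 \<partial>joint)
      = (\<integral>\<omega>. (norm (R \<omega>))\<^sup>2 \<partial>M) + s * (\<integral>\<omega>. (norm (T \<omega> - mat 1))\<^sup>2 \<partial>M)" .
qed

text \<open>In other words \<open>(1 + s) mean_excess s\<close> is the conditional expectation of \<open>defect s\<close> given the
observation: \<open>(1 + s) m - Y\<close> projects \<open>(1 + s) X - Y = X - sqrt s g\<close>, and the smoothed Stein identity
replaces \<open>X\<close> by \<open>R + sqrt s T g\<close>.\<close>
lemma mean_excess_inner:
  fixes \<phi> :: "real^'d \<Rightarrow> real^'d"
  assumes s: "0 < s" and m [measurable]: "\<phi> \<in> borel_measurable borel" and K: "\<And>y. norm (\<phi> y) \<le> K"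
  shows "(1 + s) * (\<integral>z. mean_excess s (obs s z) \<bullet> \<phi> (obs s z) \<partial>joint) = (\<integral>z. defect s z \<bullet> \<phi> (obs s z) \<partial>joint)"
proof -
  have phi2: "integrable joint (\<lambda>z. (norm (\<phi> (obs s z)))\<^sup>2)"
  proof (rule Bochner_Integration.integrable_bound)
    show "integrable joint (\<lambda>_. K\<^sup>2)" by simp
    show "AE z in joint. norm ((norm (\<phi> (obs s z)))\<^sup>2) \<le> norm (K\<^sup>2)"
      using K by (intro AE_I2) (simp add: power_mono)
  qed measurable
  have comp: "\<bar>\<phi> y $ k\<bar> \<le> K" for y k using component_le_norm_cart[of "\<phi> y" k] K[of y] by linarith
  have mk [measurable]: "(\<lambda>y. \<phi> y $ k) \<in> borel_measurable borel" for k by measurable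
  have X1: "integrable joint (\<lambda>z. X (fst z) $ k * \<phi> (obs s z) $ k)" for k
  proof -
    have "integrable M (\<lambda>\<omega>. X \<omega> $ k)"
      using integrable_inner_left[OF X_integrable, of "axis k 1"] by (simp add: inner_axis)
    from bounded_mult_integrable[OF integrable_fst_joint[OF this] _ comp] show ?thesis by simp
  qed
  have R1: "integrable joint (\<lambda>z. R (fst z) $ k * \<phi> (obs s z) $ k)" for k
  proof -
    have "integrable M (\<lambda>\<omega>. R \<omega> $ k)"
      using integrable_inner_left[OF integrable_of_square[OF R_measurable R_L2], of "axis k 1"] by (simp add: inner_axis)
    from bounded_mult_integrable[OF integrable_fst_joint[OF this] _ comp] show ?thesis by simp
  qed
  have T1: "integrable joint (\<lambda>z. (T (fst z) $ k \<bullet> snd z) * \<phi> (obs s z) $ k)" for k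
    by (intro bounded_mult_integrable[where K=K] integrable_inner_L2 integrable_fst_joint[OF T_row_L2]
        noise_L2 comp) measurable
  have g1: "integrable joint (\<lambda>z. snd z $ k * \<phi> (obs s z) $ k)" for k
    by (intro bounded_mult_integrable[where K=K] integrable_snd_joint std_gaussian_moments comp) measurable
  have im: "integrable joint (\<lambda>z. post_mean s (obs s z) \<bullet> \<phi> (obs s z))"
    by (intro integrable_inner_L2 post_mean_L2 phi2 s) measurable
  have iy: "integrable joint (\<lambda>z. obs s z \<bullet> \<phi> (obs s z))"
    by (intro integrable_inner_L2 obs_L2 phi2 s) measurable
  have iX: "integrable joint (\<lambda>z. X (fst z) \<bullet> \<phi> (obs s z))"
    by (intro integrable_inner_L2 integrable_fst_joint X_L2 phi2) measurable
  have ig: "integrable joint (\<lambda>z. snd z \<bullet> \<phi> (obs s z))"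
    by (intro integrable_inner_L2 noise_L2 phi2) measurable
  have ex: "(1 + s) * (mean_excess s y \<bullet> v) = (1 + s) * (post_mean s y \<bullet> v) - y \<bullet> v" for y v
    using s by (simp add: mean_excess_def inner_diff_left right_diff_distrib)
  have "(1 + s) * (\<integral>z. mean_excess s (obs s z) \<bullet> \<phi> (obs s z) \<partial>joint)
    = (1 + s) * (\<integral>z. post_mean s (obs s z) \<bullet> \<phi> (obs s z) \<partial>joint) - (\<integral>z. obs s z \<bullet> \<phi> (obs s z) \<partial>joint)"
    unfolding integral_mult_right_zero[symmetric] ex using im iy by simp
  also have "(\<integral>z. post_mean s (obs s z) \<bullet> \<phi> (obs s z) \<partial>joint) = (\<integral>z. X (fst z) \<bullet> \<phi> (obs s z) \<partial>joint)"
    using post_mean_inner[OF s m phi2] by (simp only: inner_commute[of "\<phi> _"])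
  also have "(\<integral>z. obs s z \<bullet> \<phi> (obs s z) \<partial>joint)
     = s * (\<integral>z. X (fst z) \<bullet> \<phi> (obs s z) \<partial>joint) + sqrt s * (\<integral>z. snd z \<bullet> \<phi> (obs s z) \<partial>joint)"
  proof -
    have "obs s z \<bullet> v = s * (X (fst z) \<bullet> v) + sqrt s * (snd z \<bullet> v)" for z v
      by (simp add: obs_def inner_add_left)
    then show ?thesis using iX ig by simp
  qed
  also have "(1 + s) * (\<integral>z. X (fst z) \<bullet> \<phi> (obs s z) \<partial>joint)
      - (s * (\<integral>z. X (fst z) \<bullet> \<phi> (obs s z) \<partial>joint) + sqrt s * (\<integral>z. snd z \<bullet> \<phi> (obs s z) \<partial>joint))
    = (\<integral>z. X (fst z) \<bullet> \<phi> (obs s z) \<partial>joint) - sqrt s * (\<integral>z. snd z \<bullet> \<phi> (obs s z) \<partial>joint)"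
    by (simp add: algebra_simps)
  also have "\<dots> = (\<Sum>k\<in>UNIV. (\<integral>z. X (fst z) $ k * \<phi> (obs s z) $ k \<partial>joint)
      - sqrt s * (\<integral>z. snd z $ k * \<phi> (obs s z) $ k \<partial>joint))"
    unfolding inner_vec_def using X1 g1 by (simp add: sum_subtractf sum_distrib_left)
  also have "\<dots> = (\<Sum>k\<in>UNIV. \<integral>z. defect s z $ k * \<phi> (obs s z) $ k \<partial>joint)"
  proof (rule sum.cong[OF refl])
    fix k
    have "defect s z $ k * \<phi> (obs s z) $ k = R (fst z) $ k * \<phi> (obs s z) $ k
        + sqrt s * ((T (fst z) $ k \<bullet> snd z) * \<phi> (obs s z) $ k) - sqrt s * (snd z $ k * \<phi> (obs s z) $ k)" for z
      unfolding defect_nth by (simp add: inner_diff_left inner_axis' algebra_simps)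
    then show "(\<integral>z. X (fst z) $ k * \<phi> (obs s z) $ k \<partial>joint) - sqrt s * (\<integral>z. snd z $ k * \<phi> (obs s z) $ k \<partial>joint)
      = (\<integral>z. defect s z $ k * \<phi> (obs s z) $ k \<partial>joint)"
      using stein_smoothed[OF s mk comp, of k k] R1 T1 g1 by simp
  qed
  also have "\<dots> = (\<integral>z. defect s z \<bullet> \<phi> (obs s z) \<partial>joint)"
  proof -
    have "integrable joint (\<lambda>z. defect s z $ k * \<phi> (obs s z) $ k)" for k
    proof -
      have "integrable joint (\<lambda>z. defect s z $ k)"
        using integrable_inner_left[OF joint.integrable_of_square[OF defect_measurable defect_L2[OF s]], of "axis k 1"]
        by (simp add: inner_axis)
      from bounded_mult_integrable[OF this _ comp] show ?thesis by simp
    qed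
    then show ?thesis unfolding inner_vec_def by simp
  qed
  finally show ?thesis .
qed

text \<open>Conditional expectation contracts the \<open>L\<^sup>2\<close> norm. The test functions in the identity are bounded, so
the excess is cut off where it is large and the cut-off is removed at the end.\<close>
lemma mean_excess_bound:
  assumes s: "0 < s"
  shows "(\<integral>z. (norm (mean_excess s (obs s z)))\<^sup>2 \<partial>joint)
     \<le> ((\<integral>\<omega>. (norm (R \<omega>))\<^sup>2 \<partial>M) + s * (\<integral>\<omega>. (norm (T \<omega> - mat 1))\<^sup>2 \<partial>M)) / (1 + s)\<^sup>2"
proof (rule LIMSEQ_le_const2)
  let ?c = "(\<integral>z. (norm (defect s z))\<^sup>2 \<partial>joint)"
  define \<phi> where "\<phi> n y = (if norm (mean_excess s y) \<le> real n then mean_excess s y else 0)" for n y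
  have [measurable]: "\<phi> n \<in> borel_measurable borel" for n unfolding \<phi>_def by measurable
  have le: "(norm (\<phi> n y))\<^sup>2 \<le> (norm (mean_excess s y))\<^sup>2" for n y by (simp add: \<phi>_def)
  have ip: "integrable joint (\<lambda>z. (norm (\<phi> n (obs s z)))\<^sup>2)" for n
    by (rule Bochner_Integration.integrable_bound[OF mean_excess_L2[OF s]]) (measurable, simp add: le)
  show "(\<lambda>n. \<integral>z. (norm (\<phi> n (obs s z)))\<^sup>2 \<partial>joint) \<longlonglongrightarrow> (\<integral>z. (norm (mean_excess s (obs s z)))\<^sup>2 \<partial>joint)"
  proof (rule integral_dominated_convergence[where w="\<lambda>z. (norm (mean_excess s (obs s z)))\<^sup>2"])
    show "AE z in joint. (\<lambda>n. (norm (\<phi> n (obs s z)))\<^sup>2) \<longlonglongrightarrow> (norm (mean_excess s (obs s z)))\<^sup>2"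
    proof (intro AE_I2 tendsto_eventually)
      fix z
      obtain N where N: "norm (mean_excess s (obs s z)) \<le> real N" using real_arch_simple by blast
      show "\<forall>\<^sub>F n in sequentially. (norm (\<phi> n (obs s z)))\<^sup>2 = (norm (mean_excess s (obs s z)))\<^sup>2"
        using eventually_ge_at_top[of N]
      proof eventually_elim
        case (elim n)
        then have "norm (mean_excess s (obs s z)) \<le> real n" using N by linarith
        then show ?case by (simp add: \<phi>_def)
      qed
    qed
    show "AE z in joint. norm ((norm (\<phi> n (obs s z)))\<^sup>2) \<le> (norm (mean_excess s (obs s z)))\<^sup>2" for n
      using le by simp
  qed (measurable, rule mean_excess_L2[OF s])
  have "(\<integral>z. (norm (\<phi> n (obs s z)))\<^sup>2 \<partial>joint) \<le> ?c / (1 + s)\<^sup>2" for n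
  proof -
    let ?I = "\<integral>z. (norm (\<phi> n (obs s z)))\<^sup>2 \<partial>joint"
    have I0: "0 \<le> ?I" and c0: "0 \<le> ?c" by simp_all
    have "mean_excess s y \<bullet> \<phi> n y = (norm (\<phi> n y))\<^sup>2" for y by (simp add: \<phi>_def dot_square_norm)
    then have "(1 + s) * ?I = (\<integral>z. defect s z \<bullet> \<phi> n (obs s z) \<partial>joint)"
      using mean_excess_inner[OF s, of "\<phi> n" "real n"] by (simp add: \<phi>_def)
    also have "\<dots> \<le> sqrt ?c * sqrt ?I"
      by (intro integral_inner_L2_le defect_L2[OF s] ip) measurable
    finally have le: "(1 + s) * ?I \<le> sqrt ?c * sqrt ?I" .
    show ?thesis
    proof (cases "?I = 0")
      case False
      then have Ip: "0 < ?I" using I0 by linarith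
      have eq: "((1 + s) * sqrt ?I) * sqrt ?I = (1 + s) * ?I" using I0 by (simp add: mult.assoc)
      have "((1 + s) * sqrt ?I) * sqrt ?I \<le> sqrt ?c * sqrt ?I" unfolding eq by (rule le)
      then have "(1 + s) * sqrt ?I \<le> sqrt ?c" using Ip by (simp add: mult_le_cancel_right)
      then have "((1 + s) * sqrt ?I)\<^sup>2 \<le> (sqrt ?c)\<^sup>2" using s I0 by (intro power_mono) simp_all
      then have "(1 + s)\<^sup>2 * ?I \<le> ?c" using I0 c0 by (simp add: power_mult_distrib)
      then show ?thesis using s by (simp add: pos_le_divide_eq mult.commute)
    qed (use c0 in simp)
  qed
  then show "\<exists>N. \<forall>n\<ge>N. (\<integral>z. (norm (\<phi> n (obs s z)))\<^sup>2 \<partial>joint)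
      \<le> ((\<integral>\<omega>. (norm (R \<omega>))\<^sup>2 \<partial>M) + s * (\<integral>\<omega>. (norm (T \<omega> - mat 1))\<^sup>2 \<partial>M)) / (1 + s)\<^sup>2"
    unfolding defect_second_moment[OF s] by blast
qed

text \<open>The estimate for an arbitrary law with an approximate Stein identity. It is Pythagorean because
\<open>R\<close> and \<open>(T - Id) g\<close> are orthogonal.\<close>
theorem wasserstein2_le_defects:
  "wasserstein2 (distr M borel X) std_gaussian
    \<le> ennreal (sqrt ((\<integral>\<omega>. (norm (R \<omega>))\<^sup>2 \<partial>M) + (\<integral>\<omega>. (norm (T \<omega> - mat 1))\<^sup>2 \<partial>M)))"
proof (rule wasserstein2_le_of_mmse_bound)
  fix s :: real assume s: "0 < s"
  show "(second_moment + s * real CARD('d)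
      - ((\<integral>\<omega>. (norm (R \<omega>))\<^sup>2 \<partial>M) + s * (\<integral>\<omega>. (norm (T \<omega> - mat 1))\<^sup>2 \<partial>M))) / (1 + s)\<^sup>2 \<le> mmse s"
    unfolding mmse_mean_excess[OF s] diff_divide_distrib using mean_excess_bound[OF s] by linarith
qed

end

section \<open>The Gibbs measure\<close>

lemma gderiv_gradient:
  assumes "C1 f"
  shows "GDERIV f x :> gradient f x" and "continuous_on UNIV (gradient f)"
proof -
  obtain D where D: "\<And>x. GDERIV f x :> D x" "continuous_on UNIV D" using assms by (auto simp: C1_def)
  have "gradient f = D" by (rule ext) (rule gradient_eqI[OF D(1)])
  then show "GDERIV f x :> gradient f x" "continuous_on UNIV (gradient f)" using D by simp_all
qed

lemma C1_continuous: "C1 f \<Longrightarrow> continuous_on UNIV f"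
  using gderiv_gradient(1)[of f] unfolding gderiv_def
  by (intro continuous_at_imp_continuous_on ballI has_derivative_continuous) blast

lemma C2_continuous:
  assumes "C2 f" shows "continuous_on UNIV (laplacian f)" "continuous_on UNIV (gradient f)" "continuous_on UNIV f"
proof -
  have 1: "C1 f" "\<And>i. C1 (\<lambda>x. gradient f x $ i)" using assms by (auto simp: C2_def)
  show "continuous_on UNIV (gradient f)" "continuous_on UNIV f"
    using 1 gderiv_gradient(2) C1_continuous by blast+
  have "continuous_on UNIV (\<lambda>x. \<Sum>i\<in>UNIV. gradient (\<lambda>y. gradient f y $ i) x $ i)"
    by (intro continuous_intros gderiv_gradient(2) 1)
  then show "continuous_on UNIV (laplacian f)" by (simp add: laplacian_def[abs_def])
qed

lemma C2_generator_continuous: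
  assumes "C1 H" "C2 f" shows "continuous_on UNIV (generator H f)"
  unfolding generator_def[abs_def]
  by (intro continuous_intros gderiv_gradient(2) C2_continuous assms)

text \<open>The diffusion property of \<open>\<Gamma>\<close> in the form needed for the Stein identity.\<close>
lemma gderiv_compose:
  fixes F :: "real^'n \<Rightarrow> real^'d"
  assumes F: "\<And>k. GDERIV (\<lambda>x. F x $ k) x :> G k" and \<psi>: "GDERIV \<psi> (F x) :> D"
  shows "GDERIV (\<lambda>x. \<psi> (F x)) x :> (\<Sum>l\<in>UNIV. (D $ l) *\<^sub>R G l)"
proof -
  have "(F has_derivative (\<lambda>h. \<chi> k. h \<bullet> G k)) (at x)"
  proof (subst has_derivative_componentwise_within, intro ballI)
    fix b :: "real^'d" assume "b \<in> Basis"
    then obtain k where b: "b = axis k 1" by (auto simp: Basis_vec_def)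
    show "((\<lambda>x. F x \<bullet> b) has_derivative (\<lambda>h. (\<chi> k. h \<bullet> G k) \<bullet> b)) (at x)"
      using F[of k] by (simp add: b inner_axis gderiv_def)
  qed
  from has_derivative_compose[OF this \<psi>[unfolded gderiv_def]]
  have "((\<lambda>x. \<psi> (F x)) has_derivative (\<lambda>h. (\<chi> k. h \<bullet> G k) \<bullet> D)) (at x)" .
  moreover have "(\<lambda>h. (\<chi> k. h \<bullet> G k) \<bullet> D) = (\<lambda>h. h \<bullet> (\<Sum>l\<in>UNIV. (D $ l) *\<^sub>R G l))"
    by (simp add: fun_eq_iff inner_vec_def[of "vec_lambda _"] inner_sum_right mult.commute)
  ultimately show ?thesis unfolding gderiv_def by simp
qed

lemma prob_space_gibbs:
  fixes H :: "real^'n \<Rightarrow> real"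
  assumes H: "C1 H" and Z: "integrable lborel (\<lambda>x. exp (- H x))"
  shows "prob_space (gibbs H)"
proof
  let ?Z = "\<integral>y. exp (- H y) \<partial>lborel"
  have [measurable]: "H \<in> borel_measurable borel"
    using C1_continuous[OF H] by (rule borel_measurable_continuous_onI)
  have "?Z \<noteq> 0"
  proof
    assume "?Z = 0"
    then have "AE x in (lborel :: (real^'n) measure). False"
      by (subst (asm) integral_nonneg_eq_0_iff_AE[OF Z]) simp_all
    then have "emeasure lborel (UNIV :: (real^'n) set) = 0"
      by (simp add: AE_iff_null null_sets_def)
    then show False by simp
  qed
  moreover have "0 \<le> ?Z" by simp
  ultimately have Zp: "0 < ?Z" by linarith
  have "emeasure (gibbs H) (space (gibbs H)) = (\<integral>\<^sup>+x. ennreal (exp (- H x) / ?Z) \<partial>lborel)"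
    unfolding gibbs_def by (simp add: emeasure_density)
  also have "\<dots> = ennreal (\<integral>x. exp (- H x) / ?Z \<partial>lborel)"
    using Z Zp by (intro nn_integral_eq_integral) simp_all
  also have "\<dots> = 1" using Zp by simp
  finally show "emeasure (gibbs H) (space (gibbs H)) = 1" .
qed

lemma sets_gibbs [simp, measurable_cong]: "sets (gibbs H) = sets borel"
  by (simp add: gibbs_def)

lemma diag_matrix_mult_vec_nth: "(diag_matrix a *v v) $ k = a k * v $ k"
  by (simp add: diag_matrix_def matrix_vector_mult_def mult_delta_left)

lemma diag_matrix_mult_nth: "(diag_matrix a ** B) $ k $ l = a k * B $ k $ l"
  by (simp add: diag_matrix_def matrix_matrix_mult_def mult_delta_left)

lemma matrix_inv_diag_matrix:
  fixes \<kappa> :: "'d::finite \<Rightarrow> real"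
  assumes "\<And>k. \<kappa> k \<noteq> 0"
  shows "matrix_inv (diag_matrix \<kappa>) = diag_matrix (\<lambda>k. 1 / \<kappa> k)"
proof -
  have *: "diag_matrix a ** diag_matrix b = diag_matrix (\<lambda>k. a k * b k)" for a b :: "'d \<Rightarrow> real"
    by (simp add: vec_eq_iff diag_matrix_mult_nth) (simp add: diag_matrix_def)
  have 1: "diag_matrix (\<lambda>_::'d. 1) = mat 1" unfolding diag_matrix_def mat_def ..
  have inv: "diag_matrix \<kappa> ** diag_matrix (\<lambda>k. 1 / \<kappa> k) = mat 1"
    "diag_matrix (\<lambda>k. 1 / \<kappa> k) ** diag_matrix \<kappa> = mat 1"
    unfolding * using assms by (simp_all add: 1)
  then have "invertible (diag_matrix \<kappa>)" unfolding invertible_def by blast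
  then have "matrix_inv (diag_matrix \<kappa>) ** diag_matrix \<kappa> = mat 1"
    unfolding matrix_inv_def invertible_def by (rule someI2_ex) simp
  then have "matrix_inv (diag_matrix \<kappa>) ** (diag_matrix \<kappa> ** diag_matrix (\<lambda>k. 1 / \<kappa> k)) = diag_matrix (\<lambda>k. 1 / \<kappa> k)"
    by (simp add: matrix_mul_assoc)
  then show ?thesis by (simp add: inv)
qed

(* The norm on real^'d^'d is the Euclidean norm of the Euclidean norms of the rows, that is,
   the Hilbert-Schmidt norm. *)
theorem proposition2p1:
  fixes H :: "real^'n \<Rightarrow> real"
    and F :: "real^'n \<Rightarrow> real^'d"
    and \<kappa> :: "'d \<Rightarrow> real"
  assumes H_C1: "C1 H"
    and Z_finite: "integrable lborel (\<lambda>x. exp (- H x))"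
    and integration_by_parts:
      "\<And>f g :: real^'n \<Rightarrow> real.
         C1 f \<Longrightarrow> C2 g \<Longrightarrow>
         square_integrable (gibbs H) f \<Longrightarrow>
         square_integrable (gibbs H) (\<lambda>x. norm (gradient f x)) \<Longrightarrow>
         square_integrable (gibbs H) (\<lambda>x. norm (gradient g x)) \<Longrightarrow>
         square_integrable (gibbs H) (generator H g) \<Longrightarrow>
         (\<integral>x. f x * (- generator H g x) \<partial>gibbs H) = (\<integral>x. carre_du_champ f g x \<partial>gibbs H)"
    and F_C2: "\<And>k. C2 (\<lambda>x. F x $ k)"
    and F_L2: "square_integrable (gibbs H) F"
    and kappa_pos: "\<And>k. \<kappa> k > 0"
  shows "wasserstein2 (distr (gibbs H) borel F) std_gaussian
    \<le> ennreal_sqrt (\<integral>\<^sup>+x. ennreal ((norm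
          (F x + matrix_inv (diag_matrix \<kappa>) *v generator_vec H F x))\<^sup>2) \<partial>gibbs H)
      + ennreal_sqrt (\<integral>\<^sup>+x. ennreal ((norm
          (mat 1 - matrix_inv (diag_matrix \<kappa>) ** carre_du_champ_matrix F x))\<^sup>2) \<partial>gibbs H)"
proof -
  let ?M = "gibbs H"
  define R where "R = (\<lambda>x. F x + matrix_inv (diag_matrix \<kappa>) *v generator_vec H F x)"
  define T where "T = (\<lambda>x. matrix_inv (diag_matrix \<kappa>) ** carre_du_champ_matrix F x)"
  let ?A2 = "\<integral>\<^sup>+x. ennreal ((norm (R x))\<^sup>2) \<partial>?M" and ?B2 = "\<integral>\<^sup>+x. ennreal ((norm (mat 1 - T x))\<^sup>2) \<partial>?M"
  have inv: "matrix_inv (diag_matrix \<kappa>) = diag_matrix (\<lambda>k. 1 / \<kappa> k)"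
    using kappa_pos by (intro matrix_inv_diag_matrix) (simp add: less_imp_neq[symmetric])
  have R_nth: "R x $ k = F x $ k + generator H (\<lambda>y. F y $ k) x / \<kappa> k" for x k
    unfolding R_def inv by (simp add: diag_matrix_mult_vec_nth generator_vec_def)
  have T_nth: "T x $ k $ l = carre_du_champ (\<lambda>y. F y $ k) (\<lambda>y. F y $ l) x / \<kappa> k" for x k l
    unfolding T_def inv by (simp add: diag_matrix_mult_nth carre_du_champ_matrix_def)
  have F_C1: "C1 (\<lambda>x. F x $ k)" for k using F_C2 by (simp add: C2_def)
  interpret prob_space ?M by (rule prob_space_gibbs[OF H_C1 Z_finite])
  have cont_to_M: "f \<in> borel_measurable ?M" if "continuous_on UNIV f" for f :: "real^'n \<Rightarrow> 'z::topological_space"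
    using borel_measurable_continuous_onI[OF that] by simp
  have F_cont: "continuous_on UNIV F"
    using C2_continuous(3)[OF F_C2] by (subst continuous_on_componentwise) (auto simp: Basis_vec_def inner_axis)
  have gF_cont: "continuous_on UNIV (gradient (\<lambda>y. F y $ k))" for k by (rule C2_continuous(2)[OF F_C2])
  have LF_cont: "continuous_on UNIV (generator H (\<lambda>y. F y $ k))" for k
    by (rule C2_generator_continuous[OF H_C1 F_C2])
  have R_cont: "continuous_on UNIV R"
  proof -
    have "continuous_on UNIV (\<lambda>x. R x $ k)" for k
      unfolding R_nth using kappa_pos
      by (intro continuous_intros LF_cont C2_continuous(3)[OF F_C2]) (simp add: less_imp_neq[symmetric])
    then show ?thesis by (subst continuous_on_componentwise) (auto simp: Basis_vec_def inner_axis)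
  qed
  have T_cont: "continuous_on UNIV T"
  proof -
    have "continuous_on UNIV (\<lambda>x. T x $ k $ l)" for k l
      unfolding T_nth carre_du_champ_def using kappa_pos
      by (intro continuous_intros gF_cont) (simp add: less_imp_neq[symmetric])
    then show ?thesis by (subst continuous_on_componentwise) (auto simp: Basis_vec_def inner_axis)
  qed
  show ?thesis
  proof (cases "?A2 = \<top> \<or> ?B2 = \<top>")
    case True
    then have top: "ennreal_sqrt ?A2 + ennreal_sqrt ?B2 = \<top>" by (auto simp: ennreal_sqrt_def)
    have "wasserstein2 (distr ?M borel F) std_gaussian \<le> ennreal_sqrt ?A2 + ennreal_sqrt ?B2"
      unfolding top by (rule top_greatest)
    then show ?thesis unfolding R_def T_def .
  next
    case False
    have R_L2: "integrable ?M (\<lambda>x. (norm (R x))\<^sup>2)"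
      using False cont_to_M[OF R_cont]
      by (intro integrableI_bounded) (auto simp: less_top)
    have T_L2': "integrable ?M (\<lambda>x. (norm (mat 1 - T x))\<^sup>2)"
      using False cont_to_M[OF T_cont]
      by (intro integrableI_bounded) (auto simp: less_top)
    then have T_L2: "integrable ?M (\<lambda>x. (norm (T x - mat 1))\<^sup>2)" by (simp add: norm_minus_commute)
    have F_L2': "integrable ?M (\<lambda>x. (norm (F x))\<^sup>2)" using F_L2 by (simp add: square_integrable_def)
    have nth_L2: "integrable ?M (\<lambda>x. (norm (f x $ k))\<^sup>2)"
      if "continuous_on UNIV f" "integrable ?M (\<lambda>x. (norm (f x))\<^sup>2)"
      for f :: "real^'n \<Rightarrow> ('z::euclidean_space)^'d" and k
    proof (rule Bochner_Integration.integrable_bound[OF that(2)])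
      show "(\<lambda>x. (norm (f x $ k))\<^sup>2) \<in> borel_measurable ?M"
        by (intro cont_to_M continuous_intros that)
      show "AE x in ?M. norm ((norm (f x $ k))\<^sup>2) \<le> norm ((norm (f x))\<^sup>2)"
        by (intro AE_I2) (simp add: power_mono Finite_Cartesian_Product.norm_nth_le)
    qed
    \<comment> \<open>\<open>LF = K (R - F)\<close> is square integrable because \<open>R\<close> and \<open>F\<close> are.\<close>
    have LF_L2: "square_integrable ?M (generator H (\<lambda>y. F y $ k))" for k
    proof -
      have eq: "generator H (\<lambda>y. F y $ k) x = \<kappa> k *\<^sub>R (R x $ k + (-1) *\<^sub>R (F x $ k))" for x
        using kappa_pos[of k] unfolding R_nth by simp
      have "integrable ?M (\<lambda>x. (norm (R x $ k + (-1) *\<^sub>R (F x $ k)))\<^sup>2)"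
        by (intro integrable_norm_add_L2 integrable_norm_scaleR_L2 nth_L2 R_cont F_cont R_L2 F_L2')
           (intro cont_to_M continuous_intros R_cont F_cont)+
      from integrable_norm_scaleR_L2[OF this, of "\<kappa> k"]
      have "integrable ?M (\<lambda>x. (norm (generator H (\<lambda>y. F y $ k) x))\<^sup>2)" unfolding eq .
      then show ?thesis unfolding square_integrable_def using cont_to_M[OF LF_cont] by blast
    qed
    \<comment> \<open>The diagonal entries of \<open>T\<close> are \<open>|\<nabla>F\<^sub>k|\<^sup>2 / \<kappa>\<^sub>k\<close>, and \<open>T - Id\<close> is integrable.\<close>
    have gF_L2: "square_integrable ?M (\<lambda>x. norm (gradient (\<lambda>y. F y $ k) x))" for k
    proof -
      have "integrable ?M (\<lambda>x. (norm ((T x - mat 1) $ k))\<^sup>2)"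
        by (intro nth_L2 T_L2 continuous_intros T_cont)
      then have "integrable ?M (\<lambda>x. (T x - mat 1) $ k)"
        by (rule integrable_of_square[rotated]) (intro cont_to_M continuous_intros T_cont)
      then have "integrable ?M (\<lambda>x. (T x - mat 1) $ k \<bullet> axis k 1)" by (rule integrable_inner_left)
      then have "integrable ?M (\<lambda>x. \<kappa> k * ((T x - mat 1) $ k $ k + 1))" by (simp add: inner_axis)
      moreover have "\<kappa> k * ((T x - mat 1) $ k $ k + 1) = (norm (gradient (\<lambda>y. F y $ k) x))\<^sup>2" for x
        using kappa_pos[of k] by (simp add: T_nth mat_def carre_du_champ_def dot_square_norm)
      ultimately have "integrable ?M (\<lambda>x. (norm (gradient (\<lambda>y. F y $ k) x))\<^sup>2)" by (simp only:)
      then show ?thesis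
        unfolding square_integrable_def using cont_to_M[OF continuous_on_norm[OF gF_cont]] by simp
    qed
    \<comment> \<open>Integration by parts with \<open>f = \<psi> \<circ> F\<close> and \<open>g = F\<^sub>k\<close>.\<close>
    interpret approximate_stein_identity ?M F R T
    proof
      show "F \<in> borel_measurable ?M" "R \<in> borel_measurable ?M" "T \<in> borel_measurable ?M"
        using cont_to_M F_cont R_cont T_cont by blast+
      fix \<psi> :: "real^'d \<Rightarrow> real" and D K k
      assume g: "\<And>z. GDERIV \<psi> z :> D z" and Dc: "continuous_on UNIV D"
        and b: "\<And>z. \<bar>\<psi> z\<bar> \<le> K" and Db: "\<And>z. norm (D z) \<le> K"
      let ?f = "\<lambda>x. \<psi> (F x)" and ?Lk = "generator H (\<lambda>y. F y $ k)"
      let ?G = "\<lambda>x. \<Sum>l\<in>UNIV. (D (F x) $ l) *\<^sub>R gradient (\<lambda>y. F y $ l) x"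
      have fd: "GDERIV ?f x :> ?G x" for x
        by (rule gderiv_compose[OF gderiv_gradient(1)[OF F_C1] g])
      have gf: "gradient ?f = ?G" by (rule ext) (rule gradient_eqI[OF fd])
      have DF_cont: "continuous_on UNIV (\<lambda>x. D (F x))"
        using continuous_on_compose2[OF Dc F_cont] by simp
      have G_cont: "continuous_on UNIV ?G" by (intro continuous_intros DF_cont gF_cont)
      have f_C1: "C1 ?f" unfolding C1_def by (intro exI[of _ ?G] conjI allI fd G_cont)
      have f_meas: "?f \<in> borel_measurable ?M" by (rule cont_to_M[OF C1_continuous[OF f_C1]])
      have K0: "0 \<le> K" using b[of 0] by linarith
      have f_L2: "square_integrable ?M ?f"
      proof -
        have "integrable ?M (\<lambda>x. (norm (?f x))\<^sup>2)"
        proof (rule Bochner_Integration.integrable_bound)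
          show "integrable ?M (\<lambda>_. K\<^sup>2)" by simp
          show "AE x in ?M. norm ((norm (?f x))\<^sup>2) \<le> norm (K\<^sup>2)"
            using power_mono[OF b, of _ 2] by (intro AE_I2) simp
        qed (use f_meas in measurable)
        then show ?thesis using f_meas by (simp add: square_integrable_def)
      qed
      have G_L2: "integrable ?M (\<lambda>x. (norm (?G x))\<^sup>2)"
      proof (rule Bochner_Integration.integrable_bound)
        let ?w = "\<lambda>x. \<Sum>l\<in>UNIV. norm (gradient (\<lambda>y. F y $ l) x)"
        have "integrable ?M (\<lambda>x. (norm (\<Sum>l\<in>I. norm (gradient (\<lambda>y. F y $ l) x)))\<^sup>2)" for I :: "'d set"
        proof (induction I rule: infinite_finite_induct)
          case (insert l I)
          have "integrable ?M (\<lambda>x. (norm (norm (gradient (\<lambda>y. F y $ l) x) + (\<Sum>l\<in>I. norm (gradient (\<lambda>y. F y $ l) x))))\<^sup>2)"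
            by (intro integrable_norm_add_L2 insert.IH cont_to_M continuous_intros gF_cont)
               (use gF_L2[of l] in \<open>simp add: square_integrable_def\<close>)
          then show ?case using insert.hyps by simp
        qed simp_all
        from integrable_norm_scaleR_L2[OF this[of UNIV], of K]
        show "integrable ?M (\<lambda>x. (norm (K *\<^sub>R ?w x))\<^sup>2)" .
        have le: "norm (?G x) \<le> K * ?w x" for x
        proof -
          have "norm (?G x) \<le> (\<Sum>l\<in>UNIV. norm ((D (F x) $ l) *\<^sub>R gradient (\<lambda>y. F y $ l) x))"
            by (rule norm_sum)
          also have "\<dots> \<le> (\<Sum>l\<in>UNIV. K * norm (gradient (\<lambda>y. F y $ l) x))"
          proof (rule sum_mono)
            fix l
            have "\<bar>D (F x) $ l\<bar> \<le> K" using component_le_norm_cart[of "D (F x)" l] Db[of "F x"] by linarith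
            then show "norm ((D (F x) $ l) *\<^sub>R gradient (\<lambda>y. F y $ l) x) \<le> K * norm (gradient (\<lambda>y. F y $ l) x)"
              by (simp add: mult_right_mono)
          qed
          finally show ?thesis by (simp add: sum_distrib_left)
        qed
        show "AE x in ?M. norm ((norm (?G x))\<^sup>2) \<le> norm ((norm (K *\<^sub>R ?w x))\<^sup>2)"
        proof (intro AE_I2)
          fix x
          have "(norm (?G x))\<^sup>2 \<le> (K * ?w x)\<^sup>2" by (rule power_mono[OF le]) simp
          then show "norm ((norm (?G x))\<^sup>2) \<le> norm ((norm (K *\<^sub>R ?w x))\<^sup>2)" by simp
        qed
      qed (intro cont_to_M continuous_intros G_cont)
      have gf_L2: "square_integrable ?M (\<lambda>x. norm (gradient ?f x))"
        unfolding gf square_integrable_def using G_L2 cont_to_M[OF continuous_on_norm[OF G_cont]] by simp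
      have ibp: "(\<integral>x. ?f x * (- ?Lk x) \<partial>?M) = (\<integral>x. carre_du_champ ?f (\<lambda>y. F y $ k) x \<partial>?M)"
        by (rule integration_by_parts[OF f_C1 F_C2 f_L2 gf_L2 gF_L2 LF_L2])
      have Td: "T x $ k \<bullet> D (F x) = carre_du_champ ?f (\<lambda>y. F y $ k) x / \<kappa> k" for x
      proof -
        have "carre_du_champ ?f (\<lambda>y. F y $ k) x
          = (\<Sum>l\<in>UNIV. D (F x) $ l * carre_du_champ (\<lambda>y. F y $ k) (\<lambda>y. F y $ l) x)"
          unfolding carre_du_champ_def gf inner_sum_left inner_scaleR_left
          by (intro sum.cong refl arg_cong2[where f="(*)"] inner_commute)
        then show ?thesis
          by (simp add: inner_vec_def[of "T x $ k"] T_nth sum_divide_distrib mult.commute)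
      qed
      have nth1: "integrable ?M (\<lambda>x. v x * ?f x)"
        if "integrable ?M (\<lambda>x. (norm (v x))\<^sup>2)" "continuous_on UNIV v" for v :: "real^'n \<Rightarrow> real"
      proof -
        have "integrable ?M (\<lambda>x. v x \<bullet> ?f x)"
          using f_L2 that by (intro integrable_inner_L2 cont_to_M) (simp_all add: square_integrable_def C1_continuous[OF f_C1])
        then show ?thesis by simp
      qed
      have iR: "integrable ?M (\<lambda>x. R x $ k * ?f x)"
        by (intro nth1 nth_L2 R_L2 R_cont continuous_intros)
      have iL: "integrable ?M (\<lambda>x. ?Lk x * ?f x)"
        using LF_L2[of k] by (intro nth1 LF_cont) (simp add: square_integrable_def)
      have "(\<integral>x. F x $ k * ?f x \<partial>?M) = (\<integral>x. R x $ k * ?f x - (?Lk x * ?f x) / \<kappa> k \<partial>?M)"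
        unfolding R_nth by (simp add: algebra_simps)
      also have "\<dots> = (\<integral>x. R x $ k * ?f x \<partial>?M) - (\<integral>x. ?Lk x * ?f x \<partial>?M) / \<kappa> k"
        using iR iL by simp
      also have "\<dots> = (\<integral>x. R x $ k * ?f x \<partial>?M) + (\<integral>x. T x $ k \<bullet> D (F x) \<partial>?M)"
      proof -
        have "(\<integral>x. carre_du_champ ?f (\<lambda>y. F y $ k) x \<partial>?M) = - (\<integral>x. ?Lk x * ?f x \<partial>?M)"
          unfolding ibp[symmetric] by (simp add: mult.commute)
        then show ?thesis unfolding Td by simp
      qed
      finally show "(\<integral>x. F x $ k * ?f x \<partial>?M) = (\<integral>x. R x $ k * ?f x \<partial>?M) + (\<integral>x. T x $ k \<bullet> D (F x) \<partial>?M)" .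
    qed (fact F_L2' R_L2 T_L2)+
    let ?a = "\<integral>x. (norm (R x))\<^sup>2 \<partial>?M" and ?b = "\<integral>x. (norm (T x - mat 1))\<^sup>2 \<partial>?M"
    have a: "?A2 = ennreal ?a" by (rule nn_integral_eq_integral[OF R_L2]) simp
    have b: "?B2 = ennreal ?b" using nn_integral_eq_integral[OF T_L2] by (simp add: norm_minus_commute)
    have "wasserstein2 (distr ?M borel F) std_gaussian \<le> ennreal (sqrt (?a + ?b))"
      by (rule wasserstein2_le_defects)
    also have "\<dots> \<le> ennreal (sqrt ?a + sqrt ?b)" by (intro ennreal_leI sqrt_add_le_add_sqrt) simp_all
    also have "\<dots> = ennreal_sqrt ?A2 + ennreal_sqrt ?B2" unfolding a b by (simp add: ennreal_sqrt_ennreal)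
    finally show ?thesis unfolding R_def T_def .
  qed
qed

end
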